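(* Let $V$ be a discrete valuation ring with quotient field $F$, let $K/F$ be a finite Galois extension with group $G$, let $S$ be the integral closure of $V$ in $K$, and assume $S$ is unramified over $V$. Let $f\in Z^2(G,K\setminus\{0\})$ be a normalized two-cocycle with $f(G\times G)\subseteq S\setminus\{0\}$, and let $A_f=\sum_{\sigma\in G}Sx_\sigma$ be the associated crossed-product order in $\Sigma_f$. Then: (1) $A_f$ is a maximal order (that is, a maximal $V$-order in $\Sigma_f$) if and only if for every maximal ideal $M$ of $S$, $f(\tau,\tau^{-1})\notin M^2$ for all $\tau\in G$, and there exists a set of right coset representatives $g_1,g_2,\ldots,g_r$ of $D_M$ in $G$ (i.e., $G$ is the disjoint union $\bigcup_i D_Mg_i$) such that $f(g_i,g_i^{-1})\notin M$ for all $i$. (2) If $S$ is a discrete valuation ring, then $A_f$ is a maximal order if and only if $f(\tau,\tau^{-1})\notin J(S)^2$ for all $\tau\in G$.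
   Context: A normalized two-cocycle is a map $f:G\times G\to K\setminus\{0\}$ with $\sigma(f(\tau,\gamma))\,f(\sigma,\tau\gamma)=f(\sigma,\tau)\,f(\sigma\tau,\gamma)$ and $f(1,\sigma)=f(\sigma,1)=1$ for all $\sigma,\tau,\gamma\in G$. It is not required that the values of $f$ be units of $S$. The crossed-product algebra is $\Sigma_f=(K/F,G,f)=\bigoplus_{\sigma\in G}Kx_\sigma$, with multiplication determined by $x_\sigma a=\sigma(a)x_\sigma$ ($a\in K$) and $x_\sigma x_\tau=f(\sigma,\tau)x_{\sigma\tau}$. The crossed-product order is the subring $A_f=\bigoplus_{\sigma\in G}Sx_\sigma$ of $\Sigma_f$; it is a $V$-order in $\Sigma_f$ with identity $1=x_1$. "Unramified" has its standard meaning: every maximal ideal of $S$ has ramification index $1$ over $V$ (so $J(V)S=J(S)$) and separable residue field extension. $J(R)$ denotes the Jacobson radical of a ring $R$. For a maximal ideal $M$ of $S$, $D_M=\{\sigma\in G\mid \sigma(M)=M\}$ is the decomposition group of $M$. In (1), the choice of coset representatives may depend on $M$. *)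

theory Defs
  imports "HOL-Algebra.Algebraic_Closure_Type" "HOL-Algebra.Ideal_Product"
begin

section \<open>Commutative rings inside a field\<close>

text \<open>
  The field \<open>K\<close> is the whole type \<open>'k\<close>; its subrings are sets of elements of \<open>'k\<close>, and
  \<open>ring_on R\<close> is such a subset as an object of \<open>HOL-Algebra\<close>.
\<close>

abbreviation ring_on :: "'k::field set \<Rightarrow> 'k ring" where
  "ring_on R \<equiv> ring_of_type_algebra\<lparr>carrier := R\<rparr>"

definition discrete_valuation_ring :: "('a, 'b) ring_scheme \<Rightarrow> bool" where
  "discrete_valuation_ring R \<longleftrightarrow>
     principal_domain R \<and> (\<exists>!M. maximalideal M R) \<and> \<not> field R"

definition is_quotient_field :: "'k::field set \<Rightarrow> 'k set \<Rightarrow> bool" where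
  "is_quotient_field V F \<longleftrightarrow> F = {a / b | a b. a \<in> V \<and> b \<in> V \<and> b \<noteq> 0}"

definition integral_closure :: "'k::field set \<Rightarrow> 'k set" where
  "integral_closure V =
     {x. \<exists>p. Polynomial.lead_coeff p = 1 \<and> set (Polynomial.coeffs p) \<subseteq> V \<and> poly p x = 0}"

text \<open>Only meant for commutative rings, where one-sided and two-sided ideals coincide.\<close>

definition jacobson_radical :: "('a, 'b) ring_scheme \<Rightarrow> 'a set" where
  "jacobson_radical R = carrier R \<inter> \<Inter>{M. maximalideal M R}"

abbreviation ideal_power :: "('a, 'b) ring_scheme \<Rightarrow> 'a set \<Rightarrow> nat \<Rightarrow> 'a set" where
  "ideal_power R I n \<equiv> I [^]\<^bsub>ideals_set R\<^esub> n"

section \<open>Unramified extensions\<close>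

text \<open>
  Polynomials in \<open>HOL-Algebra\<close> are lists of coefficients, the leading one first.  A polynomial is
  separable when it is coprime to its formal derivative, and an algebraic extension is separable
  when the minimal polynomial of each of its elements is.
\<close>

definition (in ring) formal_derivative :: "'a list \<Rightarrow> 'a list" where
  "formal_derivative p =
     normalize (map (\<lambda>i. add_pow R (Suc i) (coeff p (Suc i))) (rev [0..<Polynomials.degree p]))"

definition (in ring) separable_poly :: "'a set \<Rightarrow> 'a list \<Rightarrow> bool" where
  "separable_poly k p \<longleftrightarrow>
     (\<exists>u \<in> carrier (k[X]). \<exists>v \<in> carrier (k[X]).
        (u \<otimes>\<^bsub>k[X]\<^esub> p) \<oplus>\<^bsub>k[X]\<^esub> (v \<otimes>\<^bsub>k[X]\<^esub> formal_derivative p) = \<one>\<^bsub>k[X]\<^esub>)"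

definition (in ring) separable_extension :: "'a set \<Rightarrow> bool" where
  "separable_extension k \<longleftrightarrow> (\<forall>x \<in> carrier R. algebraic k x \<and> separable_poly k (Irr k x))"

text \<open>
  The ramification index over \<open>V\<close> of a maximal ideal \<open>M\<close> of \<open>S\<close> is the exponent of \<open>M\<close> in \<open>J(V)S\<close>,
  that is, the largest \<open>e\<close> with \<open>J(V) \<subseteq> M\<^sup>e\<close>.
\<close>

definition has_ramification_index :: "'k::field set \<Rightarrow> 'k set \<Rightarrow> 'k set \<Rightarrow> nat \<Rightarrow> bool" where
  "has_ramification_index V S M e \<longleftrightarrow>
     jacobson_radical (ring_on V) \<subseteq> ideal_power (ring_on S) M e \<and>
     \<not> jacobson_radical (ring_on V) \<subseteq> ideal_power (ring_on S) M (Suc e)"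

text \<open>The residue field of \<open>V\<close> is embedded in \<open>S/M\<close> as the set of cosets of elements of \<open>V\<close>.\<close>

definition unramified :: "'k::field set \<Rightarrow> 'k set \<Rightarrow> bool" where
  "unramified V S \<longleftrightarrow>
     (\<forall>M. maximalideal M (ring_on S) \<longrightarrow>
        has_ramification_index V S M 1 \<and>
        ring.separable_extension (ring_on S Quot M) ((\<lambda>v. M +>\<^bsub>ring_on S\<^esub> v) ` V))"

section \<open>Galois group\<close>

definition galois_group :: "'k::field set \<Rightarrow> ('k \<Rightarrow> 'k) monoid" where
  "galois_group F =
     \<lparr>carrier = {\<sigma> \<in> ring_iso ring_of_type_algebra ring_of_type_algebra. \<forall>x\<in>F. \<sigma> x = x},
      monoid.mult = (\<circ>), one = id\<rparr>"

definition finite_galois :: "'k::field set \<Rightarrow> bool" where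
  "finite_galois F \<longleftrightarrow>
     subfield F ring_of_type_algebra \<and>
     ring.finite_dimension (ring_of_type_algebra :: 'k ring) F UNIV \<and>
     {x. \<forall>\<sigma> \<in> carrier (galois_group F). \<sigma> x = x} = F"

definition decomposition_group :: "('k \<Rightarrow> 'k) monoid \<Rightarrow> 'k set \<Rightarrow> ('k \<Rightarrow> 'k) set" where
  "decomposition_group G M = {\<sigma> \<in> carrier G. \<sigma> ` M = M}"

definition right_coset_representatives ::
  "('g, 'b) monoid_scheme \<Rightarrow> 'g set \<Rightarrow> 'g set \<Rightarrow> bool" where
  "right_coset_representatives G D T \<longleftrightarrow>
     T \<subseteq> carrier G \<and> (\<Union>g\<in>T. D #>\<^bsub>G\<^esub> g) = carrier G \<and>
     (\<forall>g\<in>T. \<forall>h\<in>T. g \<noteq> h \<longrightarrow> (D #>\<^bsub>G\<^esub> g) \<inter> (D #>\<^bsub>G\<^esub> h) = {})"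

section \<open>Crossed products\<close>

definition normalized_cocycle ::
  "('k \<Rightarrow> 'k::field) monoid \<Rightarrow> (('k \<Rightarrow> 'k) \<Rightarrow> ('k \<Rightarrow> 'k) \<Rightarrow> 'k) \<Rightarrow> bool" where
  "normalized_cocycle G f \<longleftrightarrow>
     (\<forall>\<sigma>\<in>carrier G. \<forall>\<tau>\<in>carrier G. f \<sigma> \<tau> \<noteq> 0) \<and>
     (\<forall>\<sigma>\<in>carrier G. \<forall>\<tau>\<in>carrier G. \<forall>\<gamma>\<in>carrier G.
        \<sigma> (f \<tau> \<gamma>) * f \<sigma> (\<tau> \<otimes>\<^bsub>G\<^esub> \<gamma>) = f \<sigma> \<tau> * f (\<sigma> \<otimes>\<^bsub>G\<^esub> \<tau>) \<gamma>) \<and>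
     (\<forall>\<sigma>\<in>carrier G. f \<one>\<^bsub>G\<^esub> \<sigma> = 1 \<and> f \<sigma> \<one>\<^bsub>G\<^esub> = 1)"

text \<open>
  The element \<open>\<Sum>\<sigma>. a\<^sub>\<sigma> x\<^sub>\<sigma>\<close> is the function \<open>\<sigma> \<mapsto> a\<^sub>\<sigma>\<close>, extended by \<open>0\<close> outside the (finite)
  group \<open>G\<close>.  The product comes from
  \<open>(a\<^sub>\<sigma> x\<^sub>\<sigma>) (b\<^sub>\<tau> x\<^sub>\<tau>) = a\<^sub>\<sigma> \<sigma>(b\<^sub>\<tau>) f(\<sigma>, \<tau>) x\<^sub>\<sigma>\<^sub>\<tau>\<close>.
\<close>

definition crossed_product ::
  "('k \<Rightarrow> 'k::field) monoid \<Rightarrow> (('k \<Rightarrow> 'k) \<Rightarrow> ('k \<Rightarrow> 'k) \<Rightarrow> 'k) \<Rightarrow> ('k, ('k \<Rightarrow> 'k) \<Rightarrow> 'k) module"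
where
  "crossed_product G f =
     \<lparr>carrier = {a. \<forall>\<sigma>. \<sigma> \<notin> carrier G \<longrightarrow> a \<sigma> = 0},
      monoid.mult = (\<lambda>a b \<rho>. \<Sum>(\<sigma>, \<tau>) \<in> {(\<sigma>, \<tau>). \<sigma> \<in> carrier G \<and> \<tau> \<in> carrier G \<and> \<sigma> \<otimes>\<^bsub>G\<^esub> \<tau> = \<rho>}.
                a \<sigma> * \<sigma> (b \<tau>) * f \<sigma> \<tau>),
      monoid.one = (\<lambda>\<sigma>. if \<sigma> = \<one>\<^bsub>G\<^esub> then 1 else 0),
      ring.zero = (\<lambda>\<sigma>. 0),
      ring.add = (\<lambda>a b \<sigma>. a \<sigma> + b \<sigma>),
      module.smult = (\<lambda>c a \<sigma>. c * a \<sigma>)\<rparr>"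

definition crossed_product_order ::
  "'k::field set \<Rightarrow> ('k \<Rightarrow> 'k) monoid \<Rightarrow> (('k \<Rightarrow> 'k) \<Rightarrow> ('k \<Rightarrow> 'k) \<Rightarrow> 'k) \<Rightarrow> (('k \<Rightarrow> 'k) \<Rightarrow> 'k) set"
where
  "crossed_product_order S G f =
     {a \<in> carrier (crossed_product G f). \<forall>\<sigma>\<in>carrier G. a \<sigma> \<in> S}"

section \<open>Orders\<close>

definition module_span :: "'k set \<Rightarrow> ('k, 'a, 'm) module_scheme \<Rightarrow> 'a set \<Rightarrow> 'a set" where
  "module_span R A B =
     {\<Oplus>\<^bsub>A\<^esub>x\<in>Y. c x \<odot>\<^bsub>A\<^esub> x | Y c. finite Y \<and> Y \<subseteq> B \<and> c \<in> Y \<rightarrow> R}"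

text \<open>
  A \<open>V\<close>-order in the \<open>F\<close>-algebra \<open>A\<close> is a subring (with the same identity) that is a finitely
  generated \<open>V\<close>-submodule and spans \<open>A\<close> over \<open>F\<close>.
\<close>

definition is_order :: "'k set \<Rightarrow> 'k set \<Rightarrow> ('k, 'a, 'm) module_scheme \<Rightarrow> 'a set \<Rightarrow> bool" where
  "is_order V F A \<Lambda> \<longleftrightarrow>
     subring \<Lambda> A \<and>
     (\<exists>B. finite B \<and> B \<subseteq> carrier A \<and> \<Lambda> = module_span V A B) \<and>
     module_span F A \<Lambda> = carrier A"

definition is_maximal_order :: "'k set \<Rightarrow> 'k set \<Rightarrow> ('k, 'a, 'm) module_scheme \<Rightarrow> 'a set \<Rightarrow> bool" where
  "is_maximal_order V F A \<Lambda> \<longleftrightarrow>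
     is_order V F A \<Lambda> \<and> (\<forall>\<Lambda>'. is_order V F A \<Lambda>' \<and> \<Lambda> \<subseteq> \<Lambda>' \<longrightarrow> \<Lambda>' = \<Lambda>)"

end

theory Submission
  imports Defs "Jordan_Normal_Form.Char_Poly"
begin

text \<open>
  Let \<open>v\<^sub>M\<close> be the normalised valuation at a maximal ideal \<open>M\<close> of \<open>S\<close>.  Since \<open>S\<close> is unramified, inertia
  is trivial and the indicator functions on \<open>G\<close> have the form \<open>\<sigma> \<mapsto> \<Sum> x\<^sub>i \<sigma>(y\<^sub>i)\<close> with \<open>x\<^sub>i, y\<^sub>i \<in> S\<close>.  Hence
  every order containing \<open>A\<^sub>f\<close> is graded, and \<open>S\<close> is finitely generated over \<open>V\<close>.

  If the conditions on \<open>f\<close> hold and \<open>a x\<^sub>\<sigma>\<close> lies in a larger order with \<open>v\<^sub>M(a) < 0\<close>, then multiplying by a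
  suitable \<open>x\<^sub>\<tau>\<close> moves \<open>\<sigma>\<close> into \<open>D\<^sub>M\<close>.  There \<open>v\<^sub>M(f(\<sigma>, \<tau>)) \<le> v\<^sub>M(f(\<sigma>\<^sup>-\<^sup>1, \<sigma>)) \<le> 1\<close>, so all powers of \<open>a x\<^sub>\<sigma>\<close> keep
  a coefficient of negative valuation, although one of them is a scalar of the order, hence integral.

  Conversely, fix a maximal ideal \<open>N\<close> and let \<open>L\<close> consist of the \<open>\<Sum> b\<^sub>\<tau> x\<^sub>\<tau>\<close> for which the valuation of \<open>b\<^sub>\<tau>\<close>
  at \<open>\<tau>(N)\<close> is at least \<open>1\<close> if \<open>f(\<tau>, \<tau>\<^sup>-\<^sup>1)\<close> is a unit there, and at least \<open>0\<close> otherwise.  The left order of \<open>L\<close> contains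
  \<open>A\<^sub>f\<close>, so it equals \<open>A\<^sub>f\<close> if \<open>A\<^sub>f\<close> is maximal.  Testing this on \<open>\<pi>\<^sup>-\<^sup>1 x\<^sub>\<sigma>\<close>, with \<open>\<sigma>\<close> maximal for the preorder
  \<open>v\<^sub>M(f(\<sigma>, \<sigma>\<^sup>-\<^sup>1\<rho>)) = 0\<close>, gives both conditions.
\<close>

section \<open>Subrings of a field and integral elements\<close>

text \<open>The values of \<open>f\<close> may be non-units, so the \<open>x\<^sub>\<sigma>\<close>
  need not be invertible in the order, and the group permutes the maximal ideals of
  \<open>S\<close>. Invertibility of \<open>x\<^sub>\<tau>\<close> is therefore judged at one
  maximal ideal at a time, through \<open>f \<tau> (finv \<tau>)\<close>. The only relation between
  cocycle values is the cocycle identity, read additively through a valuation: its four terms are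
  nonnegative, so when one side vanishes, both terms of the other side vanish too.

  Necessity rests on one principle in place of a structure theory of orders: a maximal order equals
  the left order of every full lattice that it stabilises. One lattice for each \<open>N\<close>
  suffices, because every maximal ideal is a conjugate of \<open>N\<close>. The bound 1 on the
  valuation, hence the square of \<open>M\<close> in the theorem, arises since the exponents of the
  lattice are only 0 and 1 and the test element has a simple pole.

  The integral closure is controlled without a primitive element: \<open>pruefer\<close> makes the
  localizations valuation rings, and unramifiedness makes the same \<open>p\<close> a uniformizer in
  all of them.\<close>

lemma type_algebra_simps [simp]:
  "carrier ring_of_type_algebra = UNIV"
  "x \<otimes>\<^bsub>ring_of_type_algebra\<^esub> y = x * y"
  "x \<oplus>\<^bsub>ring_of_type_algebra\<^esub> y = x + y"
  "\<one>\<^bsub>ring_of_type_algebra\<^esub> = 1"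
  "\<zero>\<^bsub>ring_of_type_algebra\<^esub> = 0"
  by (simp_all add: ring_of_type_algebra_def)

lemma type_algebra_a_inv [simp]: "\<ominus>\<^bsub>ring_of_type_algebra\<^esub> x = - (x :: 'k::field)"
proof -
  interpret L: field "ring_of_type_algebra :: 'k ring" by (rule field_from_type_algebra)
  show ?thesis by (rule L.minus_equality) simp_all
qed

text \<open>Closure properties in terms of the operations of the type \<open>'k\<close> make
  class-based polynomials, sums and matrices available; the records \<open>ring_on V\<close> serve
  to connect with the notions of the theorem.\<close>

locale field_subring =
  fixes V :: "'k::field set"
  assumes zero_mem [simp]: "0 \<in> V" and one_mem [simp]: "1 \<in> V"
    and add_mem: "x \<in> V \<Longrightarrow> y \<in> V \<Longrightarrow> x + y \<in> V"
    and uminus_mem: "x \<in> V \<Longrightarrow> - x \<in> V"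
    and mult_mem: "x \<in> V \<Longrightarrow> y \<in> V \<Longrightarrow> x * y \<in> V"
begin

lemma diff_mem: "x \<in> V \<Longrightarrow> y \<in> V \<Longrightarrow> x - y \<in> V"
  using add_mem[of x "- y"] uminus_mem by simp

lemma sum_mem: "(\<And>i. i \<in> A \<Longrightarrow> h i \<in> V) \<Longrightarrow> sum h A \<in> V"
  by (induction A rule: infinite_finite_induct) (auto intro: add_mem)

lemma prod_mem: "(\<And>i. i \<in> A \<Longrightarrow> h i \<in> V) \<Longrightarrow> prod h A \<in> V"
  by (induction A rule: infinite_finite_induct) (auto intro: mult_mem)

lemma power_mem: "x \<in> V \<Longrightarrow> x ^ n \<in> V"
  by (induction n) (auto intro: mult_mem)

lemma of_nat_mem: "of_nat n \<in> V"
  by (induction n) (auto intro: add_mem)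

lemma domain_ring_on: "domain (ring_on V)"
proof -
  interpret L: field "ring_of_type_algebra :: 'k ring" by (rule field_from_type_algebra)
  have "subring V (ring_of_type_algebra :: 'k ring)"
    by (rule L.subringI) (auto intro: add_mem mult_mem uminus_mem)
  then show ?thesis by (rule L.subring_is_domain)
qed

lemma cring_ring_on: "cring (ring_on V)"
  using domain_ring_on by (simp add: domain_def)

section \<open>Ideals and maximal ideals of a subring\<close>

lemma ideal_ring_on_iff:
  "ideal M (ring_on V) \<longleftrightarrow> M \<subseteq> V \<and> 0 \<in> M \<and> (\<forall>x\<in>M. \<forall>y\<in>M. x + y \<in> M) \<and> (\<forall>s\<in>V. \<forall>x\<in>M. s * x \<in> M)"
proof
  assume "ideal M (ring_on V)"
  then interpret ideal M "ring_on V" .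
  show "M \<subseteq> V \<and> 0 \<in> M \<and> (\<forall>x\<in>M. \<forall>y\<in>M. x + y \<in> M) \<and> (\<forall>s\<in>V. \<forall>x\<in>M. s * x \<in> M)"
    using additive_subgroup.a_subset[OF additive_subgroup_axioms]
      additive_subgroup.zero_closed[OF additive_subgroup_axioms]
      additive_subgroup.a_closed[OF additive_subgroup_axioms] I_l_closed by simp
next
  interpret R: domain "ring_on V" by (rule domain_ring_on)
  assume *: "M \<subseteq> V \<and> 0 \<in> M \<and> (\<forall>x\<in>M. \<forall>y\<in>M. x + y \<in> M) \<and> (\<forall>s\<in>V. \<forall>x\<in>M. s * x \<in> M)"
  then have sub: "M \<subseteq> V" and smult: "\<And>s x. s \<in> V \<Longrightarrow> x \<in> M \<Longrightarrow> s * x \<in> M" by auto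
  show "ideal M (ring_on V)"
  proof (rule idealI[OF R.ring_axioms])
    show "subgroup M (add_monoid (ring_on V))"
    proof (rule R.add.subgroupI)
      fix a assume a: "a \<in> M"
      then have "\<ominus>\<^bsub>ring_on V\<^esub> a = - a"
        using * uminus_mem by (intro R.minus_equality) auto
      moreover have "(- 1) * a \<in> M" using a uminus_mem[of 1] by (intro smult) auto
      ultimately show "\<ominus>\<^bsub>ring_on V\<^esub> a \<in> M" by simp
    qed (use * in auto)
    fix a x assume "a \<in> M" "x \<in> carrier (ring_on V)"
    then have "x * a \<in> M" by (intro smult) auto
    then show "x \<otimes>\<^bsub>ring_on V\<^esub> a \<in> M" "a \<otimes>\<^bsub>ring_on V\<^esub> x \<in> M" by (simp_all add: mult.commute)
  qed
qed

text \<open>For \<open>s\<close> outside a maximal \<open>M\<close> the ideal \<open>J\<close>,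
  which is \<open>M + sV\<close>, contains 1. Conversely, an ideal above \<open>M\<close> that
  contains such an \<open>s\<close> contains \<open>s * t + (1 - s * t)\<close>. The last clause is
  invertibility of nonzero residue classes, expressed without the quotient ring.\<close>

lemma maximalideal_ring_on_iff:
  "maximalideal M (ring_on V) \<longleftrightarrow> M \<subseteq> V \<and> 0 \<in> M \<and> (\<forall>x\<in>M. \<forall>y\<in>M. x + y \<in> M) \<and>
     (\<forall>s\<in>V. \<forall>x\<in>M. s * x \<in> M) \<and> 1 \<notin> M \<and> (\<forall>s\<in>V - M. \<exists>t\<in>V. 1 - s * t \<in> M)" (is "_ \<longleftrightarrow> ?rhs")
proof
  assume max: "maximalideal M (ring_on V)"
  then have "ideal M (ring_on V)" by (simp add: maximalideal_def)
  then have id: "M \<subseteq> V" "0 \<in> M" "\<And>x y. x \<in> M \<Longrightarrow> y \<in> M \<Longrightarrow> x + y \<in> M" "\<And>s x. s \<in> V \<Longrightarrow> x \<in> M \<Longrightarrow> s * x \<in> M"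
    unfolding ideal_ring_on_iff by auto
  have ne: "M \<noteq> V" using maximalideal.I_notcarr[OF max] by simp
  have one: "1 \<notin> M"
  proof
    assume "1 \<in> M"
    then have "x \<in> M" if "x \<in> V" for x using id(4)[OF that, of 1] by simp
    then show False using ne id(1) by blast
  qed
  have "\<exists>t\<in>V. 1 - s * t \<in> M" if s: "s \<in> V - M" for s
  proof -
    define J where "J = {m + s * t | m t. m \<in> M \<and> t \<in> V}"
    have mem: "m + s * t \<in> J" if "m \<in> M" "t \<in> V" for m t using that by (auto simp: J_def)
    have "x + y \<in> J" if xy: "x \<in> J" "y \<in> J" for x y
    proof -
      obtain m t m' t' where *: "m \<in> M" "t \<in> V" "x = m + s * t" "m' \<in> M" "t' \<in> V" "y = m' + s * t'"
        using xy by (auto simp: J_def)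
      have eq: "x + y = (m + m') + s * (t + t')" unfolding * by (simp add: algebra_simps)
      show ?thesis unfolding eq by (rule mem) (use * id add_mem in auto)
    qed
    moreover have "r * x \<in> J" if rx: "r \<in> V" "x \<in> J" for r x
    proof -
      obtain m t where *: "m \<in> M" "t \<in> V" "x = m + s * t"
        using rx by (auto simp: J_def)
      have eq: "r * x = r * m + s * (r * t)" unfolding * by (simp add: algebra_simps)
      show ?thesis unfolding eq by (rule mem) (use * rx id mult_mem in auto)
    qed
    moreover have "J \<subseteq> V" using id s by (auto simp: J_def intro!: add_mem mult_mem)
    moreover have MJ: "M \<subseteq> J" using mem[of _ 0] by auto
    ultimately have "ideal J (ring_on V)" unfolding ideal_ring_on_iff using id by auto
    moreover have "s \<in> J" using mem[of 0 1] id by simp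
    ultimately have "J = V"
      using maximalideal.I_maximal[OF max, of J] MJ \<open>J \<subseteq> V\<close> s by auto
    then have "1 \<in> J" by simp
    then obtain m t where "m \<in> M" "t \<in> V" "1 = m + s * t" by (auto simp: J_def)
    then show ?thesis by (metis add_diff_cancel_right')
  qed
  then show ?rhs using id one by auto
next
  assume rhs: ?rhs
  show "maximalideal M (ring_on V)"
  proof (rule maximalidealI)
    show "ideal M (ring_on V)" unfolding ideal_ring_on_iff using rhs by blast
    show "carrier (ring_on V) \<noteq> M" using rhs by auto
    fix J assume J: "ideal J (ring_on V)" "M \<subseteq> J" "J \<subseteq> carrier (ring_on V)"
    show "J = M \<or> J = carrier (ring_on V)"
    proof (cases "J = M")
      case False
      note Jid = J(1)[unfolded ideal_ring_on_iff]
      obtain s where s: "s \<in> J" "s \<notin> M" using False J(2) by blast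
      then obtain t where t: "t \<in> V" "1 - s * t \<in> M" using rhs Jid by blast
      have "t * s \<in> J" using Jid s t by blast
      moreover have "1 - s * t \<in> J" using t J(2) by blast
      ultimately have "t * s + (1 - s * t) \<in> J" using Jid by blast
      then have "1 \<in> J" by (simp add: mult.commute)
      then have "x \<in> J" if "x \<in> V" for x using Jid that by (metis mult.right_neutral)
      then show ?thesis using Jid by auto
    qed simp
  qed
qed

lemma ideal_power_1:
  assumes "ideal M (ring_on V)"
  shows "ideal_power (ring_on V) M 1 = M"
proof -
  interpret I: comm_monoid "ideals_set (ring_on V)"
    by (rule cring.ideals_set_is_comm_monoid[OF cring_ring_on])
  have "M \<in> carrier (ideals_set (ring_on V))" using assms by (simp add: ideals_set_def)
  then show ?thesis using I.nat_pow_eone by simp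
qed

lemma ideal_power_2:
  assumes "ideal M (ring_on V)"
  shows "ideal_power (ring_on V) M 2 = M \<cdot>\<^bsub>ring_on V\<^esub> M"
proof -
  interpret I: comm_monoid "ideals_set (ring_on V)"
    by (rule cring.ideals_set_is_comm_monoid[OF cring_ring_on])
  have M: "M \<in> carrier (ideals_set (ring_on V))" using assms by (simp add: ideals_set_def)
  have "M [^]\<^bsub>ideals_set (ring_on V)\<^esub> (2::nat) = M [^]\<^bsub>ideals_set (ring_on V)\<^esub> (1::nat) \<otimes>\<^bsub>ideals_set (ring_on V)\<^esub> M"
    using I.nat_pow_Suc[of M 1] by (simp add: numeral_2_eq_2)
  then show ?thesis using I.nat_pow_eone[OF M] by (simp add: ideals_set_def)
qed

text \<open>Zorn's lemma on the ideals that contain \<open>I\<close> and omit 1. Properness in the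
  form of omitting 1 passes to unions of chains.\<close>

lemma exists_maximalideal:
  assumes "ideal I (ring_on V)" "1 \<notin> I"
  obtains M where "maximalideal M (ring_on V)" "I \<subseteq> M"
proof -
  define \<A> where "\<A> = {J. ideal J (ring_on V) \<and> I \<subseteq> J \<and> 1 \<notin> J}"
  have "I \<in> \<A>" using assms by (simp add: \<A>_def)
  have "\<exists>M\<in>\<A>. \<forall>J\<in>\<A>. M \<subseteq> J \<longrightarrow> J = M"
  proof (rule subset_Zorn_nonempty)
    show "\<A> \<noteq> {}" using \<open>I \<in> \<A>\<close> by blast
    fix C assume "C \<noteq> {}" and C: "subset.chain \<A> C"
    then have sub: "C \<subseteq> \<A>" and tot: "\<And>J K. J \<in> C \<Longrightarrow> K \<in> C \<Longrightarrow> J \<subseteq> K \<or> K \<subseteq> J"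
      by (auto simp: subset_chain_def)
    have J: "J \<subseteq> V" "0 \<in> J" "I \<subseteq> J" "1 \<notin> J" "\<And>x y. x \<in> J \<Longrightarrow> y \<in> J \<Longrightarrow> x + y \<in> J"
      "\<And>s x. s \<in> V \<Longrightarrow> x \<in> J \<Longrightarrow> s * x \<in> J" if "J \<in> C" for J
      using that sub unfolding \<A>_def ideal_ring_on_iff by auto
    have "x + y \<in> \<Union> C" if xy: "x \<in> \<Union> C" "y \<in> \<Union> C" for x y
    proof -
      obtain J K where JK: "J \<in> C" "x \<in> J" "K \<in> C" "y \<in> K" using xy by blast
      then obtain W where "W \<in> C" "x \<in> W" "y \<in> W" using tot[of J K] by blast
      then show ?thesis using J(5) by blast
    qed
    moreover have "s * x \<in> \<Union> C" if "s \<in> V" "x \<in> \<Union> C" for s x using that J(6) by blast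
    moreover have "\<Union> C \<subseteq> V" "0 \<in> \<Union> C" "I \<subseteq> \<Union> C" "1 \<notin> \<Union> C"
      using J(1-4) \<open>C \<noteq> {}\<close> by blast+
    ultimately show "\<Union> C \<in> \<A>" unfolding \<A>_def ideal_ring_on_iff by blast
  qed
  then obtain M where M: "M \<in> \<A>" "\<And>J. J \<in> \<A> \<Longrightarrow> M \<subseteq> J \<Longrightarrow> J = M" by blast
  have "maximalideal M (ring_on V)"
  proof (rule maximalidealI)
    show "ideal M (ring_on V)" "carrier (ring_on V) \<noteq> M" using M(1) by (auto simp: \<A>_def)
    fix J assume J: "ideal J (ring_on V)" "M \<subseteq> J" "J \<subseteq> carrier (ring_on V)"
    show "J = M \<or> J = carrier (ring_on V)"
    proof (cases "1 \<in> J")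
      case True
      then have "x \<in> J" if "x \<in> V" for x
        using J(1) that unfolding ideal_ring_on_iff by (metis mult.right_neutral)
      then show ?thesis using J(3) by auto
    next
      case False
      then have "J \<in> \<A>" using J M(1) by (auto simp: \<A>_def)
      then show ?thesis using M(2) J(2) by blast
    qed
  qed
  then show ?thesis using that M(1) by (auto simp: \<A>_def)
qed

section \<open>Polynomials with coefficients in the subring\<close>

lemma coeffs_subset_iff: "set (coeffs p) \<subseteq> V \<longleftrightarrow> (\<forall>i. poly.coeff p i \<in> V)"
proof -
  have "set (coeffs p) \<subseteq> V \<longleftrightarrow> range (poly.coeff p) \<subseteq> V" by (simp add: range_coeff)
  then show ?thesis by auto
qed

lemma coeff_mult_mem:
  "(\<And>i. poly.coeff p i \<in> V) \<Longrightarrow> (\<And>i. poly.coeff q i \<in> V) \<Longrightarrow> poly.coeff (p * q) i \<in> V"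
  by (auto simp: coeff_mult intro!: sum_mem mult_mem)

lemma coeff_prod_mem:
  "(\<And>i j. i \<in> A \<Longrightarrow> poly.coeff (h i) j \<in> V) \<Longrightarrow> poly.coeff (prod h A) k \<in> V"
proof (induction A arbitrary: k rule: infinite_finite_induct)
  case (insert x A)
  then show ?case using coeff_mult_mem[of "h x" "prod h A"] by simp
qed (auto simp: coeff_1)

lemma poly_mem: "(\<And>i. poly.coeff p i \<in> V) \<Longrightarrow> x \<in> V \<Longrightarrow> poly p x \<in> V"
  by (auto simp: poly_altdef intro!: sum_mem mult_mem power_mem)

lemma coeff_Poly_mem: "set l \<subseteq> V \<Longrightarrow> poly.coeff (Poly l) i \<in> V"
  by (auto simp: coeff_Poly_eq nth_default_def)

text \<open>Induction along Horner's scheme keeps the quadratic remainder integral. No division by 2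
  occurs, so the expansion serves in every residue characteristic.\<close>

lemma poly_taylor:
  assumes "\<And>i. poly.coeff P i \<in> V" "x \<in> V" "h \<in> V"
  shows "\<exists>c\<in>V. poly P (x + h) = poly P x + poly (pderiv P) x * h + h ^ 2 * c"
  using assms(1)
proof (induction P rule: pCons_induct)
  case (pCons a P)
  have P: "poly.coeff P i \<in> V" for i using pCons.prems[of "Suc i"] by simp
  then obtain c where c: "c \<in> V" "poly P (x + h) = poly P x + poly (pderiv P) x * h + h ^ 2 * c"
    using pCons.IH by blast
  have dP: "poly.coeff (pderiv P) i \<in> V" for i
    unfolding coeff_pderiv by (intro mult_mem of_nat_mem P)
  have "poly (pderiv P) x + (x + h) * c \<in> V"
    using poly_mem[OF dP assms(2)] c assms by (intro add_mem mult_mem) auto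
  moreover have "poly (pCons a P) (x + h) = poly (pCons a P) x + poly (pderiv (pCons a P)) x * h
      + h ^ 2 * (poly (pderiv P) x + (x + h) * c)"
    unfolding poly_pCons c(2) by (simp add: pderiv_pCons algebra_simps power2_eq_square)
  ultimately show ?case by blast
qed (auto intro!: bexI[of _ 0])

text \<open>For finite \<open>B\<close> this is the \<open>V\<close>-module spanned by
  \<open>B\<close>. For infinite \<open>B\<close> every such sum is 0 and \<open>lin B\<close>
  collapses to the zero module, hence the finiteness assumptions in \<open>lin_base\<close> and
  \<open>lin_mono\<close>.\<close>

definition lin :: "'k set \<Rightarrow> 'k set" where
  "lin B = {\<Sum>b\<in>B. c b * b | c. c \<in> B \<rightarrow> V}"

lemma lin_intro: "x = (\<Sum>b\<in>B. c b * b) \<Longrightarrow> c \<in> B \<rightarrow> V \<Longrightarrow> x \<in> lin B"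
  unfolding lin_def by (rule CollectI, rule exI[of _ c]) simp

lemma lin_elim:
  assumes "x \<in> lin B"
  obtains c where "x = (\<Sum>b\<in>B. c b * b)" "c \<in> B \<rightarrow> V"
proof -
  have "\<exists>c. x = (\<Sum>b\<in>B. c b * b) \<and> c \<in> B \<rightarrow> V"
    using assms unfolding lin_def by (rule CollectD)
  then show ?thesis using that by (elim exE conjE)
qed

lemma lin_zero: "0 \<in> lin B"
  by (rule lin_intro[of _ "\<lambda>_. 0"]) auto

lemma lin_add: "x \<in> lin B \<Longrightarrow> y \<in> lin B \<Longrightarrow> x + y \<in> lin B"
proof -
  assume "x \<in> lin B" "y \<in> lin B"
  then obtain c d where "x = (\<Sum>b\<in>B. c b * b)" "c \<in> B \<rightarrow> V" "y = (\<Sum>b\<in>B. d b * b)" "d \<in> B \<rightarrow> V"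
    by (auto simp: lin_def)
  then have "x + y = (\<Sum>b\<in>B. (c b + d b) * b)" "(\<lambda>b. c b + d b) \<in> B \<rightarrow> V"
    by (auto simp: sum.distrib distrib_right intro: add_mem)
  then show ?thesis by (rule lin_intro)
qed

lemma lin_smult: "a \<in> V \<Longrightarrow> x \<in> lin B \<Longrightarrow> a * x \<in> lin B"
proof -
  assume "x \<in> lin B" "a \<in> V"
  then obtain c where "x = (\<Sum>b\<in>B. c b * b)" "c \<in> B \<rightarrow> V"
    by (auto simp: lin_def)
  then have "a * x = (\<Sum>b\<in>B. (a * c b) * b)" "(\<lambda>b. a * c b) \<in> B \<rightarrow> V"
    using \<open>a \<in> V\<close> by (auto simp: sum_distrib_left mult.assoc intro: mult_mem)
  then show ?thesis by (rule lin_intro)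
qed

lemma lin_uminus: "x \<in> lin B \<Longrightarrow> - x \<in> lin B"
  using lin_smult[of "-1" x B] uminus_mem[of 1] by simp

lemma lin_sum: "(\<And>i. i \<in> A \<Longrightarrow> h i \<in> lin B) \<Longrightarrow> sum h A \<in> lin B"
  by (induction A rule: infinite_finite_induct) (auto intro: lin_add lin_zero)

lemma sum_indicator:
  "finite B \<Longrightarrow> b \<in> B \<Longrightarrow> (\<Sum>b'\<in>B. (if b' = b then 1 else 0) * h b') = (h b :: 'k)"
  by (simp add: if_distrib[of "\<lambda>x. x * _"] cong: if_cong)

lemma lin_base:
  assumes "finite B" "b \<in> B"
  shows "b \<in> lin B"
proof -
  have "b = (\<Sum>b'\<in>B. (if b' = b then 1 else 0) * b')"
    using sum_indicator[OF assms, of "\<lambda>b. b"] by simp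
  moreover have "(\<lambda>b'. if b' = b then 1 else 0) \<in> B \<rightarrow> V" by auto
  ultimately show ?thesis by (rule lin_intro)
qed

lemma lin_subset:
  assumes "x \<in> lin B" and "\<And>b. b \<in> B \<Longrightarrow> b \<in> lin C"
  shows "x \<in> lin C"
proof -
  obtain c where "x = (\<Sum>b\<in>B. c b * b)" "c \<in> B \<rightarrow> V"
    using assms(1) by (auto simp: lin_def)
  then show ?thesis using assms(2) by (auto intro!: lin_sum lin_smult)
qed

lemma lin_mult_stable:
  assumes "x \<in> lin B" and "\<And>b. b \<in> B \<Longrightarrow> y * b \<in> lin C"
  shows "y * x \<in> lin C"
proof -
  obtain c where c: "x = (\<Sum>b\<in>B. c b * b)" "c \<in> B \<rightarrow> V"
    using assms(1) by (auto simp: lin_def)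
  then have "y * x = (\<Sum>b\<in>B. c b * (y * b))"
    by (simp add: sum_distrib_left algebra_simps)
  moreover have "(\<Sum>b\<in>B. c b * (y * b)) \<in> lin C"
    by (rule lin_sum, rule lin_smult) (use c assms(2) in auto)
  ultimately show ?thesis by simp
qed

lemma lin_least:
  assumes "x \<in> lin B" "B \<subseteq> U" "0 \<in> U"
    and add: "\<And>x y. x \<in> U \<Longrightarrow> y \<in> U \<Longrightarrow> x + y \<in> U"
    and smult: "\<And>a x. a \<in> V \<Longrightarrow> x \<in> U \<Longrightarrow> a * x \<in> U"
  shows "x \<in> U"
proof -
  have sum: "(\<And>i. i \<in> A \<Longrightarrow> h i \<in> U) \<Longrightarrow> sum h A \<in> U" for h :: "'k \<Rightarrow> 'k" and A
    by (induction A rule: infinite_finite_induct) (auto intro: add assms(3))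
  obtain c where c: "x = (\<Sum>b\<in>B. c b * b)" "c \<in> B \<rightarrow> V"
    using assms(1) by (rule lin_elim)
  show ?thesis unfolding c(1) by (rule sum, rule smult) (use c(2) assms(2) in auto)
qed

lemma lin_mono: "finite C \<Longrightarrow> B \<subseteq> C \<Longrightarrow> x \<in> lin B \<Longrightarrow> x \<in> lin C"
  by (erule lin_subset) (auto intro: lin_base)

section \<open>Integral elements and finitely generated stable modules\<close>

lemma coeff_det_mem:
  fixes A :: "'k poly mat"
  assumes "A \<in> carrier_mat n n" and "\<And>i j k. i < n \<Longrightarrow> j < n \<Longrightarrow> poly.coeff (A $$ (i, j)) k \<in> V"
  shows "poly.coeff (Determinant.det A) k \<in> V"
proof -
  have "poly.coeff (signof q * (\<Prod>i=0..<n. A $$ (i, q i))) k \<in> V"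
    if "q permutes {0..<n}" for q
  proof -
    have "poly.coeff (\<Prod>i=0..<n. A $$ (i, q i)) k \<in> V" for k
      using permutes_in_image[OF that] by (intro coeff_prod_mem assms(2)) auto
    then show ?thesis by (cases "sign q = 1") (auto simp: uminus_mem sign_def)
  qed
  then show ?thesis
    using assms(1) by (auto simp: Determinant.det_def coeff_sum intro!: sum_mem)
qed

text \<open>The determinant trick: \<open>y\<close> is an eigenvalue of a matrix with entries in \<open>V\<close>, whose
  characteristic polynomial is monic over \<open>V\<close>.\<close>

lemma integral_closureI:
  assumes "finite B" "b0 \<in> B" "b0 \<noteq> 0" and stab: "\<And>b. b \<in> B \<Longrightarrow> y * b \<in> lin B"
  shows "y \<in> integral_closure V"
proof -
  obtain bs where bs: "set bs = B" "distinct bs" using finite_distinct_list[OF assms(1)] by blast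
  have "\<exists>c. c \<in> B \<rightarrow> V \<and> y * b = (\<Sum>b'\<in>B. c b' * b')" if "b \<in> B" for b
    using stab[OF that] by (auto simp: lin_def)
  then obtain c where c: "\<And>b. b \<in> B \<Longrightarrow> c b \<in> B \<rightarrow> V"
    "\<And>b. b \<in> B \<Longrightarrow> y * b = (\<Sum>b'\<in>B. c b b' * b')"
    by metis
  define n where "n = length bs"
  define A where "A = mat n n (\<lambda>(i, j). c (bs ! i) (bs ! j))"
  define v where "v = vec n (\<lambda>i. bs ! i)"
  have A: "A \<in> carrier_mat n n" by (simp add: A_def)
  have nth: "bs ! i \<in> B" if "i < n" for i using that bs by (auto simp: n_def)
  have sums: "(\<Sum>b'\<in>B. h b') = (\<Sum>j=0..<n. h (bs ! j))" for h :: "'k \<Rightarrow> 'k"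
    using bs sum_list_sum_nth[of "map h bs"] by (simp add: n_def sum_list_distinct_conv_sum_set)
  have "A *\<^sub>v v = y \<cdot>\<^sub>v v"
  proof (rule eq_vecI)
    fix i assume "i < dim_vec (y \<cdot>\<^sub>v v)"
    then have i: "i < n" by (simp add: v_def)
    have "(A *\<^sub>v v) $ i = (\<Sum>j=0..<n. c (bs ! i) (bs ! j) * (bs ! j))"
      using i by (simp add: A_def v_def scalar_prod_def)
    also have "\<dots> = y * bs ! i" using c(2)[OF nth[OF i]] sums by simp
    finally show "(A *\<^sub>v v) $ i = (y \<cdot>\<^sub>v v) $ i" using i by (simp add: v_def)
  qed (simp add: A_def v_def)
  moreover have "v \<noteq> 0\<^sub>v n"
  proof
    assume "v = 0\<^sub>v n"
    moreover obtain i where "i < n" "bs ! i = b0"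
      using assms(2) bs by (metis in_set_conv_nth n_def)
    ultimately show False using assms(3) by (metis index_vec index_zero_vec(1) v_def)
  qed
  ultimately have "eigenvalue A y"
    unfolding eigenvalue_def eigenvector_def using A by (auto simp: v_def intro!: exI[of _ "vec n ((!) bs)"])
  then have root: "poly (char_poly A) y = 0" using eigenvalue_root_char_poly[OF A] by simp
  have "poly.coeff (char_poly A) k \<in> V" for k
  proof -
    have "poly.coeff (char_poly_matrix A $$ (i, j)) k \<in> V" if "i < n" "j < n" for i j k
      using that c(1) nth A
      by (auto simp: char_poly_matrix_def A_def coeff_pCons Pi_iff intro!: uminus_mem split: nat.split)
    then show ?thesis unfolding char_poly_def
      by (intro coeff_det_mem[of _ n]) (use A in auto)
  qed
  moreover have "Polynomial.lead_coeff (char_poly A) = 1"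
    using degree_monic_char_poly[OF A] by auto
  ultimately show ?thesis
    using root unfolding integral_closure_def by (auto simp: coeffs_subset_iff)
qed

text \<open>A monic equation of degree \<open>n\<close> returns \<open>y ^ n\<close> to the module
  spanned by the lower powers of \<open>y\<close>. The degree is positive because a monic constant
  is 1 and has no root; this puts 1 among the generators.\<close>

lemma integral_closureD:
  assumes "y \<in> integral_closure V"
  obtains B where "finite B" "1 \<in> B" "\<And>b. b \<in> B \<Longrightarrow> y * b \<in> lin B"
proof -
  obtain p where p: "Polynomial.lead_coeff p = 1" "\<And>i. poly.coeff p i \<in> V" "poly p y = 0"
    using assms by (auto simp: integral_closure_def coeffs_subset_iff)
  define n where "n = Polynomial.degree p"
  have n0: "n \<noteq> 0"
  proof
    assume "n = 0"
    then have "p = [:1:]" using p(1) n_def by (metis degree_eq_zeroE pCons_0_0 coeff_pCons_0)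
    then show False using p(3) by simp
  qed
  define B where "B = (\<lambda>i. y ^ i) ` {..<n}"
  have fin: "finite B" by (simp add: B_def)
  have pow: "y ^ i \<in> lin B" if "i < n" for i
    using that fin by (intro lin_base) (auto simp: B_def)
  have "0 = (\<Sum>i\<le>n. poly.coeff p i * y ^ i)" using p(3) by (simp add: poly_altdef n_def)
  also have "\<dots> = (\<Sum>i<n. poly.coeff p i * y ^ i) + poly.coeff p n * y ^ n"
    by (simp only: lessThan_Suc_atMost[symmetric] sum.lessThan_Suc)
  also have "poly.coeff p n = 1" using p(1) unfolding n_def .
  also have "1 * y ^ n = y ^ n" by (rule mult_1_left)
  finally have "(\<Sum>i<n. poly.coeff p i * y ^ i) + y ^ n = 0" by (rule sym)
  then have "y ^ n = - (\<Sum>i<n. poly.coeff p i * y ^ i)"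
    by (simp add: eq_neg_iff_add_eq_0 add.commute)
  then have top: "y ^ n \<in> lin B"
    using p(2) pow by (auto intro!: lin_uminus lin_sum lin_smult)
  show ?thesis
  proof (rule that[of B])
    show "1 \<in> B" using n0 by (auto simp: B_def intro!: image_eqI[of _ _ 0])
    fix b assume "b \<in> B"
    then obtain i where i: "i < n" "y * b = y ^ Suc i" by (auto simp: B_def)
    show "y * b \<in> lin B"
    proof (cases "Suc i < n")
      case True then show ?thesis using pow[of "Suc i"] i by metis
    next
      case False
      then have "Suc i = n" using i by simp
      then show ?thesis using top i by metis
    qed
  qed (rule fin)
qed

lemma subset_integral_closure: "x \<in> V \<Longrightarrow> x \<in> integral_closure V"
  by (rule integral_closureI[of "{1}" 1]) (auto simp: lin_def)

text \<open>Products of the two generating systems span one module stable under both elements, hence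
  under their sum and product. This makes the integral closure a ring.\<close>

lemma common_stable:
  assumes "x \<in> integral_closure V" "y \<in> integral_closure V"
  obtains B where "finite B" "1 \<in> B" "\<And>b. b \<in> lin B \<Longrightarrow> x * b \<in> lin B"
    "\<And>b. b \<in> lin B \<Longrightarrow> y * b \<in> lin B"
proof -
  obtain B1 where B1: "finite B1" "1 \<in> B1" "\<And>b. b \<in> B1 \<Longrightarrow> x * b \<in> lin B1"
    using integral_closureD[OF assms(1)] by blast
  obtain B2 where B2: "finite B2" "1 \<in> B2" "\<And>b. b \<in> B2 \<Longrightarrow> y * b \<in> lin B2"
    using integral_closureD[OF assms(2)] by blast
  define B where "B = (\<lambda>(a, b). a * b) ` (B1 \<times> B2)"
  have fin: "finite B" using B1 B2 by (auto simp: B_def)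
  have prod: "a * b \<in> lin B" if "a \<in> lin B1" "b \<in> lin B2" for a b
  proof (rule lin_mult_stable[OF that(2)])
    fix b' assume b': "b' \<in> B2"
    have "b' * a \<in> lin B"
      using b' by (intro lin_mult_stable[OF that(1)] lin_base[OF fin]) (auto simp: B_def mult.commute)
    then show "a * b' \<in> lin B" by (simp add: mult.commute)
  qed
  show ?thesis
  proof (rule that[OF fin])
    show "1 \<in> B" using B1 B2 by (auto simp: B_def intro!: image_eqI[of _ _ "(1,1)"])
    show "x * b \<in> lin B" if b: "b \<in> lin B" for b
    proof (rule lin_mult_stable[OF b])
      fix b assume "b \<in> B"
      then obtain b1 b2 where "b1 \<in> B1" "b2 \<in> B2" "b = b1 * b2" by (auto simp: B_def)
      then show "x * b \<in> lin B" using prod[of "x * b1" b2] B1 B2 lin_base by (simp add: mult.assoc)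
    qed
    show "y * b \<in> lin B" if b: "b \<in> lin B" for b
    proof (rule lin_mult_stable[OF b])
      fix b assume "b \<in> B"
      then obtain b1 b2 where "b1 \<in> B1" "b2 \<in> B2" "b = b1 * b2" by (auto simp: B_def)
      then show "y * b \<in> lin B" using prod[of b1 "y * b2"] B1 B2 lin_base by (simp add: mult.left_commute)
    qed
  qed
qed

lemma field_subring_integral_closure: "field_subring (integral_closure V)"
proof
  show "0 \<in> integral_closure V" "1 \<in> integral_closure V"
    by (simp_all add: subset_integral_closure)
  fix x y assume xy: "x \<in> integral_closure V" "y \<in> integral_closure V"
  obtain B where B: "finite B" "1 \<in> B" "\<And>b. b \<in> lin B \<Longrightarrow> x * b \<in> lin B"
    "\<And>b. b \<in> lin B \<Longrightarrow> y * b \<in> lin B" using common_stable[OF xy] by blast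
  note base = lin_base[OF B(1)]
  show "x + y \<in> integral_closure V"
    using B base by (intro integral_closureI[OF B(1,2)]) (auto simp: distrib_right intro: lin_add)
  show "x * y \<in> integral_closure V"
    using B base by (intro integral_closureI[OF B(1,2)]) (auto simp: mult.assoc)
  show "- x \<in> integral_closure V"
    using B base by (intro integral_closureI[OF B(1,2)]) (auto intro: lin_uminus)
qed

end

lemma field_subring_if_ring:
  assumes "ring (ring_on (V :: 'k::field set))"
  shows "field_subring V"
proof -
  interpret L: field "ring_of_type_algebra :: 'k ring" by (rule field_from_type_algebra)
  have "subring V (ring_of_type_algebra :: 'k ring)"
    by (rule L.ring_incl_imp_subring) (use assms in simp_all)
  from subringE[OF this] show ?thesis by unfold_locales auto
qed

section \<open>Discrete valuation rings\<close>

text \<open>A discrete valuation ring presented by a uniformizer. That \<open>inverse p\<close> lies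
  outside \<open>V\<close> excludes fields and makes the exponent in \<open>factorization\<close>
  unique.\<close>

locale dvr_subring = field_subring V for V :: "'k::field set" +
  fixes p :: 'k
  assumes p_mem: "p \<in> V" and p_nonzero [simp]: "p \<noteq> 0" and inverse_p: "inverse p \<notin> V"
    and factorization: "x \<in> V \<Longrightarrow> x \<noteq> 0 \<Longrightarrow> \<exists>u n. u \<in> V \<and> inverse u \<in> V \<and> x = u * p ^ n"
begin

definition fractions :: "'k set" where
  "fractions = {a / b | a b. a \<in> V \<and> b \<in> V \<and> b \<noteq> 0}"

lemma fractionsI: "a \<in> V \<Longrightarrow> b \<in> V \<Longrightarrow> b \<noteq> 0 \<Longrightarrow> a / b \<in> fractions"
  unfolding fractions_def by blast

text \<open>Cancelling powers of \<open>p\<close> leaves them in the numerator or in the denominator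
  only. The second case keeps one factor \<open>p\<close> explicit, since this factor is what
  contradicts integrality later.\<close>

lemma fractions_cases:
  assumes "x \<in> fractions"
  obtains (int) "x \<in> V" | (inv) y where "y \<in> V" "x = inverse (p * y)" "x \<noteq> 0"
proof (cases "x = 0")
  case True then show ?thesis using int by simp
next
  case False
  obtain a b where ab: "x = a / b" "a \<in> V" "b \<in> V" "b \<noteq> 0"
    using assms by (auto simp: fractions_def)
  then have "a \<noteq> 0" using False by auto
  obtain u n where u: "u \<in> V" "inverse u \<in> V" "a = u * p ^ n"
    using factorization[OF ab(2) \<open>a \<noteq> 0\<close>] by blast
  obtain w m where w: "w \<in> V" "inverse w \<in> V" "b = w * p ^ m"
    using factorization[OF ab(3,4)] by blast
  show ?thesis
  proof (cases "m \<le> n")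
    case True
    then have "p ^ n = p ^ m * p ^ (n - m)" by (simp add: power_add[symmetric])
    then have "x = u * inverse w * p ^ (n - m)"
      using ab u w by (simp add: field_simps)
    then show ?thesis using u w int by (simp add: mult_mem power_mem p_mem)
  next
    case False
    then have "p ^ m = p ^ n * (p * p ^ (m - n - 1))"
      by (simp add: power_add[symmetric] power_Suc[symmetric] del: power_Suc)
    then have "x = inverse (p * (w * inverse u * p ^ (m - n - 1)))"
      using ab u w \<open>a \<noteq> 0\<close> by (simp add: field_simps)
    moreover have "w * inverse u * p ^ (m - n - 1) \<in> V"
      using u w by (simp add: mult_mem power_mem p_mem)
    ultimately show ?thesis using inv \<open>x \<noteq> 0\<close> by blast
  qed
qed

lemma inverse_p_mult: "y \<in> V \<Longrightarrow> p * y \<noteq> 1"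
proof
  assume "y \<in> V" "p * y = 1"
  then have "inverse p = y" by (metis inverse_unique)
  then show False using inverse_p \<open>y \<in> V\<close> by simp
qed

lemma fractions_total:
  assumes "x \<in> fractions" "y \<in> fractions" "x \<noteq> 0" "y \<noteq> 0"
  shows "x / y \<in> V \<or> y / x \<in> V"
proof -
  obtain a b c d where *: "x = a / b" "a \<in> V" "b \<in> V" "b \<noteq> 0" "y = c / d" "c \<in> V" "d \<in> V" "d \<noteq> 0"
    using assms by (auto simp: fractions_def)
  then have "x / y = (a * d) / (b * c)" "c \<noteq> 0" using assms by auto
  then have "x / y \<in> fractions" using * by (auto intro!: fractionsI mult_mem)
  then show ?thesis
  proof (cases rule: fractions_cases)
    case (inv z)
    then have "y / x = p * z" by (metis inverse_divide inverse_inverse_eq)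
    then show ?thesis using inv p_mem by (simp add: mult_mem)
  qed simp
qed

text \<open>\<open>c\<close> has least valuation in \<open>A\<close>. Dividing the coefficients of a
  polynomial by such a \<open>c\<close> makes them integral with one of them equal to 1.\<close>

lemma min_fraction:
  assumes "finite A" "A \<subseteq> fractions" "a \<in> A" "a \<noteq> 0"
  shows "\<exists>c\<in>A. c \<noteq> 0 \<and> (\<forall>x\<in>A. x / c \<in> V)"
  using assms
proof (induction A arbitrary: a rule: finite_induct)
  case (insert y A)
  show ?case
  proof (cases "\<exists>a\<in>A. a \<noteq> 0")
    case True
    then obtain c where c: "c \<in> A" "c \<noteq> 0" "\<forall>x\<in>A. x / c \<in> V"
      using insert.IH insert.prems(1) by blast
    show ?thesis
    proof (cases "y / c \<in> V")
      case True then show ?thesis using c by auto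
    next
      case False
      then have "y \<noteq> 0" by auto
      moreover have "c \<in> fractions" "y \<in> fractions" using c insert.prems by auto
      ultimately have "c / y \<in> V" using fractions_total[of y c] c False by blast
      have "x / y \<in> V" if "x \<in> A" for x
        using c(2) c(3) that mult_mem[of "x / c" "c / y"] \<open>c / y \<in> V\<close> by simp
      then show ?thesis using \<open>y \<noteq> 0\<close> by auto
    qed
  next
    case False
    then have "y \<noteq> 0" using insert.prems by auto
    then show ?thesis using False by force
  qed
qed auto

text \<open>A fraction outside \<open>V\<close> is \<open>inverse (p * y)\<close>. Multiplying its
  monic equation of degree \<open>n\<close> by \<open>(p * y) ^ n\<close> turns every term but the
  leading one into a multiple of \<open>p\<close>, so \<open>p\<close> would be a unit.\<close>

lemma integral_fraction:
  assumes "x \<in> fractions" "x \<in> integral_closure V"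
  shows "x \<in> V"
  using assms(1)
proof (cases rule: fractions_cases)
  case (inv y)
  obtain q where q: "Polynomial.lead_coeff q = 1" "\<And>i. poly.coeff q i \<in> V" "poly q x = 0"
    using assms(2) by (auto simp: integral_closure_def coeffs_subset_iff)
  define n where "n = Polynomial.degree q"
  define z where "z = p * y"
  have z: "z \<in> V" "x * z = 1" "x \<noteq> 0" "z \<noteq> 0"
    using inv by (auto simp: z_def p_mem mult_mem field_simps)
  have "0 = (\<Sum>i\<le>n. poly.coeff q i * x ^ i) * z ^ n" using q(3) by (simp add: poly_altdef n_def)
  also have "\<dots> = (\<Sum>i\<le>n. poly.coeff q i * z ^ (n - i))"
    unfolding sum_distrib_right
  proof (rule sum.cong[OF refl])
    fix i assume "i \<in> {..n}"
    then have "z ^ n = z ^ i * z ^ (n - i)" by (simp add: power_add[symmetric])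
    moreover have "x ^ i * z ^ i = 1" using z by (simp add: power_mult_distrib[symmetric])
    ultimately show "poly.coeff q i * x ^ i * z ^ n = poly.coeff q i * z ^ (n - i)"
      by (metis (no_types, opaque_lifting) mult.assoc mult_1)
  qed
  also have "\<dots> = (\<Sum>i<n. poly.coeff q i * z ^ (n - i)) + poly.coeff q n * z ^ (n - n)"
    by (simp only: lessThan_Suc_atMost[symmetric] sum.lessThan_Suc)
  also have "poly.coeff q n * z ^ (n - n) = 1" using q(1) by (simp add: n_def)
  also have "(\<Sum>i<n. poly.coeff q i * z ^ (n - i)) = (\<Sum>i<n. p * (poly.coeff q i * y * z ^ (n - Suc i)))"
  proof (rule sum.cong[OF refl])
    fix i assume "i \<in> {..<n}"
    then have "n - i = Suc (n - Suc i)" by simp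
    then show "poly.coeff q i * z ^ (n - i) = p * (poly.coeff q i * y * z ^ (n - Suc i))"
      by (simp add: z_def algebra_simps)
  qed
  finally have "0 = p * (\<Sum>i<n. poly.coeff q i * y * z ^ (n - Suc i)) + 1"
    by (simp only: sum_distrib_left)
  then have "p * (- (\<Sum>i<n. poly.coeff q i * y * z ^ (n - Suc i))) = 1"
    by (metis add.commute minus_unique mult_minus_right)
  moreover have "- (\<Sum>i<n. poly.coeff q i * y * z ^ (n - Suc i)) \<in> V"
    using q(2) inv z by (intro uminus_mem sum_mem mult_mem power_mem) auto
  ultimately show ?thesis using inverse_p_mult by blast
qed

text \<open>An element with the least exponent of \<open>p\<close> divides all others.\<close>

lemma ideal_generator:
  assumes "I \<subseteq> V" "r0 \<in> I" "r0 \<noteq> 0"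
  shows "\<exists>g\<in>I. g \<noteq> 0 \<and> (\<forall>r\<in>I. r / g \<in> V)"
proof -
  define Q where "Q n \<longleftrightarrow> (\<exists>g\<in>I. g \<noteq> 0 \<and> (\<exists>u. u \<in> V \<and> inverse u \<in> V \<and> g = u * p ^ n))" for n
  have "\<exists>n. Q n" using factorization[of r0] assms by (auto simp: Q_def)
  then have "Q (LEAST n. Q n)" by (rule LeastI_ex)
  then obtain g u n where g: "g \<in> I" "g \<noteq> 0" "u \<in> V" "inverse u \<in> V" "g = u * p ^ n"
    and n: "n = (LEAST n. Q n)" by (auto simp: Q_def)
  have "r / g \<in> V" if "r \<in> I" for r
  proof (cases "r = 0")
    case False
    have "r \<in> V" using that assms(1) by auto
    then obtain w m where w: "w \<in> V" "inverse w \<in> V" "r = w * p ^ m"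
      using factorization[OF _ False] by blast
    then have "Q m" using that False unfolding Q_def by blast
    then have "n \<le> m" unfolding n by (rule Least_le)
    then have "p ^ m = p ^ n * p ^ (m - n)" by (simp add: power_add[symmetric])
    then have "r / g = w * inverse u * p ^ (m - n)" using w g by (simp add: field_simps)
    then show ?thesis using w g by (simp add: mult_mem power_mem p_mem)
  qed simp
  then show ?thesis using g by blast
qed

text \<open>Induction on the generators: \<open>U \<inter> lin B\<close> is finitely generated by
  hypothesis, and the coefficients of \<open>b\<close> in elements of \<open>U\<close> form an ideal
  \<open>I\<close> whose generator \<open>g\<close> is attained at one further element
  \<open>u0\<close>.\<close>

lemma noetherian:
  assumes "finite B" "U \<subseteq> lin B" "0 \<in> U"
    and "\<And>x y. x \<in> U \<Longrightarrow> y \<in> U \<Longrightarrow> x + y \<in> U"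
    and "\<And>a x. a \<in> V \<Longrightarrow> x \<in> U \<Longrightarrow> a * x \<in> U"
  shows "\<exists>C. finite C \<and> C \<subseteq> U \<and> U = lin C"
  using assms
proof (induction B arbitrary: U rule: finite_induct)
  case empty
  then have "U = lin {}" by (auto simp: lin_def)
  then show ?case by (intro exI[of _ "{}"]) auto
next
  case (insert b B)
  define U' where "U' = U \<inter> lin B"
  have "\<exists>C. finite C \<and> C \<subseteq> U' \<and> U' = lin C"
    using insert.prems by (intro insert.IH) (auto simp: U'_def intro: lin_zero lin_add lin_smult)
  then obtain C where C: "finite C" "C \<subseteq> U'" "U' = lin C" by blast
  define I where "I = {r \<in> V. \<exists>u\<in>U. u - r * b \<in> lin B}"
  have split: "\<exists>r\<in>V. u - r * b \<in> lin B" if u: "u \<in> lin (insert b B)" for u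
  proof -
    obtain c where c: "u = (\<Sum>b'\<in>insert b B. c b' * b')" "c \<in> insert b B \<rightarrow> V"
      using u by (rule lin_elim)
    then have "u - c b * b = (\<Sum>b'\<in>B. c b' * b')" using insert.hyps by simp
    then have "u - c b * b \<in> lin B" by (rule lin_intro) (use c in auto)
    then show ?thesis using c by auto
  qed
  show ?case
  proof (cases "I \<subseteq> {0}")
    case True
    have "u \<in> U'" if "u \<in> U" for u
    proof -
      obtain r where "r \<in> V" "u - r * b \<in> lin B" using split insert.prems(1) \<open>u \<in> U\<close> by blast
      moreover then have "r = 0" using True that by (auto simp: I_def)
      ultimately show ?thesis using that by (simp add: U'_def)
    qed
    then have "U = U'" by (auto simp: U'_def)
    then show ?thesis using C by blast
  next
    case False
    moreover have "I \<subseteq> V" by (auto simp: I_def)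
    ultimately obtain g where g: "g \<in> I" "g \<noteq> 0" "\<And>r. r \<in> I \<Longrightarrow> r / g \<in> V"
      using ideal_generator[of I] by blast
    then obtain u0 where u0: "u0 \<in> U" "u0 - g * b \<in> lin B" by (auto simp: I_def)
    have fin: "finite (insert u0 C)" using C by simp
    have "u \<in> lin (insert u0 C)" if u: "u \<in> U" for u
    proof -
      obtain r where r: "r \<in> V" "u - r * b \<in> lin B" using split insert.prems(1) u by blast
      then have rg: "r / g \<in> V" using g(3) u by (auto simp: I_def)
      have "u + (- (r / g)) * u0 \<in> U"
        using rg u u0 insert.prems uminus_mem by blast
      moreover have "(u - r * b) + (- (r / g)) * (u0 - g * b) \<in> lin B"
        using rg r u0 by (intro lin_add lin_smult uminus_mem) auto
      moreover have "(u - r * b) + (- (r / g)) * (u0 - g * b) = u + (- (r / g)) * u0"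
        using g(2) by (simp add: algebra_simps)
      ultimately have "u + (- (r / g)) * u0 \<in> U'" unfolding U'_def by (metis IntI)
      then have "u + (- (r / g)) * u0 \<in> lin C" using C(3) by simp
      then have "u + (- (r / g)) * u0 \<in> lin (insert u0 C)" by (rule lin_mono[OF fin, rotated]) auto
      moreover have "(r / g) * u0 \<in> lin (insert u0 C)"
        by (intro lin_smult rg lin_base[OF fin]) simp
      ultimately have "(u + (- (r / g)) * u0) + (r / g) * u0 \<in> lin (insert u0 C)" by (rule lin_add)
      then show ?thesis by simp
    qed
    moreover have "u \<in> U" if u: "u \<in> lin (insert u0 C)" for u
      by (rule lin_least[OF u]) (use insert.prems u0 C in \<open>auto simp: U'_def\<close>)
    moreover have "insert u0 C \<subseteq> U" using u0 C by (auto simp: U'_def)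
    ultimately show ?thesis using fin by blast
  qed
qed

end

section \<open>Galois extensions\<close>

abbreviation finv :: "('a \<Rightarrow> 'b) \<Rightarrow> 'b \<Rightarrow> 'a" where
  "finv \<equiv> inv_into UNIV"

text \<open>The extension in Artin's form: a finite group of field automorphisms whose fixed field
  is the quotient field of \<open>V\<close>.\<close>

locale galois_setting = dvr_subring V p for V :: "'k::field set" and p +
  fixes \<G> :: "('k \<Rightarrow> 'k) set"
  assumes finite_G [simp]: "finite \<G>"
    and id_mem [simp]: "id \<in> \<G>"
    and comp_mem: "\<sigma> \<in> \<G> \<Longrightarrow> \<tau> \<in> \<G> \<Longrightarrow> \<sigma> \<circ> \<tau> \<in> \<G>"
    and inv_mem: "\<sigma> \<in> \<G> \<Longrightarrow> finv \<sigma> \<in> \<G>"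
    and bij: "\<sigma> \<in> \<G> \<Longrightarrow> bij \<sigma>"
    and hom_add: "\<sigma> \<in> \<G> \<Longrightarrow> \<sigma> (x + y) = \<sigma> x + \<sigma> y"
    and hom_mult: "\<sigma> \<in> \<G> \<Longrightarrow> \<sigma> (x * y) = \<sigma> x * \<sigma> y"
    and fixed_field: "{x. \<forall>\<sigma>\<in>\<G>. \<sigma> x = x} = fractions"
begin

lemma hom_zero [simp]: "\<sigma> \<in> \<G> \<Longrightarrow> \<sigma> 0 = 0"
  using hom_add[of \<sigma> 0 0] by (metis add.right_neutral add_left_cancel)

lemma hom_eq_0_iff [simp]: "\<sigma> \<in> \<G> \<Longrightarrow> \<sigma> x = 0 \<longleftrightarrow> x = 0"
  using bij[of \<sigma>] hom_zero[of \<sigma>] by (metis bij_is_inj injD)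

lemma hom_one [simp]: "\<sigma> \<in> \<G> \<Longrightarrow> \<sigma> 1 = 1"
  using hom_mult[of \<sigma> 1 1] hom_eq_0_iff[of \<sigma> 1] by simp

lemma hom_uminus: "\<sigma> \<in> \<G> \<Longrightarrow> \<sigma> (- x) = - \<sigma> x"
  using hom_add[of \<sigma> x "- x"] by (simp add: eq_neg_iff_add_eq_0 add.commute)

lemma hom_diff: "\<sigma> \<in> \<G> \<Longrightarrow> \<sigma> (x - y) = \<sigma> x - \<sigma> y"
  using hom_add[of \<sigma> x "- y"] by (simp add: hom_uminus)

lemma hom_inverse: "\<sigma> \<in> \<G> \<Longrightarrow> \<sigma> (inverse x) = inverse (\<sigma> x)"
  using hom_mult[of \<sigma> x "inverse x"] by (cases "x = 0") (auto intro: inverse_unique[symmetric])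

lemma hom_power: "\<sigma> \<in> \<G> \<Longrightarrow> \<sigma> (x ^ n) = \<sigma> x ^ n"
  by (induction n) (auto simp: hom_mult)

lemma hom_power_int: "\<sigma> \<in> \<G> \<Longrightarrow> \<sigma> (x powi n) = \<sigma> x powi n"
  by (auto simp: power_int_def hom_power hom_inverse)

lemma hom_sum: "\<sigma> \<in> \<G> \<Longrightarrow> \<sigma> (sum h A) = (\<Sum>i\<in>A. \<sigma> (h i))"
  by (induction A rule: infinite_finite_induct) (auto simp: hom_add)

lemma hom_prod: "\<sigma> \<in> \<G> \<Longrightarrow> \<sigma> (prod h A) = (\<Prod>i\<in>A. \<sigma> (h i))"
  by (induction A rule: infinite_finite_induct) (auto simp: hom_mult)

lemma inv_apply [simp]: "\<sigma> \<in> \<G> \<Longrightarrow> finv \<sigma> (\<sigma> x) = x" "\<sigma> \<in> \<G> \<Longrightarrow> \<sigma> (finv \<sigma> x) = x"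
  using bij[of \<sigma>] by (auto simp: bij_is_inj bij_is_surj surj_f_inv_f)

lemma comp_inv [simp]: "\<sigma> \<in> \<G> \<Longrightarrow> \<sigma> \<circ> finv \<sigma> = id" "\<sigma> \<in> \<G> \<Longrightarrow> finv \<sigma> \<circ> \<sigma> = id"
  by auto

lemma inv_inv [simp]: "\<sigma> \<in> \<G> \<Longrightarrow> finv (finv \<sigma>) = \<sigma>"
  using bij inv_inv_eq by blast

lemma V_subset_fractions: "x \<in> V \<Longrightarrow> x \<in> fractions"
  using fractionsI[of x 1] by simp

lemma hom_fixed: "\<sigma> \<in> \<G> \<Longrightarrow> x \<in> fractions \<Longrightarrow> \<sigma> x = x"
  using fixed_field by auto

lemma hom_fixed_V: "\<sigma> \<in> \<G> \<Longrightarrow> x \<in> V \<Longrightarrow> \<sigma> x = x"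
  using hom_fixed V_subset_fractions by blast

lemma hom_p [simp]: "\<sigma> \<in> \<G> \<Longrightarrow> \<sigma> p = p"
  using hom_fixed_V p_mem by blast

lemma bij_comp_left: "\<tau> \<in> \<G> \<Longrightarrow> bij_betw (\<lambda>\<sigma>. \<tau> \<circ> \<sigma>) \<G> \<G>"
  by (rule bij_betwI[where g = "\<lambda>\<sigma>. finv \<tau> \<circ> \<sigma>"])
    (auto intro: comp_mem inv_mem simp: comp_assoc[symmetric])

lemma fractionsI_fixed: "(\<And>\<sigma>. \<sigma> \<in> \<G> \<Longrightarrow> \<sigma> x = x) \<Longrightarrow> x \<in> fractions"
  using fixed_field by blast

section \<open>The integral closure and the group acting on it\<close>

abbreviation S :: "'k set" where "S \<equiv> integral_closure V"

sublocale S: field_subring S by (rule field_subring_integral_closure)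

lemma V_subset_S: "x \<in> V \<Longrightarrow> x \<in> S"
  by (rule subset_integral_closure)

lemma p_mem_S: "p \<in> S" using p_mem V_subset_S by blast

lemma hom_poly:
  assumes "\<sigma> \<in> \<G>" "\<And>i. poly.coeff P i \<in> fractions"
  shows "\<sigma> (poly P x) = poly P (\<sigma> x)"
  using assms by (simp add: poly_altdef hom_sum hom_mult hom_power hom_fixed)

lemma hom_S: "\<sigma> \<in> \<G> \<Longrightarrow> x \<in> S \<Longrightarrow> \<sigma> x \<in> S"
proof -
  assume s: "\<sigma> \<in> \<G>" "x \<in> S"
  then obtain P where P: "Polynomial.lead_coeff P = 1" "\<And>i. poly.coeff P i \<in> V" "poly P x = 0"
    by (auto simp: integral_closure_def coeffs_subset_iff)
  then have "poly P (\<sigma> x) = \<sigma> (poly P x)"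
    using hom_poly[OF s(1), of P x] V_subset_fractions by simp
  then have "poly P (\<sigma> x) = 0" using P(3) s(1) by simp
  then show "\<sigma> x \<in> S" using P by (auto simp: integral_closure_def coeffs_subset_iff)
qed

lemma hom_S_iff [simp]: "\<sigma> \<in> \<G> \<Longrightarrow> \<sigma> x \<in> S \<longleftrightarrow> x \<in> S"
  using hom_S[of \<sigma> x] hom_S[of "finv \<sigma>" "\<sigma> x"] inv_mem by auto

lemma fractions_inter_S: "x \<in> fractions \<Longrightarrow> x \<in> S \<Longrightarrow> x \<in> V"
  by (rule integral_fraction)

lemma norm_mem_V: "x \<in> S \<Longrightarrow> (\<Prod>\<sigma>\<in>\<G>. \<sigma> x) \<in> V"
proof (intro fractions_inter_S fractionsI_fixed)
  fix \<tau> assume t: "\<tau> \<in> \<G>"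
  show "\<tau> (\<Prod>\<sigma>\<in>\<G>. \<sigma> x) = (\<Prod>\<sigma>\<in>\<G>. \<sigma> x)"
    using prod.reindex_bij_betw[OF bij_comp_left[OF t], of "\<lambda>\<sigma>. \<sigma> x"] t by (simp add: hom_prod)
qed (auto intro!: S.prod_mem)

lemma trace_mem_V: "x \<in> S \<Longrightarrow> (\<Sum>\<sigma>\<in>\<G>. \<sigma> x) \<in> V"
proof (intro fractions_inter_S fractionsI_fixed)
  fix \<tau> assume t: "\<tau> \<in> \<G>"
  show "\<tau> (\<Sum>\<sigma>\<in>\<G>. \<sigma> x) = (\<Sum>\<sigma>\<in>\<G>. \<sigma> x)"
    using sum.reindex_bij_betw[OF bij_comp_left[OF t], of "\<lambda>\<sigma>. \<sigma> x"] t by (simp add: hom_sum)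
qed (auto intro!: S.sum_mem)

lemma multiple_in_V:
  assumes "x \<in> S" "x \<noteq> 0"
  obtains y where "y \<in> S" "x * y \<in> V" "x * y \<noteq> 0"
proof (rule that)
  have eq: "(\<Prod>\<sigma>\<in>\<G>. \<sigma> x) = x * (\<Prod>\<sigma>\<in>\<G>-{id}. \<sigma> x)"
    using prod.remove[of \<G> id "\<lambda>\<sigma>. \<sigma> x"] by simp
  show "(\<Prod>\<sigma>\<in>\<G>-{id}. \<sigma> x) \<in> S" using assms by (auto intro!: S.prod_mem)
  show "x * (\<Prod>\<sigma>\<in>\<G>-{id}. \<sigma> x) \<in> V" using norm_mem_V[OF assms(1)] eq by simp
  show "x * (\<Prod>\<sigma>\<in>\<G>-{id}. \<sigma> x) \<noteq> 0" using assms by auto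
qed

text \<open>Automorphisms move the linear factors. The subset \<open>A\<close> lets the factors be
  added one by one; for the whole group the factors are permuted, so the coefficients lie in the
  fixed field.\<close>

lemma coeff_prod_linear:
  assumes "\<tau> \<in> \<G>" "A \<subseteq> \<G>"
  shows "\<tau> (poly.coeff (\<Prod>\<sigma>\<in>A. [:- \<sigma> x, 1:]) i) = poly.coeff (\<Prod>\<sigma>\<in>A. [:- (\<tau> \<circ> \<sigma>) x, 1:]) i"
proof -
  have "finite A" using assms(2) finite_G by (rule finite_subset)
  then show ?thesis using assms(2)
  proof (induction A arbitrary: i rule: finite_induct)
    case empty
    then show ?case using assms(1) by (simp add: coeff_1)
  next
    case (insert \<sigma> A)
    have *: "poly.coeff ([:c, 1:] * q) i = c * poly.coeff q i + (case i of 0 \<Rightarrow> 0 | Suc j \<Rightarrow> poly.coeff q j)"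
      for c :: 'k and q i
      by (simp add: coeff_pCons split: nat.split)
    show ?case using insert assms(1)
      by (simp add: * hom_add hom_mult hom_uminus hom_diff split: nat.split del: mult_pCons_left)
  qed
qed

text \<open>Horner's scheme: for a relation \<open>a\<^sub>n x\<^sup>n + \<dots> + a\<^sub>0 = 0\<close> over \<open>V\<close> with \<open>a\<^sub>i = 1\<close>, the elements
  \<open>b\<^sub>i = a\<^sub>n x\<^sup>n\<^sup>-\<^sup>i + \<dots> + a\<^sub>i\<close> stabilise the module spanned by \<open>1, \<dots>, x\<^sup>n\<^sup>-\<^sup>1\<close>, and
  \<open>b\<^sub>i - x b\<^sub>i\<^sub>+\<^sub>1 = a\<^sub>i = 1\<close>.\<close>

lemma pruefer:
  obtains b c where "b \<in> S" "c \<in> S" "x * b \<in> S" "x * c \<in> S" "b - x * c = 1"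
proof -
  define Q where "Q = (\<Prod>\<sigma>\<in>\<G>. [:- \<sigma> x, 1:])"
  have Q_fixed: "poly.coeff Q i \<in> fractions" for i
  proof (rule fractionsI_fixed)
    fix \<tau> assume t: "\<tau> \<in> \<G>"
    have "\<tau> (poly.coeff Q i) = poly.coeff (\<Prod>\<sigma>\<in>\<G>. [:- (\<tau> \<circ> \<sigma>) x, 1:]) i"
      unfolding Q_def by (rule coeff_prod_linear[OF t order_refl])
    also have "(\<Prod>\<sigma>\<in>\<G>. [:- (\<tau> \<circ> \<sigma>) x, 1:]) = Q"
      unfolding Q_def by (rule prod.reindex_bij_betw[OF bij_comp_left[OF t]])
    finally show "\<tau> (poly.coeff Q i) = poly.coeff Q i" .
  qed
  have "poly Q x = 0"
    unfolding Q_def poly_prod by (rule prod_zero) (auto intro!: bexI[of _ id])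
  have "Q \<noteq> 0" unfolding Q_def by simp
  define n where "n = Polynomial.degree Q"
  have "n \<noteq> 0"
  proof
    assume "n = 0"
    then obtain a where "Q = [:a:]" unfolding n_def by (metis degree_eq_zeroE)
    then show False using \<open>poly Q x = 0\<close> \<open>Q \<noteq> 0\<close> by simp
  qed
  \<comment> \<open>The coefficient to be normalised to 1 must have least valuation, so that all the
    others stay in \<open>V\<close>.\<close>
  have "\<exists>c\<in>poly.coeff Q ` {..n}. c \<noteq> 0 \<and> (\<forall>a\<in>poly.coeff Q ` {..n}. a / c \<in> V)"
    by (rule min_fraction[where a = "Polynomial.lead_coeff Q"]) (use Q_fixed \<open>Q \<noteq> 0\<close> n_def in auto)
  then obtain k where k: "k \<le> n" "poly.coeff Q k \<noteq> 0"
    "\<And>j. j \<le> n \<Longrightarrow> poly.coeff Q j / poly.coeff Q k \<in> V" by auto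
  define a where "a j = poly.coeff Q j / poly.coeff Q k" for j
  have a: "a j \<in> V" if "j \<le> n" for j using k that by (simp add: a_def)
  have ak: "a k = 1" using k by (simp add: a_def)
  have "(\<Sum>j\<le>n. a j * x ^ j) = poly Q x / poly.coeff Q k"
    by (simp add: poly_altdef n_def a_def sum_divide_distrib)
  then have root: "(\<Sum>j\<le>n. a j * x ^ j) = 0" using \<open>poly Q x = 0\<close> by simp
  define b where "b i = (\<Sum>j\<in>{i..n}. a j * x ^ (j - i))" for i
  define W where "W = (\<lambda>i. x ^ i) ` {..<n}"
  have fin: "finite W" by (simp add: W_def)
  have pow: "x ^ i \<in> lin W" if "i < n" for i
    using that by (intro lin_base[OF fin]) (auto simp: W_def)
  have bx: "b i * x ^ m = (\<Sum>j\<in>{i..n}. a j * x ^ (j - i + m))" for i m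
    unfolding b_def sum_distrib_right by (rule sum.cong) (simp_all only: power_add mult.assoc)
  have bS: "b i \<in> S" if i: "i \<le> Suc n" for i
  proof (rule integral_closureI[OF fin, of 1])
    show "1 \<in> W" using \<open>n \<noteq> 0\<close> by (auto simp: W_def intro!: image_eqI[of _ _ 0])
    fix w assume "w \<in> W"
    then obtain m where m: "m < n" "w = x ^ m" by (auto simp: W_def)
    show "b i * w \<in> lin W"
    proof (cases "m < i")
      case True
      have "(\<Sum>j\<in>{i..n}. a j * x ^ (j - i + m)) \<in> lin W"
        by (rule lin_sum, rule lin_smult) (use True m in \<open>auto intro!: a pow\<close>)
      then show ?thesis using bx m by simp
    next
      case False
      \<comment> \<open>For \<open>m \<ge> i\<close> the relation replaces the tail
        \<open>b i * x ^ i\<close> by minus the initial segment. After multiplication by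
        \<open>x ^ (m - i)\<close> the exponents are below \<open>m\<close>, hence below
        \<open>n\<close>.\<close>
      have "{..n} = {..<i} \<union> {i..n}" using i by auto
      then have "(\<Sum>j\<le>n. a j * x ^ j) = (\<Sum>j<i. a j * x ^ j) + (\<Sum>j\<in>{i..n}. a j * x ^ j)"
        by (metis (no_types, lifting) sum.union_disjoint finite_lessThan finite_atLeastAtMost ivl_disj_int_one(4) ivl_disj_int_two(7) inf_commute disjoint_iff lessThan_iff atLeastAtMost_iff not_less)
      moreover have "(\<Sum>j\<in>{i..n}. a j * x ^ j) = b i * x ^ i" unfolding bx by (rule sum.cong) auto
      ultimately have "b i * x ^ i = - (\<Sum>j<i. a j * x ^ j)" using root
        by (simp add: eq_neg_iff_add_eq_0 add.commute)
      moreover have "x ^ m = x ^ i * x ^ (m - i)" using False by (simp add: power_add[symmetric])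
      ultimately have "b i * w = - (\<Sum>j<i. a j * x ^ (j + (m - i)))"
        using m by (simp add: mult.assoc[symmetric] sum_distrib_right power_add)
      moreover have "(\<Sum>j<i. a j * x ^ (j + (m - i))) \<in> lin W"
        by (rule lin_sum, rule lin_smult) (use False m i in \<open>auto intro!: a pow\<close>)
      ultimately show ?thesis by (simp add: lin_uminus)
    qed
  qed simp
  have step: "b i = a i + x * b (Suc i)" if "i \<le> n" for i
  proof -
    have "b i = a i * x ^ (i - i) + (\<Sum>j\<in>{Suc i..n}. a j * x ^ (j - i))"
      unfolding b_def using that by (rule sum.atLeast_Suc_atMost)
    also have "(\<Sum>j\<in>{Suc i..n}. a j * x ^ (j - i)) = (\<Sum>j\<in>{Suc i..n}. x * (a j * x ^ (j - Suc i)))"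
    proof (rule sum.cong[OF refl])
      fix j assume "j \<in> {Suc i..n}"
      then have "j - i = Suc (j - Suc i)" by auto
      then show "a j * x ^ (j - i) = x * (a j * x ^ (j - Suc i))" by simp
    qed
    also have "\<dots> = x * b (Suc i)" by (simp add: b_def sum_distrib_left)
    finally show ?thesis by simp
  qed
  have xb: "x * b (Suc i) \<in> S" if "i \<le> n" for i
  proof -
    have "x * b (Suc i) = b i - a i" using step[OF that] by simp
    then show ?thesis using bS[of i] a[of i] that by (simp add: S.diff_mem V_subset_S)
  qed
  have b0: "b 0 = 0" using root by (simp add: b_def atLeast0AtMost)
  show ?thesis
  proof (rule that[of "b k" "b (Suc k)"])
    show "x * b k \<in> S"
    proof (cases k)
      case 0 then show ?thesis using b0 by simp
    next
      case (Suc i) then show ?thesis using xb[of i] k by simp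
    qed
    show "b k - x * b (Suc k) = 1" using step[OF k(1)] ak by simp
  qed (use bS xb k in auto)
qed

text \<open>By \<open>pruefer\<close> both \<open>b\<close> and \<open>c\<close> multiply
  \<open>x\<close> into \<open>S\<close>, and \<open>b - x * c = 1\<close> keeps them from vanishing
  together. A norm then turns the denominator in \<open>S\<close> into one in
  \<open>V\<close>.\<close>

lemma multiple_in_S:
  obtains v where "v \<in> V" "v \<noteq> 0" "v * x \<in> S"
proof -
  obtain b c where bc: "b \<in> S" "c \<in> S" "x * b \<in> S" "x * c \<in> S" "b - x * c = 1"
    by (rule pruefer)
  define d where "d = (if b = 0 then c else b)"
  have d: "d \<in> S" "d \<noteq> 0" "x * d \<in> S" using bc by (auto simp: d_def)
  obtain y where y: "y \<in> S" "d * y \<in> V" "d * y \<noteq> 0" using multiple_in_V[OF d(1,2)] by blast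
  show ?thesis
    by (rule that[of "d * y"]) (use y d S.mult_mem[of "x * d" y] in \<open>auto simp: algebra_simps\<close>)
qed

section \<open>Maximal ideals of the integral closure\<close>

definition max_ideal :: "'k set \<Rightarrow> bool" where
  "max_ideal M \<longleftrightarrow> maximalideal M (ring_on S)"

lemmas max_ideal_iff = max_ideal_def[unfolded S.maximalideal_ring_on_iff]

context
  fixes M assumes M: "max_ideal M"
begin

lemma max_ideal_subset: "x \<in> M \<Longrightarrow> x \<in> S"
  and max_ideal_zero: "0 \<in> M"
  and max_ideal_add: "x \<in> M \<Longrightarrow> y \<in> M \<Longrightarrow> x + y \<in> M"
  and max_ideal_mult: "s \<in> S \<Longrightarrow> x \<in> M \<Longrightarrow> s * x \<in> M"
  and max_ideal_mult_right: "s \<in> S \<Longrightarrow> x \<in> M \<Longrightarrow> x * s \<in> M"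
  and max_ideal_one: "1 \<notin> M"
  and max_ideal_inverse: "s \<in> S \<Longrightarrow> s \<notin> M \<Longrightarrow> \<exists>t\<in>S. 1 - s * t \<in> M"
  using M unfolding max_ideal_iff by (auto simp: mult.commute[of x s])

lemma max_ideal_uminus: "x \<in> M \<Longrightarrow> - x \<in> M"
  using max_ideal_mult[of "-1" x] S.uminus_mem[of 1] by simp

lemma max_ideal_diff: "x \<in> M \<Longrightarrow> y \<in> M \<Longrightarrow> x - y \<in> M"
  using max_ideal_add[of x "- y"] max_ideal_uminus by simp

lemma max_ideal_prime:
  assumes "s \<in> S" "t \<in> S" "s \<notin> M" "t \<notin> M"
  shows "s * t \<notin> M"
proof
  assume st: "s * t \<in> M"
  obtain u where u: "u \<in> S" "1 - s * u \<in> M" using max_ideal_inverse assms by blast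
  have "t * (1 - s * u) \<in> M" using u assms max_ideal_mult by blast
  moreover have "u * (s * t) \<in> M" using u st max_ideal_mult by blast
  ultimately have "t * (1 - s * u) + u * (s * t) \<in> M" by (rule max_ideal_add)
  then show False using assms(4) by (simp add: algebra_simps)
qed

lemma max_ideal_prod_notin:
  "finite A \<Longrightarrow> (\<And>i. i \<in> A \<Longrightarrow> h i \<in> S) \<Longrightarrow> (\<And>i. i \<in> A \<Longrightarrow> h i \<notin> M) \<Longrightarrow> prod h A \<notin> M"
proof (induction A rule: finite_induct)
  case (insert x A)
  then have "prod h A \<in> S" by (intro S.prod_mem) auto
  then show ?case using insert max_ideal_prime[of "h x" "prod h A"] by auto
qed (simp add: max_ideal_one)

lemma max_ideal_prod_in:
  "finite A \<Longrightarrow> (\<And>i. i \<in> A \<Longrightarrow> h i \<in> S) \<Longrightarrow> i \<in> A \<Longrightarrow> h i \<in> M \<Longrightarrow> prod h A \<in> M"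
  using prod.remove[of A i h] max_ideal_mult_right[of "prod h (A - {i})" "h i"] S.prod_mem[of "A - {i}" h]
  by simp

end

lemma max_ideal_hom:
  assumes "\<sigma> \<in> \<G>" "max_ideal M"
  shows "max_ideal (\<sigma> ` M)"
proof -
  note M = max_ideal_subset[OF assms(2)] max_ideal_zero[OF assms(2)] max_ideal_add[OF assms(2)]
    max_ideal_mult[OF assms(2)] max_ideal_one[OF assms(2)] max_ideal_inverse[OF assms(2)]
  have mem: "x \<in> \<sigma> ` M \<longleftrightarrow> finv \<sigma> x \<in> M" for x
    using assms(1) by (auto simp: image_iff) (metis inv_apply(2))
  note i = inv_mem[OF assms(1)]
  show ?thesis
    unfolding max_ideal_iff mem
  proof (intro conjI ballI)
    show "\<sigma> ` M \<subseteq> S" using M(1) assms(1) by auto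
    fix s assume s: "s \<in> S - \<sigma> ` M"
    then have "finv \<sigma> s \<in> S" "finv \<sigma> s \<notin> M" using mem i by auto
    then obtain t where t: "t \<in> S" "1 - finv \<sigma> s * t \<in> M" using M(6) by blast
    have "finv \<sigma> (1 - s * \<sigma> t) = 1 - finv \<sigma> s * t"
      using assms(1) i by (simp add: hom_diff hom_mult)
    then show "\<exists>t\<in>S. finv \<sigma> (1 - s * t) \<in> M" using t assms(1) by (intro bexI[of _ "\<sigma> t"]) auto
  qed (use M i mem in \<open>auto simp: hom_add hom_mult\<close>)
qed

lemma exists_max_ideal:
  assumes "I \<subseteq> S" "0 \<in> I" "\<And>x y. x \<in> I \<Longrightarrow> y \<in> I \<Longrightarrow> x + y \<in> I"
    "\<And>s x. s \<in> S \<Longrightarrow> x \<in> I \<Longrightarrow> s * x \<in> I" "1 \<notin> I"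
  obtains M where "max_ideal M" "I \<subseteq> M"
  using S.exists_maximalideal[of I] assms unfolding max_ideal_def S.ideal_ring_on_iff by blast

end

section \<open>Valuations at the maximal ideals\<close>

text \<open>Unramifiedness in the form in which it is applied. Clearing denominators yields a sum of
  two products from \<open>M\<close>, whence the shape of \<open>p_notin_square\<close>.
  Separability says that every residue class is a simple root of the reduction of a polynomial over
  \<open>V\<close>.\<close>

locale unramified_setting = galois_setting V p \<G> for V :: "'k::field set" and p \<G> +
  assumes p_in_max_ideal: "max_ideal M \<Longrightarrow> p \<in> M"
    and p_notin_square: "max_ideal M \<Longrightarrow> a \<in> M \<Longrightarrow> b \<in> M \<Longrightarrow> c \<in> M \<Longrightarrow> d \<in> M \<Longrightarrow> p \<noteq> a * b + c * d"
    and separable_lift: "max_ideal M \<Longrightarrow> x \<in> S \<Longrightarrow>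
      \<exists>P. (\<forall>i. poly.coeff P i \<in> V) \<and> poly P x \<in> M \<and> poly (pderiv P) x \<notin> M"
begin

text \<open>The localization of \<open>S\<close> at \<open>M\<close>, as a subring of the
  field.\<close>

definition loc :: "'k set \<Rightarrow> 'k set" where
  "loc M = {x. \<exists>s\<in>S - M. s * x \<in> S}"

definition loc_unit :: "'k set \<Rightarrow> 'k \<Rightarrow> bool" where
  "loc_unit M x \<longleftrightarrow> x \<in> loc M \<and> inverse x \<in> loc M \<and> x \<noteq> 0"

text \<open>Since the extension is unramified, the same \<open>p\<close> is a uniformizer at every
  maximal ideal and normalises all the valuations at once.\<close>

definition val :: "'k set \<Rightarrow> 'k \<Rightarrow> int" where
  "val M x = (THE k. loc_unit M (x * p powi (- k)))"

text \<open>\<open>val M 0\<close> is unspecified; admitting 0 here makes the condition closed under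
  sums.\<close>

definition val_ge :: "'k set \<Rightarrow> int \<Rightarrow> 'k \<Rightarrow> bool" where
  "val_ge M k x \<longleftrightarrow> x = 0 \<or> k \<le> val M x"

context
  fixes M assumes M: "max_ideal M"
begin

lemma S_subset_loc: "x \<in> S \<Longrightarrow> x \<in> loc M"
  using max_ideal_one[OF M] unfolding loc_def by (auto intro!: bexI[of _ 1])

lemma field_subring_loc: "field_subring (loc M)"
proof
  show "0 \<in> loc M" "1 \<in> loc M" using S_subset_loc by auto
  fix x y assume "x \<in> loc M" "y \<in> loc M"
  then obtain s t where st: "s \<in> S" "s \<notin> M" "s * x \<in> S" "t \<in> S" "t \<notin> M" "t * y \<in> S"
    by (auto simp: loc_def)
  have m: "s * t \<in> S - M" using st max_ideal_prime[OF M] S.mult_mem by blast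
  have "(s * t) * (x + y) = t * (s * x) + s * (t * y)" by (simp add: algebra_simps)
  then have "(s * t) * (x + y) \<in> S" using st S.mult_mem S.add_mem by simp
  then show "x + y \<in> loc M" using m unfolding loc_def by blast
  have "(s * t) * (x * y) = (s * x) * (t * y)" by (simp add: algebra_simps)
  then have "(s * t) * (x * y) \<in> S" using S.mult_mem[OF st(3) st(6)] by (simp only:)
  then show "x * y \<in> loc M" using m unfolding loc_def by blast
  have "s * (- x) \<in> S" using st S.uminus_mem by simp
  then show "- x \<in> loc M" using st unfolding loc_def by blast
qed

interpretation O: field_subring "loc M" by (rule field_subring_loc)

lemma inverse_mem_loc: "s \<in> S \<Longrightarrow> s \<notin> M \<Longrightarrow> inverse s \<in> loc M"
  using max_ideal_zero[OF M] unfolding loc_def by (cases "s = 0") (auto intro!: bexI[of _ s])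

lemma inverse_notin_loc: "x \<in> M \<Longrightarrow> x \<noteq> 0 \<Longrightarrow> inverse x \<notin> loc M"
proof
  assume x: "x \<in> M" "x \<noteq> 0" "inverse x \<in> loc M"
  then obtain s where s: "s \<in> S" "s \<notin> M" "s * inverse x \<in> S" by (auto simp: loc_def)
  have "(s * inverse x) * x \<in> M" using s(3) x(1) by (rule max_ideal_mult[OF M])
  then show False using s x by (simp add: mult.assoc)
qed

text \<open>With \<open>b - x * c = 1\<close> from \<open>pruefer\<close>, one of \<open>b\<close>
  and \<open>x * c\<close> lies outside \<open>M\<close>. The first is then a denominator for
  \<open>x\<close>, the second one for \<open>inverse x\<close>.\<close>

lemma loc_total: "x \<in> loc M \<or> inverse x \<in> loc M"
proof -
  obtain b c where bc: "b \<in> S" "c \<in> S" "x * b \<in> S" "x * c \<in> S" "b - x * c = 1"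
    by (rule pruefer)
  show ?thesis
  proof (cases "b \<in> M")
    case False
    then show ?thesis using bc unfolding loc_def by (auto simp: mult.commute intro!: bexI[of _ b])
  next
    case True
    then have xc: "x * c \<notin> M" using bc max_ideal_one[OF M] max_ideal_diff[OF M] by metis
    then have "x \<noteq> 0" using max_ideal_zero[OF M] by auto
    then have "(x * c) * inverse x = c" by (simp add: field_simps)
    then have "(x * c) * inverse x \<in> S" using bc(2) by (simp only:)
    then have "inverse x \<in> loc M" using xc bc(4) unfolding loc_def by blast
    then show ?thesis ..
  qed
qed

text \<open>Otherwise \<open>x\<close> and \<open>p / x\<close> would both be non-units of the
  localization, and clearing denominators would write \<open>p\<close> as a sum of two products from
  \<open>M\<close>.\<close>

lemma uniformizer:
  assumes x: "x \<in> loc M" "x \<noteq> 0" "inverse x \<notin> loc M"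
  shows "x / p \<in> loc M"
proof (rule ccontr)
  assume n: "x / p \<notin> loc M"
  then have "inverse (x / p) \<in> loc M" using loc_total by blast
  then obtain t where t: "t \<in> S" "t \<notin> M" "t * (p / x) \<in> S" by (auto simp: loc_def)
  obtain s where s: "s \<in> S" "s \<notin> M" "s * x \<in> S" using x by (auto simp: loc_def)
  have "s * x \<in> M"
  proof (rule ccontr)
    assume "s * x \<notin> M"
    then have "s * inverse (s * x) \<in> loc M"
      using inverse_mem_loc[OF s(3)] S_subset_loc s by (intro O.mult_mem) auto
    moreover have "s * inverse (s * x) = inverse x"
      using s max_ideal_zero[OF M] by (cases "s = 0") auto
    ultimately show False using x(3) by metis
  qed
  moreover have "t * (p / x) \<in> M"
  proof (rule ccontr)
    assume "t * (p / x) \<notin> M"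
    then have "t * inverse (t * (p / x)) \<in> loc M"
      using inverse_mem_loc[OF t(3)] S_subset_loc t by (intro O.mult_mem) auto
    moreover have "t * inverse (t * (p / x)) = x / p"
      using t max_ideal_zero[OF M] by (cases "t = 0") auto
    ultimately show False using n by metis
  qed
  \<comment> \<open>Clearing denominators gives \<open>s * t * p\<close> as a product of two
    elements of \<open>M\<close>. An inverse \<open>r\<close> of \<open>s * t\<close> modulo
    \<open>M\<close> restores \<open>p\<close>, at the price of the second product
    \<open>p * (1 - s * t * r)\<close>.\<close>
  moreover obtain r where r: "r \<in> S" "1 - (s * t) * r \<in> M"
    using max_ideal_inverse[OF M] max_ideal_prime[OF M] s t S.mult_mem by metis
  moreover have "t * (p / x) * r \<in> M" using r(1) \<open>t * (p / x) \<in> M\<close> by (rule max_ideal_mult_right[OF M])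
  ultimately have "p \<noteq> (s * x) * (t * (p / x) * r) + p * (1 - (s * t) * r)"
    using p_in_max_ideal[OF M] by (intro p_notin_square[OF M])
  then show False using x by (simp add: field_simps)
qed

lemma inverse_p_notin_loc: "inverse p \<notin> loc M"
  using inverse_notin_loc[OF p_in_max_ideal[OF M]] by simp

lemma p_mem_loc: "p \<in> loc M"
  using S_subset_loc p_mem_S by blast

lemma inverse_p_power_notin_loc: "inverse (p ^ Suc n) \<notin> loc M"
proof
  assume "inverse (p ^ Suc n) \<in> loc M"
  then have "inverse (p ^ Suc n) * p ^ n \<in> loc M"
    using p_mem_loc by (intro O.mult_mem O.power_mem)
  then show False using inverse_p_notin_loc by (simp add: field_simps)
qed

lemma powi_mem_loc_iff: "p powi k \<in> loc M \<longleftrightarrow> 0 \<le> k"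
proof
  assume "p powi k \<in> loc M"
  show "0 \<le> k"
  proof (rule ccontr)
    assume "\<not> 0 \<le> k"
    then obtain n where "k = - int (Suc n)" by (cases k rule: int_cases) auto
    then have "p powi k = inverse (p ^ Suc n)" by (simp only: power_int_minus power_int_of_nat)
    then show False using \<open>p powi k \<in> loc M\<close> inverse_p_power_notin_loc by simp
  qed
next
  assume "0 \<le> k"
  then show "p powi k \<in> loc M" using p_mem_loc by (auto simp: power_int_def intro: O.power_mem)
qed

section \<open>The normalised valuation at a maximal ideal\<close>

lemma loc_unit_mult: "loc_unit M x \<Longrightarrow> loc_unit M y \<Longrightarrow> loc_unit M (x * y)"
  unfolding loc_unit_def by (auto intro: O.mult_mem)

lemma loc_unit_inverse: "loc_unit M x \<Longrightarrow> loc_unit M (inverse x)"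
  unfolding loc_unit_def by auto

lemma loc_unit_powi: "loc_unit M (p powi k) \<Longrightarrow> k = 0"
  using powi_mem_loc_iff[of k] powi_mem_loc_iff[of "-k"] unfolding loc_unit_def
  by (simp add: power_int_minus)

text \<open>\<open>x\<close> divides a nonzero element \<open>u * p ^ n\<close> of \<open>V\<close>,
  which bounds the powers of \<open>p\<close> dividing \<open>x\<close> in the localization. The
  quotient by the largest such power is a unit by \<open>uniformizer\<close>.\<close>

lemma exists_val_S:
  assumes "x \<in> S" "x \<noteq> 0"
  shows "\<exists>k u. loc_unit M u \<and> x = u * p powi k"
proof -
  obtain y where y: "y \<in> S" "x * y \<in> V" "x * y \<noteq> 0" using multiple_in_V[OF assms] by blast
  obtain u n where u: "u \<in> V" "inverse u \<in> V" "x * y = u * p ^ n"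
    using factorization[OF y(2,3)] by blast
  have "u \<noteq> 0" using u y by auto
  have bound: "j \<le> n" if "x / p ^ j \<in> loc M" for j
  proof (rule ccontr)
    assume "\<not> j \<le> n"
    then have j: "j = n + Suc (j - n - 1)" by simp
    have "inverse u * y * (x / p ^ j) \<in> loc M"
      using that u y V_subset_S S_subset_loc by (intro O.mult_mem) auto
    moreover have "inverse u * y * (x / p ^ j) = p ^ n / p ^ j" using u \<open>u \<noteq> 0\<close>
      by (simp add: mult.commute[of y x] mult.assoc)
    moreover have "p ^ n / p ^ j = inverse (p ^ Suc (j - n - 1))"
      by (subst j, subst power_add) (simp add: divide_inverse)
    ultimately show False using inverse_p_power_notin_loc by metis
  qed
  define m where "m = (GREATEST j. x / p ^ j \<in> loc M)"
  have "x / p ^ 0 \<in> loc M" using assms S_subset_loc by simp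
  then have m: "x / p ^ m \<in> loc M"
    unfolding m_def by (rule GreatestI_nat[where b = n]) (use bound in auto)
  have "x / p ^ Suc m \<notin> loc M"
  proof
    assume "x / p ^ Suc m \<in> loc M"
    then have "Suc m \<le> m" unfolding m_def by (rule Greatest_le_nat[where b = n]) (use bound in auto)
    then show False by simp
  qed
  then have "inverse (x / p ^ m) \<in> loc M"
    using uniformizer[OF m] assms by (auto simp: field_simps)
  then have "loc_unit M (x / p ^ m)" using m assms by (simp add: loc_unit_def)
  moreover have "x = (x / p ^ m) * p powi int m" by simp
  ultimately show ?thesis by blast
qed

lemma exists_val:
  assumes "x \<noteq> 0"
  shows "\<exists>k u. loc_unit M u \<and> x = u * p powi k"
proof -
  obtain v where v: "v \<in> V" "v \<noteq> 0" "v * x \<in> S" using multiple_in_S by blast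
  obtain k u where ku: "loc_unit M u" "v * x = u * p powi k"
    using exists_val_S[OF v(3)] v(2) assms by auto
  obtain l w where lw: "loc_unit M w" "v = w * p powi l"
    using exists_val_S[OF V_subset_S[OF v(1)] v(2)] by auto
  have "x = (u * p powi k) / (w * p powi l)"
    using ku(2) lw(2) v(2) by (metis nonzero_mult_div_cancel_left)
  also have "\<dots> = (u * inverse w) * p powi (k - l)"
    by (simp add: power_int_diff divide_inverse)
  finally show ?thesis using loc_unit_mult[OF ku(1) loc_unit_inverse[OF lw(1)]] by blast
qed

lemma val_eqI:
  assumes "loc_unit M u" "x = u * p powi k"
  shows "val M x = k"
  unfolding val_def
proof (rule the_equality)
  have "x * p powi - k = u" using assms(2) by (simp add: power_int_minus)
  then show "loc_unit M (x * p powi - k)" using assms(1) by simp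
  fix l assume "loc_unit M (x * p powi - l)"
  then have "loc_unit M (inverse u * (x * p powi - l))"
    using assms(1) loc_unit_inverse loc_unit_mult by blast
  moreover have "inverse u * (x * p powi - l) = p powi (k - l)"
    using assms by (simp add: loc_unit_def power_int_diff power_int_minus divide_inverse)
  ultimately show "l = k" using loc_unit_powi[of "k - l"] by simp
qed

lemma val_decomp:
  assumes "x \<noteq> 0"
  obtains u where "loc_unit M u" "x = u * p powi val M x"
proof -
  obtain k u where ku: "loc_unit M u" "x = u * p powi k" using exists_val[OF assms] by blast
  have "val M x = k" by (rule val_eqI[OF ku])
  then show ?thesis using that[of u] ku by simp
qed

lemma val_mult: "x \<noteq> 0 \<Longrightarrow> y \<noteq> 0 \<Longrightarrow> val M (x * y) = val M x + val M y"
proof -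
  assume xy: "x \<noteq> 0" "y \<noteq> 0"
  obtain u where u: "loc_unit M u" "x = u * p powi val M x" by (rule val_decomp[OF xy(1)])
  obtain w where w: "loc_unit M w" "y = w * p powi val M y" by (rule val_decomp[OF xy(2)])
  show ?thesis
  proof (rule val_eqI)
    show "loc_unit M (u * w)" using u w loc_unit_mult by blast
    show "x * y = u * w * p powi (val M x + val M y)"
      by (subst u(2), subst w(2)) (simp add: power_int_add)
  qed
qed

lemma val_powi: "val M (p powi k) = k"
  by (rule val_eqI[of 1]) (auto simp: loc_unit_def)

lemma val_p [simp]: "val M p = 1"
  using val_powi[of 1] by simp

lemma val_one [simp]: "val M 1 = 0"
  using val_powi[of 0] by simp

lemma val_inverse: "x \<noteq> 0 \<Longrightarrow> val M (inverse x) = - val M x"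
  using val_mult[of x "inverse x"] by simp

lemma mem_loc_iff: "x \<in> loc M \<longleftrightarrow> val_ge M 0 x"
proof (cases "x = 0")
  case False
  then obtain u where u: "loc_unit M u" "x = u * p powi val M x" by (rule val_decomp)
  have "x \<in> loc M \<longleftrightarrow> p powi val M x \<in> loc M"
  proof
    assume "x \<in> loc M"
    then have "inverse u * x \<in> loc M" using u(1) by (intro O.mult_mem) (auto simp: loc_unit_def)
    moreover have "inverse u * x = p powi val M x"
      by (subst u(2)) (use u(1) in \<open>simp add: loc_unit_def mult.assoc[symmetric]\<close>)
    ultimately show "p powi val M x \<in> loc M" by simp
  next
    assume "p powi val M x \<in> loc M"
    then have "u * p powi val M x \<in> loc M" using u(1) by (intro O.mult_mem) (auto simp: loc_unit_def)
    then show "x \<in> loc M" using u(2) by simp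
  qed
  then show ?thesis using False by (simp add: powi_mem_loc_iff val_ge_def)
qed (simp add: val_ge_def)

text \<open>Multiplying by a power of \<open>p\<close> moves the bound to 0. The ultrametric
  inequality thereby becomes closure of the localization under addition.\<close>

lemma val_ge_iff_loc: "val_ge M k x \<longleftrightarrow> x * p powi (- k) \<in> loc M"
proof (cases "x = 0")
  case False
  then have "val M (x * p powi (- k)) = val M x - k"
    using val_mult[of x "p powi (- k)"] val_powi[of "- k"] by simp
  then show ?thesis unfolding mem_loc_iff using False by (simp add: val_ge_def)
qed (simp add: mem_loc_iff val_ge_def)

lemma val_ge_zero [simp]: "val_ge M k 0"
  by (simp add: val_ge_def)

lemma val_ge_add: "val_ge M k x \<Longrightarrow> val_ge M k y \<Longrightarrow> val_ge M k (x + y)"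
  unfolding val_ge_iff_loc by (simp add: distrib_right O.add_mem)

lemma val_ge_uminus: "val_ge M k x \<Longrightarrow> val_ge M k (- x)"
  unfolding val_ge_iff_loc using O.uminus_mem by fastforce

lemma val_ge_diff: "val_ge M k x \<Longrightarrow> val_ge M k y \<Longrightarrow> val_ge M k (x - y)"
  using val_ge_add[of k x "- y"] val_ge_uminus by simp

lemma val_ge_sum: "(\<And>i. i \<in> A \<Longrightarrow> val_ge M k (h i)) \<Longrightarrow> val_ge M k (sum h A)"
  by (induction A rule: infinite_finite_induct) (auto intro: val_ge_add)

lemma val_ge_mult: "val_ge M k x \<Longrightarrow> val_ge M l y \<Longrightarrow> val_ge M (k + l) (x * y)"
  by (cases "x = 0 \<or> y = 0") (auto simp: val_ge_def val_mult)

lemma val_ge_mono: "val_ge M k x \<Longrightarrow> l \<le> k \<Longrightarrow> val_ge M l x"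
  by (auto simp: val_ge_def)

lemma val_ge_S: "x \<in> S \<Longrightarrow> val_ge M 0 x"
  using S_subset_loc mem_loc_iff by blast

lemma val_S_nonneg: "x \<in> S \<Longrightarrow> x \<noteq> 0 \<Longrightarrow> 0 \<le> val M x"
  using val_ge_S by (auto simp: val_ge_def)

lemma max_ideal_iff_val_ge: "x \<in> S \<Longrightarrow> x \<in> M \<longleftrightarrow> val_ge M 1 x"
proof (cases "x = 0")
  case False
  assume x: "x \<in> S"
  have "0 \<le> val M x" using val_S_nonneg x False by blast
  moreover have "x \<in> M \<longleftrightarrow> inverse x \<notin> loc M"
    using inverse_mem_loc[OF x] inverse_notin_loc[OF _ False] by blast
  moreover have "inverse x \<notin> loc M \<longleftrightarrow> 0 < val M x"
    using False by (auto simp: mem_loc_iff val_ge_def val_inverse)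
  ultimately show ?thesis using False by (auto simp: val_ge_def)
qed (use max_ideal_zero[OF M] in simp)

lemma max_ideal_iff_val: "x \<in> S \<Longrightarrow> x \<noteq> 0 \<Longrightarrow> x \<in> M \<longleftrightarrow> 0 < val M x"
  using max_ideal_iff_val_ge by (auto simp: val_ge_def)

text \<open>Membership in \<open>M\<^sup>2\<close>: cancel \<open>s\<close> with an inverse modulo \<open>M\<close>.\<close>

lemma val_ge_2_product:
  assumes "x \<in> S" "val_ge M 2 x"
  obtains a b c d where "a \<in> M" "b \<in> M" "c \<in> M" "d \<in> M" "x = a * b + c * d"
proof -
  have "x * p powi (-2) \<in> loc M" using assms(2) val_ge_iff_loc[of 2 x] by simp
  then obtain s where s: "s \<in> S" "s \<notin> M" "s * (x * p powi (-2)) \<in> S" by (auto simp: loc_def)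
  obtain r where r: "r \<in> S" "1 - s * r \<in> M" using max_ideal_inverse[OF M] s by blast
  have xM: "x \<in> M" using assms max_ideal_iff_val_ge val_ge_mono[of 2 x 1] by simp
  have pM: "p \<in> M" using p_in_max_ideal[OF M] .
  define y where "y = s * (x * p powi (-2)) * r"
  have y: "y \<in> S" using s r S.mult_mem by (simp add: y_def)
  have "p * (p * y) = s * r * x" by (simp add: y_def power_int_minus power2_eq_square field_simps)
  then have "x = p * (p * y) + x * (1 - s * r)" by (simp add: algebra_simps)
  moreover have "p * y \<in> M" using y pM max_ideal_mult_right[OF M] by blast
  ultimately show ?thesis using that[of p "p * y" x "1 - s * r"] pM xM r by blast
qed

end

section \<open>Valuations at conjugate ideals; the integral closure as an intersection of
  localizations\<close>

lemma loc_hom: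
  assumes "\<sigma> \<in> \<G>"
  shows "\<sigma> x \<in> loc (\<sigma> ` M) \<longleftrightarrow> x \<in> loc M"
proof
  assume "x \<in> loc M"
  then obtain s where s: "s \<in> S" "s \<notin> M" "s * x \<in> S" by (auto simp: loc_def)
  then have "\<sigma> s \<in> S - \<sigma> ` M" using assms bij[OF assms] by (auto simp: bij_is_inj inj_image_mem_iff)
  moreover have "\<sigma> s * \<sigma> x \<in> S" using s assms by (simp add: hom_mult[symmetric])
  ultimately show "\<sigma> x \<in> loc (\<sigma> ` M)" unfolding loc_def by blast
next
  assume "\<sigma> x \<in> loc (\<sigma> ` M)"
  then obtain s where s: "s \<in> S" "s \<notin> \<sigma> ` M" "s * \<sigma> x \<in> S" by (auto simp: loc_def)
  define t where "t = finv \<sigma> s"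
  have "s = \<sigma> t" using assms by (simp add: t_def)
  then have "t \<in> S - M" "t * x \<in> S" using s assms by (auto simp: hom_mult[symmetric])
  then show "x \<in> loc M" unfolding loc_def by blast
qed

lemma loc_unit_hom:
  assumes "\<sigma> \<in> \<G>"
  shows "loc_unit (\<sigma> ` M) (\<sigma> x) \<longleftrightarrow> loc_unit M x"
  using assms loc_hom[OF assms, of x M] loc_hom[OF assms, of "inverse x" M]
  by (simp add: loc_unit_def hom_inverse)

lemma val_hom:
  assumes "\<sigma> \<in> \<G>"
  shows "val (\<sigma> ` M) (\<sigma> x) = val M x"
proof -
  have "\<sigma> x * p powi k = \<sigma> (x * p powi k)" for k
    using assms by (simp add: hom_mult hom_power_int)
  then show ?thesis using loc_unit_hom[OF assms, of M] by (simp add: val_def)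
qed

text \<open>The denominators of \<open>x\<close> form an ideal of \<open>S\<close>. If
  \<open>x\<close> lies in every localization, no maximal ideal contains it, so it contains
  1.\<close>

lemma mem_S_iff: "x \<in> S \<longleftrightarrow> (\<forall>M. max_ideal M \<longrightarrow> val_ge M 0 x)"
proof (intro iffI allI impI)
  assume all: "\<forall>M. max_ideal M \<longrightarrow> val_ge M 0 x"
  define I where "I = {s \<in> S. s * x \<in> S}"
  have "1 \<in> I"
  proof (rule ccontr)
    assume "1 \<notin> I"
    obtain M where M: "max_ideal M" "I \<subseteq> M"
    proof (rule exists_max_ideal[of I])
      show "I \<subseteq> S" "0 \<in> I" by (auto simp: I_def)
      show "a + b \<in> I" if "a \<in> I" "b \<in> I" for a b
        using that by (auto simp: I_def distrib_right intro: S.add_mem)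
      show "s * a \<in> I" if "s \<in> S" "a \<in> I" for s a
        using that by (auto simp: I_def mult.assoc intro: S.mult_mem)
    qed (use \<open>1 \<notin> I\<close> in auto)
    then have "x \<in> loc M" using all mem_loc_iff by blast
    then show False using M by (auto simp: loc_def I_def)
  qed
  then show "x \<in> S" by (simp add: I_def)
qed (rule val_ge_S)

end

section \<open>Trivial inertia and separability\<close>

context unramified_setting
begin

section \<open>Conjugacy of the maximal ideals\<close>

lemma max_ideal_maximal:
  assumes "max_ideal M" "max_ideal N" "M \<noteq> N"
  shows "\<exists>s\<in>N. s \<notin> M"
proof (rule ccontr)
  assume "\<not> (\<exists>s\<in>N. s \<notin> M)"
  then have sub: "N \<subseteq> M" by blast
  then obtain s where s: "s \<in> M" "s \<notin> N" using assms(3) by blast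
  then obtain t where t: "t \<in> S" "1 - s * t \<in> N"
    using max_ideal_inverse[OF assms(2)] max_ideal_subset[OF assms(1)] by blast
  have "s * t \<in> M" using s t max_ideal_mult_right[OF assms(1)] by blast
  then have "(1 - s * t) + s * t \<in> M" using t sub max_ideal_add[OF assms(1)] by blast
  then show False using max_ideal_one[OF assms(1)] by simp
qed

text \<open>Chinese remaindering, one ideal at a time: each \<open>P\<close> contributes a factor
  \<open>1 - s * t\<close> that lies in \<open>P\<close> and is congruent to 1 modulo
  \<open>N\<close>.\<close>

lemma max_ideal_separate:
  assumes "finite A" "\<And>P. P \<in> A \<Longrightarrow> max_ideal P" "max_ideal N" "N \<notin> A"
  shows "\<exists>y\<in>S. 1 - y \<in> N \<and> (\<forall>P\<in>A. y \<in> P)"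
  using assms(1,2,4)
proof (induction A rule: finite_induct)
  case empty
  then show ?case using max_ideal_zero[OF assms(3)] by (intro bexI[of _ 1]) auto
next
  case (insert P A)
  then obtain y where y: "y \<in> S" "1 - y \<in> N" "\<forall>P\<in>A. y \<in> P" by auto
  have P: "max_ideal P" "P \<noteq> N" using insert.prems by auto
  then obtain s where s: "s \<in> N" "s \<notin> P" using max_ideal_maximal[OF P(1) assms(3)] by blast
  then have sS: "s \<in> S" using max_ideal_subset[OF assms(3)] by blast
  obtain t where t: "t \<in> S" "1 - s * t \<in> P" using max_ideal_inverse[OF P(1) sS s(2)] by blast
  have st: "s * t \<in> N" using s t max_ideal_mult_right[OF assms(3)] by blast
  have st': "1 - s * t \<in> S" using max_ideal_subset[OF P(1)] t by blast
  have "(1 - y) + y * (s * t) \<in> N"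
    by (rule max_ideal_add[OF assms(3) y(2) max_ideal_mult[OF assms(3) y(1) st]])
  moreover have "(1 - y) + y * (s * t) = 1 - y * (1 - s * t)" by (simp add: algebra_simps)
  ultimately have "1 - y * (1 - s * t) \<in> N" by simp
  moreover have "y * (1 - s * t) \<in> P" using y t max_ideal_mult[OF P(1)] by blast
  moreover have "y * (1 - s * t) \<in> Q" if "Q \<in> A" for Q
    using y st' that insert.prems max_ideal_mult_right[of Q] by blast
  moreover have "y * (1 - s * t) \<in> S" using y st' S.mult_mem by blast
  ultimately show ?case by blast
qed

text \<open>Units of \<open>V\<close> lie in no maximal ideal, so \<open>x \<in> N\<close> forces a
  factor \<open>p\<close>, and \<open>p\<close> lies in every maximal ideal.\<close>

lemma V_inter_max_ideal:
  assumes "max_ideal M" "max_ideal N" "x \<in> V" "x \<in> N"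
  shows "x \<in> M"
proof (cases "x = 0")
  case False
  then obtain u n where u: "u \<in> V" "inverse u \<in> V" "x = u * p ^ n"
    using factorization assms(3) by blast
  have "n \<noteq> 0"
  proof
    assume "n = 0"
    then have "x * inverse u \<in> N" using u assms(2,4) V_subset_S max_ideal_mult_right by blast
    moreover have "x * inverse u = 1" using \<open>n = 0\<close> u False by simp
    ultimately show False using max_ideal_one[OF assms(2)] by simp
  qed
  then have "x = (u * p ^ (n - 1)) * p" using u(3) by (cases n) auto
  moreover have "u * p ^ (n - 1) \<in> S" using u p_mem by (intro V_subset_S mult_mem power_mem)
  ultimately show ?thesis using p_in_max_ideal[OF assms(1)] max_ideal_mult[OF assms(1)] by metis
qed (use max_ideal_zero[OF assms(1)] in simp)

text \<open>Otherwise some \<open>x \<in> N\<close> would avoid all conjugates of \<open>M\<close>, although its norm lies in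
  \<open>N \<inter> V = M \<inter> V\<close>.\<close>

lemma max_ideal_transitive:
  assumes M: "max_ideal M" and N: "max_ideal N"
  shows "\<exists>\<sigma>\<in>\<G>. \<sigma> ` M = N"
proof (rule ccontr)
  assume neg: "\<not> (\<exists>\<sigma>\<in>\<G>. \<sigma> ` M = N)"
  have A: "max_ideal P" if "P \<in> (\<lambda>\<sigma>. \<sigma> ` M) ` \<G>" for P
    using that max_ideal_hom M by auto
  obtain y where y: "y \<in> S" "1 - y \<in> N" "\<forall>P\<in>(\<lambda>\<sigma>. \<sigma> ` M) ` \<G>. y \<in> P"
    using max_ideal_separate[of "(\<lambda>\<sigma>. \<sigma> ` M) ` \<G>" N] A N neg by auto
  define x where "x = 1 - y"
  have xS: "x \<in> S" using y by (simp add: x_def S.diff_mem)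
  have "\<sigma> x \<notin> M" if s: "\<sigma> \<in> \<G>" for \<sigma>
  proof
    assume "\<sigma> x \<in> M"
    have i: "finv \<sigma> \<in> \<G>" using inv_mem s by blast
    have "finv \<sigma> (\<sigma> x) \<in> finv \<sigma> ` M" using \<open>\<sigma> x \<in> M\<close> by (rule imageI)
    then have "x \<in> finv \<sigma> ` M" using s by simp
    moreover have "y \<in> finv \<sigma> ` M" using y(3) i by blast
    moreover have mi: "max_ideal (finv \<sigma> ` M)" using max_ideal_hom[OF i M] .
    ultimately have "x + y \<in> finv \<sigma> ` M" using max_ideal_add by blast
    then show False using max_ideal_one[OF mi] by (simp add: x_def)
  qed
  then have "(\<Prod>\<sigma>\<in>\<G>. \<sigma> x) \<notin> M"
    using xS by (intro max_ideal_prod_notin[OF M]) auto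
  moreover have "(\<Prod>\<sigma>\<in>\<G>. \<sigma> x) \<in> N"
    by (rule max_ideal_prod_in[OF N, where i = id]) (use xS y in \<open>auto simp: x_def\<close>)
  ultimately show False using V_inter_max_ideal[OF M N] norm_mem_V[OF xS] by blast
qed

lemma finite_max_ideals: "finite {M. max_ideal M}"
proof (cases "\<exists>M. max_ideal M")
  case True
  then obtain M where "max_ideal M" by blast
  then have "{M. max_ideal M} \<subseteq> (\<lambda>\<sigma>. \<sigma> ` M) ` \<G>" using max_ideal_transitive by blast
  then show ?thesis by (rule finite_subset) simp
qed simp

text \<open>\<open>1 / p\<close> has a simple pole at every maximal ideal. An element congruent to 1
  modulo \<open>M\<close> and contained in all the others cancels every pole but the one at
  \<open>M\<close>, so that maximality can be tested at \<open>M\<close> alone.\<close>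

lemma exists_simple_pole:
  assumes M: "max_ideal M"
  obtains c where "c \<noteq> 0" "val M c = - 1" "\<And>N. max_ideal N \<Longrightarrow> N \<noteq> M \<Longrightarrow> 0 \<le> val N c"
proof -
  have "\<exists>y\<in>S. 1 - y \<in> M \<and> (\<forall>P\<in>{M. max_ideal M} - {M}. y \<in> P)"
    by (rule max_ideal_separate) (use finite_max_ideals M in simp_all)
  then obtain y where y: "y \<in> S" "1 - y \<in> M" "\<forall>P\<in>{M. max_ideal M} - {M}. y \<in> P" by blast
  have yM: "y \<notin> M"
    using max_ideal_add[OF M y(2), of y] max_ideal_one[OF M] by auto
  then have y0: "y \<noteq> 0" using max_ideal_zero[OF M] by auto
  have v: "val N (y / p) = val N y - 1" if N: "max_ideal N" for N
    using val_mult[OF N y0, of "inverse p"] val_inverse[OF N, of p] val_p[OF N] by (simp add: divide_inverse)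
  show ?thesis
  proof (rule that[of "y / p"])
    have "val M y = 0"
      using max_ideal_iff_val[OF M y(1) y0] val_S_nonneg[OF M y(1) y0] yM by simp
    then show "val M (y / p) = - 1" using v[OF M] by simp
    fix N assume N: "max_ideal N" "N \<noteq> M"
    then have "y \<in> N" using y by blast
    then show "0 \<le> val N (y / p)" using v[OF N(1)] max_ideal_iff_val[OF N(1) y(1) y0] by simp
  qed (use y0 in simp)
qed

text \<open>If \<open>\<sigma> \<noteq> id\<close> acted trivially on \<open>S/M\<close>, let \<open>n \<ge> 1\<close> be the least valuation of \<open>\<sigma> x - x\<close>.  Modulo
  \<open>M\<^sup>n\<^sup>+\<^sup>1\<close> the map \<open>x \<mapsto> \<sigma> x - x\<close> is a derivation vanishing on \<open>V\<close>; it kills \<open>M\<close> because \<open>p\<close> generates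
  \<open>M\<close> locally, and it kills everything because \<open>S/M\<close> is separable.\<close>

lemma inertia_trivial:
  assumes M: "max_ideal M" and s: "\<sigma> \<in> \<G>" and inert: "\<And>x. x \<in> S \<Longrightarrow> \<sigma> x - x \<in> M"
  shows "\<sigma> = id"
proof (rule ccontr)
  assume "\<sigma> \<noteq> id"
  then obtain x0 where x0: "\<sigma> x0 \<noteq> x0" by (metis eq_id_iff)
  define Q where "Q n \<longleftrightarrow> (\<exists>x\<in>S. \<sigma> x - x \<noteq> 0 \<and> val M (\<sigma> x - x) = int n)" for n
  have valQ: "\<exists>n. val M (\<sigma> x - x) = int n \<and> Q n" if "x \<in> S" "\<sigma> x - x \<noteq> 0" for x
  proof -
    have "0 \<le> val M (\<sigma> x - x)"
      using val_S_nonneg[OF M _ that(2)] max_ideal_subset[OF M inert[OF that(1)]] by blast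
    then have "val M (\<sigma> x - x) = int (nat (val M (\<sigma> x - x)))" by simp
    then show ?thesis unfolding Q_def using that by blast
  qed
  obtain v where v: "v \<in> V" "v \<noteq> 0" "v * x0 \<in> S" using multiple_in_S by blast
  have "\<sigma> (v * x0) - v * x0 = v * (\<sigma> x0 - x0)"
    using s v by (simp add: hom_mult hom_fixed_V algebra_simps)
  then have "\<sigma> (v * x0) - v * x0 \<noteq> 0" using v x0 by simp
  then have "\<exists>n. Q n" using valQ[OF v(3)] by blast
  then have "Q (LEAST n. Q n)" by (rule LeastI_ex)
  then obtain x n where x: "x \<in> S" "\<sigma> x - x \<noteq> 0" "val M (\<sigma> x - x) = int n" and n: "n = (LEAST n. Q n)"
    unfolding Q_def by blast
  have ge_n: "val_ge M (int n) (\<sigma> y - y)" if "y \<in> S" for y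
  proof (cases "\<sigma> y - y = 0")
    case False
    then obtain m where "val M (\<sigma> y - y) = int m" "Q m" using valQ \<open>y \<in> S\<close> by blast
    then show ?thesis using Least_le[of Q m] by (simp add: n val_ge_def)
  qed (use M in simp)
  have n1: "1 \<le> n"
    using max_ideal_iff_val[OF M _ x(2)] inert[OF x(1)] max_ideal_subset[OF M] x(3) by auto
  have ge_Suc: "val_ge M (int n + 1) (\<sigma> m - m)" if m: "m \<in> M" for m
  proof -
    have mS: "m \<in> S" using max_ideal_subset[OF M m] .
    have "val_ge M 1 m" using max_ideal_iff_val_ge[OF M mS] m by simp
    then have "m * p powi (- 1) \<in> loc M" using val_ge_iff_loc[OF M] by simp
    then obtain r where r: "r \<in> S" "r \<notin> M" "r * (m * p powi (- 1)) \<in> S" by (auto simp: loc_def)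
    define t where "t = r * (m * p powi (- 1))"
    have rm: "r * m = p * t" by (simp add: t_def power_int_minus field_simps)
    have srS: "\<sigma> r \<in> S" using r s by simp
    have "\<sigma> r \<notin> M"
    proof
      assume "\<sigma> r \<in> M"
      then have "\<sigma> r - (\<sigma> r - r) \<in> M" using inert[OF r(1)] max_ideal_diff[OF M] by blast
      then show False using r by simp
    qed
    then have sr0: "\<sigma> r \<noteq> 0" and "val M (\<sigma> r) = 0"
      using max_ideal_zero[OF M] max_ideal_iff_val[OF M srS] val_S_nonneg[OF M srS] by force+
    then have inv: "val_ge M 0 (inverse (\<sigma> r))" using val_inverse[OF M sr0] by (simp add: val_ge_def)
    have "\<sigma> r * \<sigma> m = p * \<sigma> t" using arg_cong[OF rm, of \<sigma>] s by (simp add: hom_mult)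
    \<comment> \<open>A twisted product rule for \<open>r * m = p * t\<close>: the first term gains
      valuation from the fixed element \<open>p\<close>, the second from \<open>m \<in> M\<close>,
      while \<open>\<sigma> r\<close> is a unit at \<open>M\<close>.\<close>
    then have eq: "\<sigma> r * (\<sigma> m - m) = p * (\<sigma> t - t) - (\<sigma> r - r) * m"
      using rm by (simp add: algebra_simps)
    have "val_ge M (1 + int n) (p * (\<sigma> t - t))"
      using ge_n[of t] r by (intro val_ge_mult[OF M]) (auto simp: t_def val_ge_def val_p[OF M])
    moreover have "val_ge M (int n + 1) ((\<sigma> r - r) * m)"
      using ge_n r \<open>val_ge M 1 m\<close> by (intro val_ge_mult[OF M]) auto
    ultimately have "val_ge M (int n + 1) (\<sigma> r * (\<sigma> m - m))"
      unfolding eq by (intro val_ge_diff[OF M]) (auto simp: add.commute)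
    then have "val_ge M (0 + (int n + 1)) (inverse (\<sigma> r) * (\<sigma> r * (\<sigma> m - m)))"
      by (rule val_ge_mult[OF M inv])
    then show ?thesis using sr0 by (simp add: mult.assoc[symmetric])
  qed
  define h where "h = \<sigma> x - x"
  obtain P where P: "\<And>i. poly.coeff P i \<in> V" "poly P x \<in> M" "poly (pderiv P) x \<notin> M"
    using separable_lift[OF M x(1)] by blast
  have hS: "h \<in> S" using max_ideal_subset[OF M] inert[OF x(1)] by (simp add: h_def)
  obtain c where c: "c \<in> S" "poly P (x + h) = poly P x + poly (pderiv P) x * h + h ^ 2 * c"
    using S.poly_taylor[of P x h] P(1) V_subset_S x(1) hS by blast
  have "\<sigma> (poly P x) = poly P (x + h)"
    using hom_poly[OF s, of P x] P(1) V_subset_fractions by (simp add: h_def)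
  then have eq: "poly (pderiv P) x * h = (\<sigma> (poly P x) - poly P x) - h ^ 2 * c"
    using c(2) by simp
  have "val_ge M (int n) h" using ge_n[OF x(1)] by (simp add: h_def)
  then have "val_ge M (int n + int n + 0) (h * h * c)"
    using val_ge_S[OF M c(1)] by (intro val_ge_mult[OF M])
  \<comment> \<open>Here \<open>1 \<le> n\<close> enters: \<open>2 * n \<ge> n + 1\<close> makes the
    quadratic term negligible.\<close>
  then have "val_ge M (int n + 1) (h ^ 2 * c)"
    unfolding power2_eq_square using n1 by (elim val_ge_mono[OF M]) simp
  then have ge: "val_ge M (int n + 1) (poly (pderiv P) x * h)"
    unfolding eq by (intro val_ge_diff[OF M] ge_Suc P)
  have "poly.coeff (pderiv P) i \<in> S" for i
    unfolding coeff_pderiv using P(1) V_subset_S by (intro S.mult_mem S.of_nat_mem) auto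
  then have dS: "poly (pderiv P) x \<in> S"
    using x(1) by (rule S.poly_mem)
  have d0: "poly (pderiv P) x \<noteq> 0" using P(3) max_ideal_zero[OF M] by auto
  have "val M (poly (pderiv P) x) = 0"
    using max_ideal_iff_val[OF M dS d0] val_S_nonneg[OF M dS d0] P(3) by simp
  then have "val M (poly (pderiv P) x * h) = int n"
    using val_mult[OF M d0, of h] x by (simp add: h_def)
  then show False using ge d0 x(2) by (simp add: val_ge_def h_def)
qed

text \<open>The image of \<open>S \<otimes> S\<close> in the functions on \<open>\<G>\<close>.  That it contains the indicator functions is the
  statement that \<open>S/V\<close> is a Galois extension of rings.\<close>

inductive_set tensor_fun :: "(('k \<Rightarrow> 'k) \<Rightarrow> 'k) set" where
  zero: "(\<lambda>_. 0) \<in> tensor_fun"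
| step: "g \<in> tensor_fun \<Longrightarrow> x \<in> S \<Longrightarrow> y \<in> S \<Longrightarrow> (\<lambda>\<sigma>. g \<sigma> + x * \<sigma> y) \<in> tensor_fun"
| agree: "g \<in> tensor_fun \<Longrightarrow> (\<And>\<sigma>. \<sigma> \<in> \<G> \<Longrightarrow> g' \<sigma> = g \<sigma>) \<Longrightarrow> g' \<in> tensor_fun"

lemma tensor_fun_add: "h \<in> tensor_fun \<Longrightarrow> g \<in> tensor_fun \<Longrightarrow> (\<lambda>\<sigma>. g \<sigma> + h \<sigma>) \<in> tensor_fun"
proof (induction rule: tensor_fun.induct)
  case (step h x y)
  then have "(\<lambda>\<sigma>. (g \<sigma> + h \<sigma>) + x * \<sigma> y) \<in> tensor_fun" by (intro tensor_fun.step)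
  then show ?case by (simp add: add.assoc)
next
  case (agree h h')
  then have "(\<lambda>\<sigma>. g \<sigma> + h \<sigma>) \<in> tensor_fun" by blast
  then show ?case by (rule tensor_fun.agree) (use agree in auto)
qed simp

lemma tensor_fun_single: "x \<in> S \<Longrightarrow> y \<in> S \<Longrightarrow> (\<lambda>\<sigma>. x * \<sigma> y) \<in> tensor_fun"
  using tensor_fun.step[OF tensor_fun.zero] by simp

lemma tensor_fun_mult_single:
  "g \<in> tensor_fun \<Longrightarrow> x \<in> S \<Longrightarrow> y \<in> S \<Longrightarrow> (\<lambda>\<sigma>. g \<sigma> * (x * \<sigma> y)) \<in> tensor_fun"
proof (induction rule: tensor_fun.induct)
  case zero
  then show ?case using tensor_fun.zero by simp
next
  case (step g a b)
  then have "(\<lambda>\<sigma>. g \<sigma> * (x * \<sigma> y) + (a * x) * \<sigma> (b * y)) \<in> tensor_fun"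
    by (intro tensor_fun.step S.mult_mem)
  then show ?case by (rule tensor_fun.agree) (simp add: hom_mult algebra_simps)
next
  case (agree g g')
  then have "(\<lambda>\<sigma>. g \<sigma> * (x * \<sigma> y)) \<in> tensor_fun" by blast
  then show ?case by (rule tensor_fun.agree) (use agree in auto)
qed

lemma tensor_fun_mult: "h \<in> tensor_fun \<Longrightarrow> g \<in> tensor_fun \<Longrightarrow> (\<lambda>\<sigma>. g \<sigma> * h \<sigma>) \<in> tensor_fun"
proof (induction rule: tensor_fun.induct)
  case zero
  then show ?case using tensor_fun.zero by simp
next
  case (step h x y)
  then have "(\<lambda>\<sigma>. g \<sigma> * h \<sigma> + g \<sigma> * (x * \<sigma> y)) \<in> tensor_fun"
    by (intro tensor_fun_add tensor_fun_mult_single) auto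
  then show ?case by (simp add: distrib_left)
next
  case (agree h h')
  then have "(\<lambda>\<sigma>. g \<sigma> * h \<sigma>) \<in> tensor_fun" by blast
  then show ?case by (rule tensor_fun.agree) (use agree in auto)
qed

lemma tensor_fun_prod:
  "finite A \<Longrightarrow> (\<And>i. i \<in> A \<Longrightarrow> h i \<in> tensor_fun) \<Longrightarrow> (\<lambda>\<sigma>. \<Prod>i\<in>A. h i \<sigma>) \<in> tensor_fun"
proof (induction A rule: finite_induct)
  case empty
  show ?case by (rule tensor_fun.agree[OF tensor_fun_single[of 1 1]]) auto
next
  case (insert i A)
  then show ?case using tensor_fun_mult[of "\<lambda>\<sigma>. \<Prod>i\<in>A. h i \<sigma>" "h i"] by simp
qed

lemma tensor_fun_diff: "b \<in> S \<Longrightarrow> c \<in> S \<Longrightarrow> (\<lambda>\<sigma>. \<sigma> b - c) \<in> tensor_fun"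
  by (rule tensor_fun.agree[OF tensor_fun_add[OF tensor_fun_single[of "- c" 1] tensor_fun_single[of 1 b]]])
    (auto intro: S.uminus_mem)

text \<open>The \<open>s\<close> for which \<open>s\<close> times the indicator lies in
  \<open>tensor_fun\<close> form an ideal. Were it inside some \<open>M\<close>, trivial inertia
  would supply \<open>b \<tau>\<close> with \<open>\<rho> (b \<tau>) - \<tau> (b \<tau>)\<close>
  outside \<open>M\<close>. The product over \<open>\<tau> \<noteq> \<rho>\<close> of the functions
  \<open>\<sigma> (b \<tau>) - \<tau> (b \<tau>)\<close> of \<open>\<sigma>\<close> vanishes away
  from \<open>\<rho>\<close>, and its value at \<open>\<rho>\<close> is outside
  \<open>M\<close>.\<close>

lemma tensor_fun_indicator:
  assumes r: "\<rho> \<in> \<G>"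
  shows "(\<lambda>\<sigma>. if \<sigma> = \<rho> then 1 else 0) \<in> tensor_fun"
proof -
  define I where "I = {s \<in> S. (\<lambda>\<sigma>. if \<sigma> = \<rho> then s else 0) \<in> tensor_fun}"
  have "1 \<in> I"
  proof (rule ccontr)
    assume "1 \<notin> I"
    obtain M where M: "max_ideal M" "I \<subseteq> M"
    proof (rule exists_max_ideal[of I])
      show "I \<subseteq> S" "0 \<in> I" using tensor_fun.zero by (auto simp: I_def)
      show "a + b \<in> I" if "a \<in> I" "b \<in> I" for a b
      proof -
        have "(\<lambda>\<sigma>. (if \<sigma> = \<rho> then a else 0) + (if \<sigma> = \<rho> then b else 0)) \<in> tensor_fun"
          using that by (intro tensor_fun_add) (auto simp: I_def)
        then have "(\<lambda>\<sigma>. if \<sigma> = \<rho> then a + b else 0) \<in> tensor_fun" by (rule tensor_fun.agree) auto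
        then show ?thesis using that by (auto simp: I_def intro: S.add_mem)
      qed
      show "s * a \<in> I" if "s \<in> S" "a \<in> I" for s a
      proof -
        have "(\<lambda>\<sigma>. (if \<sigma> = \<rho> then a else 0) * (s * \<sigma> 1)) \<in> tensor_fun"
          using that by (intro tensor_fun_mult_single) (auto simp: I_def)
        then have "(\<lambda>\<sigma>. if \<sigma> = \<rho> then s * a else 0) \<in> tensor_fun" by (rule tensor_fun.agree) auto
        then show ?thesis using that by (auto simp: I_def intro: S.mult_mem)
      qed
    qed (use \<open>1 \<notin> I\<close> in auto)
    have "\<exists>b\<in>S. \<rho> b - \<tau> b \<notin> M" if t: "\<tau> \<in> \<G> - {\<rho>}" for \<tau>
    proof (rule ccontr)
      assume neg: "\<not> (\<exists>b\<in>S. \<rho> b - \<tau> b \<notin> M)"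
      have ti: "finv \<tau> \<in> \<G>" using t inv_mem by blast
      have "(\<rho> \<circ> finv \<tau>) c - c \<in> M" if "c \<in> S" for c
      proof -
        have "\<rho> (finv \<tau> c) - \<tau> (finv \<tau> c) \<in> M" using neg that ti by simp
        then show ?thesis using t by simp
      qed
      then have "\<rho> \<circ> finv \<tau> = id" using inertia_trivial[OF M(1) comp_mem[OF r ti]] by blast
      then have "\<rho> \<circ> finv \<tau> \<circ> \<tau> = \<tau>" by simp
      then have "\<rho> = \<tau>" using t by (simp add: comp_assoc)
      then show False using t by simp
    qed
    then obtain b where b: "\<And>\<tau>. \<tau> \<in> \<G> - {\<rho>} \<Longrightarrow> b \<tau> \<in> S \<and> \<rho> (b \<tau>) - \<tau> (b \<tau>) \<notin> M" by metis
    define s where "s = (\<Prod>\<tau>\<in>\<G>-{\<rho>}. \<rho> (b \<tau>) - \<tau> (b \<tau>))"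
    have "(\<lambda>\<sigma>. \<Prod>\<tau>\<in>\<G>-{\<rho>}. \<sigma> (b \<tau>) - \<tau> (b \<tau>)) \<in> tensor_fun"
      using b by (intro tensor_fun_prod tensor_fun_diff) auto
    then have "(\<lambda>\<sigma>. if \<sigma> = \<rho> then s else 0) \<in> tensor_fun"
    proof (rule tensor_fun.agree)
      fix \<sigma> assume "\<sigma> \<in> \<G>"
      then have "\<sigma> \<noteq> \<rho> \<Longrightarrow> (\<Prod>\<tau>\<in>\<G>-{\<rho>}. \<sigma> (b \<tau>) - \<tau> (b \<tau>)) = 0"
        by (intro prod_zero) auto
      then show "(if \<sigma> = \<rho> then s else 0) = (\<Prod>\<tau>\<in>\<G>-{\<rho>}. \<sigma> (b \<tau>) - \<tau> (b \<tau>))"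
        by (simp add: s_def)
    qed
    moreover have "s \<in> S" using b r by (auto simp: s_def intro!: S.prod_mem S.diff_mem)
    ultimately have "s \<in> M" using M(2) by (auto simp: I_def)
    moreover have "s \<notin> M"
      unfolding s_def using b r by (intro max_ideal_prod_notin[OF M(1)]) (auto intro!: S.diff_mem)
    ultimately show False by simp
  qed
  then show ?thesis by (simp add: I_def)
qed

lemma lin_subset_S: "B \<subseteq> S \<Longrightarrow> x \<in> lin B \<Longrightarrow> x \<in> S"
  by (rule lin_least) (auto intro: S.add_mem S.mult_mem V_subset_S)

text \<open>A dual basis. If \<open>g \<sigma>\<close> is the sum of the
  \<open>x\<^sub>i * \<sigma> y\<^sub>i\<close>, then the sum of
  \<open>g \<sigma> * \<sigma> s\<close> over the group combines the \<open>x\<^sub>i\<close> with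
  the traces of the \<open>y\<^sub>i * s\<close>, which lie in \<open>V\<close>. For the indicator
  of \<open>id\<close> this sum is \<open>s\<close> itself.\<close>

lemma S_finitely_generated:
  obtains B where "finite B" "B \<subseteq> S" "S = lin B"
proof -
  have gen: "\<exists>B. finite B \<and> B \<subseteq> S \<and> (\<forall>s\<in>S. (\<Sum>\<sigma>\<in>\<G>. g \<sigma> * \<sigma> s) \<in> lin B)" if "g \<in> tensor_fun" for g
    using that
  proof (induction rule: tensor_fun.induct)
    case zero
    show ?case by (rule exI[of _ "{}"]) (auto intro: lin_zero)
  next
    case (step g x y)
    then obtain B where B: "finite B" "B \<subseteq> S" "\<And>s. s \<in> S \<Longrightarrow> (\<Sum>\<sigma>\<in>\<G>. g \<sigma> * \<sigma> s) \<in> lin B" by blast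
    have fin: "finite (insert x B)" using B by simp
    have "(\<Sum>\<sigma>\<in>\<G>. (g \<sigma> + x * \<sigma> y) * \<sigma> s) \<in> lin (insert x B)" if "s \<in> S" for s
    proof -
      have "(\<Sum>\<sigma>\<in>\<G>. (g \<sigma> + x * \<sigma> y) * \<sigma> s) = (\<Sum>\<sigma>\<in>\<G>. g \<sigma> * \<sigma> s) + (\<Sum>\<sigma>\<in>\<G>. \<sigma> (y * s)) * x"
        by (simp add: sum.distrib sum_distrib_left sum_distrib_right hom_mult algebra_simps)
      moreover have "(\<Sum>\<sigma>\<in>\<G>. g \<sigma> * \<sigma> s) \<in> lin (insert x B)"
        using B(3)[OF that] by (rule lin_mono[OF fin, rotated]) auto
      moreover have "(\<Sum>\<sigma>\<in>\<G>. \<sigma> (y * s)) * x \<in> lin (insert x B)"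
        using step that by (intro lin_smult trace_mem_V S.mult_mem lin_base[OF fin]) auto
      ultimately show ?thesis by (simp add: lin_add)
    qed
    then show ?case using fin B step by (intro exI[of _ "insert x B"]) auto
  next
    case (agree g g')
    then show ?case by (metis (no_types, lifting) sum.cong)
  qed
  obtain B where B: "finite B" "B \<subseteq> S"
    "\<And>s. s \<in> S \<Longrightarrow> (\<Sum>\<sigma>\<in>\<G>. (if \<sigma> = id then 1 else 0) * \<sigma> s) \<in> lin B"
    using gen[OF tensor_fun_indicator[OF id_mem]] by blast
  have "(\<Sum>\<sigma>\<in>\<G>. (if \<sigma> = id then 1 else 0) * \<sigma> s) = s" for s
    using sum_indicator[OF finite_G id_mem, of "\<lambda>\<sigma>. \<sigma> s"] by simp
  then have "S = lin B" using B lin_subset_S by fastforce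
  then show ?thesis using that B by blast
qed

end

section \<open>The crossed product algebra\<close>

locale crossed_setting = unramified_setting V p \<G> for V :: "'k::field set" and p \<G> +
  fixes f :: "('k \<Rightarrow> 'k) \<Rightarrow> ('k \<Rightarrow> 'k) \<Rightarrow> 'k"
  assumes f_S: "\<sigma> \<in> \<G> \<Longrightarrow> \<tau> \<in> \<G> \<Longrightarrow> f \<sigma> \<tau> \<in> S"
    and f_nonzero: "\<sigma> \<in> \<G> \<Longrightarrow> \<tau> \<in> \<G> \<Longrightarrow> f \<sigma> \<tau> \<noteq> 0"
    and f_cocycle: "\<sigma> \<in> \<G> \<Longrightarrow> \<tau> \<in> \<G> \<Longrightarrow> \<gamma> \<in> \<G> \<Longrightarrow>
      \<sigma> (f \<tau> \<gamma>) * f \<sigma> (\<tau> \<circ> \<gamma>) = f \<sigma> \<tau> * f (\<sigma> \<circ> \<tau>) \<gamma>"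
    and f_id_left [simp]: "\<sigma> \<in> \<G> \<Longrightarrow> f id \<sigma> = 1"
    and f_id_right [simp]: "\<sigma> \<in> \<G> \<Longrightarrow> f \<sigma> id = 1"
begin

abbreviation G :: "('k \<Rightarrow> 'k) monoid" where
  "G \<equiv> \<lparr>carrier = \<G>, monoid.mult = (\<circ>), one = id\<rparr>"

definition A :: "('k, ('k \<Rightarrow> 'k) \<Rightarrow> 'k) module" where
  "A = crossed_product G f"

text \<open>Solving \<open>\<sigma> \<circ> \<tau> = \<rho>\<close> for \<open>\<tau>\<close> turns
  the sum over pairs in \<open>crossed_product\<close> into a sum over the group.\<close>

definition mul :: "(('k \<Rightarrow> 'k) \<Rightarrow> 'k) \<Rightarrow> (('k \<Rightarrow> 'k) \<Rightarrow> 'k) \<Rightarrow> ('k \<Rightarrow> 'k) \<Rightarrow> 'k" where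
  "mul a b = (\<lambda>\<rho>. if \<rho> \<in> \<G> then
     (\<Sum>\<sigma>\<in>\<G>. a \<sigma> * \<sigma> (b (finv \<sigma> \<circ> \<rho>)) * f \<sigma> (finv \<sigma> \<circ> \<rho>)) else 0)"

text \<open>The homogeneous element \<open>c x\<^sub>\<sigma>\<close>.\<close>

definition single :: "('k \<Rightarrow> 'k) \<Rightarrow> 'k \<Rightarrow> ('k \<Rightarrow> 'k) \<Rightarrow> 'k" where
  "single \<sigma> c = (\<lambda>\<tau>. if \<tau> = \<sigma> then c else 0)"

lemma comp_inv_left [simp]: "\<sigma> \<in> \<G> \<Longrightarrow> \<sigma> \<circ> (finv \<sigma> \<circ> \<tau>) = \<tau>" "\<sigma> \<in> \<G> \<Longrightarrow> finv \<sigma> \<circ> (\<sigma> \<circ> \<tau>) = \<tau>"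
  by (simp_all add: comp_assoc[symmetric])

lemma comp_inv_right [simp]: "\<sigma> \<in> \<G> \<Longrightarrow> (\<tau> \<circ> \<sigma>) \<circ> finv \<sigma> = \<tau>" "\<sigma> \<in> \<G> \<Longrightarrow> (\<tau> \<circ> finv \<sigma>) \<circ> \<sigma> = \<tau>"
  by (simp_all add: comp_assoc)

lemma comp_eq_iff: "\<sigma> \<in> \<G> \<Longrightarrow> \<tau> = finv \<sigma> \<circ> \<rho> \<longleftrightarrow> \<sigma> \<circ> \<tau> = \<rho>"
  by auto

lemma inv_comp: "\<sigma> \<in> \<G> \<Longrightarrow> \<tau> \<in> \<G> \<Longrightarrow> finv (\<sigma> \<circ> \<tau>) = finv \<tau> \<circ> finv \<sigma>"
  using bij o_inv_distrib by blast

lemma carrier_A: "carrier A = {a. \<forall>\<sigma>. \<sigma> \<notin> \<G> \<longrightarrow> a \<sigma> = 0}"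
  and one_A: "\<one>\<^bsub>A\<^esub> = single id 1"
  and zero_A: "\<zero>\<^bsub>A\<^esub> = (\<lambda>_. 0)"
  and add_A: "a \<oplus>\<^bsub>A\<^esub> b = (\<lambda>\<sigma>. a \<sigma> + b \<sigma>)"
  and smult_A: "c \<odot>\<^bsub>A\<^esub> a = (\<lambda>\<sigma>. c * a \<sigma>)"
  by (auto simp: A_def crossed_product_def single_def)

lemma mult_A: "a \<otimes>\<^bsub>A\<^esub> b = mul a b"
proof
  fix \<rho>
  let ?P = "{(\<sigma>, \<tau>). \<sigma> \<in> \<G> \<and> \<tau> \<in> \<G> \<and> \<sigma> \<circ> \<tau> = \<rho>}"
  have lhs: "(a \<otimes>\<^bsub>A\<^esub> b) \<rho> = (\<Sum>(\<sigma>, \<tau>)\<in>?P. a \<sigma> * \<sigma> (b \<tau>) * f \<sigma> \<tau>)"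
    by (simp add: A_def crossed_product_def)
  show "(a \<otimes>\<^bsub>A\<^esub> b) \<rho> = mul a b \<rho>"
  proof (cases "\<rho> \<in> \<G>")
    case True
    have P: "?P = (\<lambda>\<sigma>. (\<sigma>, finv \<sigma> \<circ> \<rho>)) ` \<G>"
      using True by (auto simp: image_iff intro: comp_mem inv_mem)
    have "inj_on (\<lambda>\<sigma>. (\<sigma>, finv \<sigma> \<circ> \<rho>)) \<G>" by (rule inj_onI) simp
    then show ?thesis unfolding lhs P using True by (simp add: sum.reindex mul_def)
  next
    case False
    then have P: "?P = {}" using comp_mem by auto
    show ?thesis unfolding lhs P using False by (simp add: mul_def)
  qed
qed

lemma mul_carrier [simp]: "mul a b \<in> carrier A"
  by (simp add: carrier_A mul_def)

lemma single_carrier [simp]: "\<sigma> \<in> \<G> \<Longrightarrow> single \<sigma> c \<in> carrier A"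
  by (auto simp: carrier_A single_def)

lemma single_same [simp]: "single \<sigma> c \<sigma> = c"
  by (simp add: single_def)

lemma mul_single_left:
  "\<sigma> \<in> \<G> \<Longrightarrow> \<rho> \<in> \<G> \<Longrightarrow> mul (single \<sigma> c) b \<rho> = c * \<sigma> (b (finv \<sigma> \<circ> \<rho>)) * f \<sigma> (finv \<sigma> \<circ> \<rho>)"
proof -
  assume s: "\<sigma> \<in> \<G>" "\<rho> \<in> \<G>"
  have "mul (single \<sigma> c) b \<rho> =
      (\<Sum>\<mu>\<in>\<G>. (if \<mu> = \<sigma> then c else 0) * \<mu> (b (finv \<mu> \<circ> \<rho>)) * f \<mu> (finv \<mu> \<circ> \<rho>))"
    using s(2) by (simp add: mul_def single_def)
  also have "\<dots> = (\<Sum>\<mu>\<in>\<G>. if \<mu> = \<sigma> then c * \<sigma> (b (finv \<sigma> \<circ> \<rho>)) * f \<sigma> (finv \<sigma> \<circ> \<rho>) else 0)"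
    by (rule sum.cong) auto
  finally show ?thesis using s by simp
qed

lemma mul_single_single:
  assumes "\<sigma> \<in> \<G>" "\<tau> \<in> \<G>"
  shows "mul (single \<sigma> c) (single \<tau> d) = single (\<sigma> \<circ> \<tau>) (c * \<sigma> d * f \<sigma> \<tau>)"
proof
  fix \<rho>
  show "mul (single \<sigma> c) (single \<tau> d) \<rho> = single (\<sigma> \<circ> \<tau>) (c * \<sigma> d * f \<sigma> \<tau>) \<rho>"
  proof (cases "\<rho> \<in> \<G>")
    case True
    then show ?thesis using assms
      by (auto simp: mul_single_left) (auto simp: single_def)
  next
    case False
    then show ?thesis using assms comp_mem by (auto simp: mul_def single_def)
  qed
qed

lemma mul_id_left: "b \<in> carrier A \<Longrightarrow> mul (single id c) b = (\<lambda>\<sigma>. c * b \<sigma>)"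
proof
  fix \<rho> assume "b \<in> carrier A"
  then show "mul (single id c) b \<rho> = c * b \<rho>"
    using mul_single_left[of id \<rho> c b] by (cases "\<rho> \<in> \<G>") (auto simp: carrier_A mul_def inv_id)
qed

lemma mul_id_right: "b \<in> carrier A \<Longrightarrow> mul b (single id c) = (\<lambda>\<sigma>. b \<sigma> * \<sigma> c)"
proof
  fix \<rho> assume b: "b \<in> carrier A"
  show "mul b (single id c) \<rho> = b \<rho> * \<rho> c"
  proof (cases "\<rho> \<in> \<G>")
    case True
    have eq: "finv \<sigma> \<circ> \<rho> = id \<longleftrightarrow> \<sigma> = \<rho>" if "\<sigma> \<in> \<G>" for \<sigma>
      using that comp_eq_iff[of \<sigma> id \<rho>] by auto
    have "mul b (single id c) \<rho> =
        (\<Sum>\<sigma>\<in>\<G>. b \<sigma> * \<sigma> (single id c (finv \<sigma> \<circ> \<rho>)) * f \<sigma> (finv \<sigma> \<circ> \<rho>))"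
      using True by (simp add: mul_def)
    also have "\<dots> = (\<Sum>\<sigma>\<in>\<G>. if \<sigma> = \<rho> then b \<rho> * \<rho> c else 0)"
      by (rule sum.cong) (auto simp: single_def eq)
    finally show ?thesis using True by simp
  qed (use b in \<open>auto simp: carrier_A mul_def\<close>)
qed

lemma mul_assoc: "mul (mul a b) c = mul a (mul b c)"
proof
  fix \<rho>
  show "mul (mul a b) c \<rho> = mul a (mul b c) \<rho>"
  proof (cases "\<rho> \<in> \<G>")
    case r: True
    let ?t = "\<lambda>\<sigma> \<mu>. a \<sigma> * \<sigma> (b (finv \<sigma> \<circ> \<mu>)) * f \<sigma> (finv \<sigma> \<circ> \<mu>) * \<mu> (c (finv \<mu> \<circ> \<rho>)) * f \<mu> (finv \<mu> \<circ> \<rho>)"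
    have "mul (mul a b) c \<rho> = (\<Sum>\<mu>\<in>\<G>. \<Sum>\<sigma>\<in>\<G>. ?t \<sigma> \<mu>)"
      using r by (simp add: mul_def sum_distrib_right cong: sum.cong)
    also have "\<dots> = (\<Sum>\<sigma>\<in>\<G>. \<Sum>\<mu>\<in>\<G>. ?t \<sigma> \<mu>)" by (rule sum.swap)
    also have "\<dots> = (\<Sum>\<sigma>\<in>\<G>. a \<sigma> * \<sigma> (mul b c (finv \<sigma> \<circ> \<rho>)) * f \<sigma> (finv \<sigma> \<circ> \<rho>))"
    proof (rule sum.cong[OF refl])
      fix \<sigma> assume s: "\<sigma> \<in> \<G>"
      have sr: "finv \<sigma> \<circ> \<rho> \<in> \<G>" using s r inv_mem comp_mem by blast
      \<comment> \<open>Setting \<open>\<mu> = \<sigma> \<circ> \<tau>\<close> factors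
        \<open>\<rho>\<close> as \<open>\<sigma> \<circ> \<tau> \<circ> \<gamma>\<close>, the shape
        in which the cocycle identity applies.\<close>
      have "(\<Sum>\<mu>\<in>\<G>. ?t \<sigma> \<mu>) = (\<Sum>\<tau>\<in>\<G>. ?t \<sigma> (\<sigma> \<circ> \<tau>))"
        by (rule sum.reindex_bij_betw[OF bij_comp_left[OF s], symmetric])
      also have "\<dots> = (\<Sum>\<tau>\<in>\<G>. a \<sigma> * \<sigma> (b \<tau> * \<tau> (c (finv \<tau> \<circ> (finv \<sigma> \<circ> \<rho>))) * f \<tau> (finv \<tau> \<circ> (finv \<sigma> \<circ> \<rho>))) * f \<sigma> (finv \<sigma> \<circ> \<rho>))"
      proof (rule sum.cong[OF refl])
        fix \<tau> assume t: "\<tau> \<in> \<G>"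
        define \<gamma> where "\<gamma> = finv \<tau> \<circ> (finv \<sigma> \<circ> \<rho>)"
        have g: "\<gamma> \<in> \<G>" using t sr inv_mem comp_mem by (auto simp: \<gamma>_def)
        have 1: "finv (\<sigma> \<circ> \<tau>) \<circ> \<rho> = \<gamma>" using s t by (simp add: inv_comp \<gamma>_def comp_assoc)
        have 2: "finv \<sigma> \<circ> \<rho> = \<tau> \<circ> \<gamma>" using t by (simp add: \<gamma>_def)
        have "?t \<sigma> (\<sigma> \<circ> \<tau>) = a \<sigma> * \<sigma> (b \<tau>) * \<sigma> (\<tau> (c \<gamma>)) * (f \<sigma> \<tau> * f (\<sigma> \<circ> \<tau>) \<gamma>)"
          unfolding 1 using s by (simp add: algebra_simps)
        also have "\<dots> = a \<sigma> * \<sigma> (b \<tau>) * \<sigma> (\<tau> (c \<gamma>)) * (\<sigma> (f \<tau> \<gamma>) * f \<sigma> (\<tau> \<circ> \<gamma>))"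
          using f_cocycle[OF s t g] by simp
        also have "\<dots> = a \<sigma> * \<sigma> (b \<tau> * \<tau> (c \<gamma>) * f \<tau> \<gamma>) * f \<sigma> (\<tau> \<circ> \<gamma>)"
          using s by (simp add: hom_mult algebra_simps)
        finally show "?t \<sigma> (\<sigma> \<circ> \<tau>) = a \<sigma> * \<sigma> (b \<tau> * \<tau> (c (finv \<tau> \<circ> (finv \<sigma> \<circ> \<rho>))) * f \<tau> (finv \<tau> \<circ> (finv \<sigma> \<circ> \<rho>))) * f \<sigma> (finv \<sigma> \<circ> \<rho>)"
          unfolding \<gamma>_def[symmetric] unfolding 2 .
      qed
      also have "\<dots> = a \<sigma> * \<sigma> (mul b c (finv \<sigma> \<circ> \<rho>)) * f \<sigma> (finv \<sigma> \<circ> \<rho>)"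
        using s sr by (simp add: mul_def hom_sum sum_distrib_left sum_distrib_right)
      finally show "(\<Sum>\<mu>\<in>\<G>. ?t \<sigma> \<mu>) = a \<sigma> * \<sigma> (mul b c (finv \<sigma> \<circ> \<rho>)) * f \<sigma> (finv \<sigma> \<circ> \<rho>)" .
    qed
    also have "\<dots> = mul a (mul b c) \<rho>" using r by (simp add: mul_def)
    finally show ?thesis .
  qed (simp add: mul_def)
qed

lemma mul_add_left: "mul (\<lambda>\<sigma>. a \<sigma> + b \<sigma>) c = (\<lambda>\<sigma>. mul a c \<sigma> + mul b c \<sigma>)"
  by (rule ext) (simp add: mul_def sum.distrib[symmetric] distrib_right)

lemma mul_add_right: "mul a (\<lambda>\<sigma>. b \<sigma> + c \<sigma>) = (\<lambda>\<sigma>. mul a b \<sigma> + mul a c \<sigma>)"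
  by (rule ext) (simp add: mul_def sum.distrib[symmetric] hom_add distrib_right distrib_left)

lemma abelian_group_A: "abelian_group A"
proof (rule abelian_groupI)
  fix x assume x: "x \<in> carrier A"
  show "\<exists>y\<in>carrier A. y \<oplus>\<^bsub>A\<^esub> x = \<zero>\<^bsub>A\<^esub>"
    by (rule bexI[of _ "\<lambda>\<sigma>. - x \<sigma>"]) (use x in \<open>auto simp: carrier_A add_A zero_A\<close>)
qed (auto simp: carrier_A add_A zero_A algebra_simps)

lemma ring_A: "ring A"
proof (rule ringI[OF abelian_group_A])
  have "(\<lambda>\<sigma>. x \<sigma> * \<sigma> 1) = x" if "x \<in> carrier A" for x
  proof
    fix \<sigma> show "x \<sigma> * \<sigma> 1 = x \<sigma>" using that by (cases "\<sigma> \<in> \<G>") (auto simp: carrier_A)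
  qed
  then show "monoid A"
    by (intro monoidI) (auto simp: mult_A one_A mul_assoc mul_id_left mul_id_right)
qed (auto simp: mult_A add_A mul_add_left mul_add_right)

lemma a_inv_A: "x \<in> carrier A \<Longrightarrow> \<ominus>\<^bsub>A\<^esub> x = (\<lambda>\<sigma>. - x \<sigma>)"
proof -
  interpret ring A by (rule ring_A)
  assume x: "x \<in> carrier A"
  then show ?thesis
    by (intro minus_equality) (auto simp: carrier_A add_A zero_A)
qed

lemma finsum_A: "h \<in> Y \<rightarrow> carrier A \<Longrightarrow> finite Y \<Longrightarrow> finsum A h Y = (\<lambda>\<sigma>. \<Sum>y\<in>Y. h y \<sigma>)"
proof -
  interpret ring A by (rule ring_A)
  assume h: "h \<in> Y \<rightarrow> carrier A" and "finite Y"
  from \<open>finite Y\<close> h show ?thesis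
  proof (induction Y rule: finite_induct)
    case (insert y Y)
    then show ?case by (simp add: finsum_insert Pi_iff add_A)
  qed (simp add: zero_A)
qed

lemma smult_carrier: "x \<in> carrier A \<Longrightarrow> c \<odot>\<^bsub>A\<^esub> x \<in> carrier A"
  by (simp add: carrier_A smult_A)

lemma scale_carrier: "x \<in> carrier A \<Longrightarrow> (\<lambda>\<sigma>. c * x \<sigma>) \<in> carrier A"
  by (simp add: carrier_A)

section \<open>Lattices and orders in the crossed product\<close>

lemma module_span_finite:
  assumes "finite B" "B \<subseteq> carrier A"
  shows "module_span V A B = {\<lambda>\<sigma>. \<Sum>x\<in>B. c x * x \<sigma> | c. c \<in> B \<rightarrow> V}"
proof (intro equalityI subsetI)
  fix y assume "y \<in> module_span V A B"
  then obtain Y c where Y: "finite Y" "Y \<subseteq> B" "c \<in> Y \<rightarrow> V" "y = (\<Oplus>\<^bsub>A\<^esub>x\<in>Y. c x \<odot>\<^bsub>A\<^esub> x)"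
    unfolding module_span_def by auto
  have "y = (\<lambda>\<sigma>. \<Sum>x\<in>Y. c x * x \<sigma>)"
    unfolding Y(4) using assms(2) Y(1,2) by (subst finsum_A) (auto intro!: scale_carrier simp: smult_A[abs_def])
  also have "\<dots> = (\<lambda>\<sigma>. \<Sum>x\<in>B. (if x \<in> Y then c x else 0) * x \<sigma>)"
    by (rule ext, rule sum.mono_neutral_cong_left) (use assms Y in auto)
  finally show "y \<in> {\<lambda>\<sigma>. \<Sum>x\<in>B. c x * x \<sigma> | c. c \<in> B \<rightarrow> V}"
    using Y(3) by (intro CollectI exI[of _ "\<lambda>x. if x \<in> Y then c x else 0"]) auto
next
  fix y assume "y \<in> {\<lambda>\<sigma>. \<Sum>x\<in>B. c x * x \<sigma> | c. c \<in> B \<rightarrow> V}"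
  then obtain c where c: "c \<in> B \<rightarrow> V" "y = (\<lambda>\<sigma>. \<Sum>x\<in>B. c x * x \<sigma>)" by auto
  then have "y = (\<Oplus>\<^bsub>A\<^esub>x\<in>B. c x \<odot>\<^bsub>A\<^esub> x)"
    using assms by (subst finsum_A) (auto intro!: scale_carrier simp: smult_A[abs_def])
  then show "y \<in> module_span V A B" unfolding module_span_def using c assms(1) by blast
qed

lemma single_sum_mem:
  assumes a: "a \<in> carrier A" "\<And>\<sigma>. \<sigma> \<in> \<G> \<Longrightarrow> single \<sigma> (a \<sigma>) \<in> L"
    and zero: "(\<lambda>_. 0) \<in> L" and add: "\<And>x y. x \<in> L \<Longrightarrow> y \<in> L \<Longrightarrow> (\<lambda>\<sigma>. x \<sigma> + y \<sigma>) \<in> L"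
  shows "a \<in> L"
proof -
  have "(\<lambda>\<tau>. \<Sum>\<sigma>\<in>Z. single \<sigma> (a \<sigma>) \<tau>) \<in> L" if "finite Z" "Z \<subseteq> \<G>" for Z
    using that
  proof (induction Z rule: finite_induct)
    case (insert \<sigma> Z)
    then show ?case using add[of "single \<sigma> (a \<sigma>)" "\<lambda>\<tau>. \<Sum>\<sigma>\<in>Z. single \<sigma> (a \<sigma>) \<tau>"] a by simp
  qed (simp add: zero)
  then have "(\<lambda>\<tau>. \<Sum>\<sigma>\<in>\<G>. single \<sigma> (a \<sigma>) \<tau>) \<in> L" by simp
  moreover have "(\<Sum>\<sigma>\<in>\<G>. single \<sigma> (a \<sigma>) \<tau>) = a \<tau>" for \<tau>
    using a by (auto simp: single_def carrier_A)
  ultimately show ?thesis by simp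
qed

text \<open>Generators of the components, placed in their degrees, generate the whole. The finite
  generation demanded by \<open>is_order\<close> is thus reduced to submodules of the field.\<close>

lemma graded_module_span:
  assumes "\<And>\<sigma>. \<sigma> \<in> \<G> \<Longrightarrow> finite (B \<sigma>)"
  shows "\<exists>C. finite C \<and> C \<subseteq> carrier A \<and> {a \<in> carrier A. \<forall>\<sigma>\<in>\<G>. a \<sigma> \<in> lin (B \<sigma>)} = module_span V A C"
proof -
  define C where "C = (\<Union>\<sigma>\<in>\<G>. single \<sigma> ` B \<sigma>)"
  have C: "finite C" "C \<subseteq> carrier A" using assms by (auto simp: C_def)
  let ?L = "module_span V A C"
  note span = module_span_finite[OF C]
  have spanI: "(\<lambda>\<sigma>. \<Sum>x\<in>C. c x * x \<sigma>) \<in> ?L" if "c \<in> C \<rightarrow> V" for c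
    unfolding span using that by blast
  have zero: "(\<lambda>_. 0) \<in> ?L" using spanI[of "\<lambda>_. 0"] by simp
  have add: "(\<lambda>\<sigma>. x \<sigma> + y \<sigma>) \<in> ?L" if xy: "x \<in> ?L" "y \<in> ?L" for x y
  proof -
    obtain c d where cd: "c \<in> C \<rightarrow> V" "d \<in> C \<rightarrow> V" "x = (\<lambda>\<sigma>. \<Sum>x\<in>C. c x * x \<sigma>)" "y = (\<lambda>\<sigma>. \<Sum>x\<in>C. d x * x \<sigma>)"
      using xy unfolding span by auto
    have "(\<lambda>\<sigma>. \<Sum>x\<in>C. (c x + d x) * x \<sigma>) \<in> ?L"
      by (rule spanI) (use cd in \<open>auto intro: add_mem\<close>)
    then show ?thesis unfolding cd by (simp add: sum.distrib distrib_right)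
  qed
  have smult: "(\<lambda>\<sigma>. a * x \<sigma>) \<in> ?L" if a: "a \<in> V" and x: "x \<in> ?L" for a x
  proof -
    obtain c where c: "c \<in> C \<rightarrow> V" "x = (\<lambda>\<sigma>. \<Sum>x\<in>C. c x * x \<sigma>)"
      using x unfolding span by auto
    have "(\<lambda>\<sigma>. \<Sum>x\<in>C. (a * c x) * x \<sigma>) \<in> ?L"
      by (rule spanI) (use a c in \<open>auto intro: mult_mem\<close>)
    then show ?thesis unfolding c by (simp add: sum_distrib_left mult.assoc)
  qed
  have base: "x \<in> ?L" if x: "x \<in> C" for x
  proof -
    have "(\<lambda>\<sigma>. \<Sum>y\<in>C. (if y = x then 1 else 0) * y \<sigma>) \<in> ?L" by (rule spanI) auto
    moreover have "(\<Sum>y\<in>C. (if y = x then 1 else 0) * y \<sigma>) = x \<sigma>" for \<sigma>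
      by (rule sum_indicator[OF C(1) x])
    ultimately show ?thesis by simp
  qed
  have "{a \<in> carrier A. \<forall>\<sigma>\<in>\<G>. a \<sigma> \<in> lin (B \<sigma>)} = ?L"
  proof (intro equalityI subsetI)
    fix a assume a: "a \<in> {a \<in> carrier A. \<forall>\<sigma>\<in>\<G>. a \<sigma> \<in> lin (B \<sigma>)}"
    have s: "single \<sigma> x \<in> ?L" if "\<sigma> \<in> \<G>" "x \<in> lin (B \<sigma>)" for \<sigma> x
    proof -
      have "x \<in> {x. single \<sigma> x \<in> ?L}"
      proof (rule lin_least[OF that(2)])
        show "B \<sigma> \<subseteq> {x. single \<sigma> x \<in> ?L}" using base that(1) by (auto simp: C_def)
        show "0 \<in> {x. single \<sigma> x \<in> ?L}" using zero by (simp add: single_def)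
        fix x y assume "x \<in> {x. single \<sigma> x \<in> ?L}" "y \<in> {x. single \<sigma> x \<in> ?L}"
        then have "(\<lambda>\<tau>. single \<sigma> x \<tau> + single \<sigma> y \<tau>) \<in> ?L" using add by simp
        moreover have "(\<lambda>\<tau>. single \<sigma> x \<tau> + single \<sigma> y \<tau>) = single \<sigma> (x + y)" by (auto simp: single_def)
        ultimately show "x + y \<in> {x. single \<sigma> x \<in> ?L}" by simp
      next
        fix c x assume "c \<in> V" "x \<in> {x. single \<sigma> x \<in> ?L}"
        then have "(\<lambda>\<tau>. c * single \<sigma> x \<tau>) \<in> ?L" using smult by simp
        moreover have "(\<lambda>\<tau>. c * single \<sigma> x \<tau>) = single \<sigma> (c * x)" by (auto simp: single_def)
        ultimately show "c * x \<in> {x. single \<sigma> x \<in> ?L}" by simp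
      qed
      then show ?thesis by simp
    qed
    show "a \<in> ?L" by (rule single_sum_mem[of a]) (use a s zero add in auto)
  next
    fix a assume "a \<in> ?L"
    then obtain c where c: "c \<in> C \<rightarrow> V" "a = (\<lambda>\<sigma>. \<Sum>x\<in>C. c x * x \<sigma>)"
      unfolding span by auto
    have comp: "x \<sigma> \<in> lin (B \<sigma>)" if x: "x \<in> C" and s: "\<sigma> \<in> \<G>" for x \<sigma>
    proof -
      obtain \<tau> b where "\<tau> \<in> \<G>" "b \<in> B \<tau>" "x = single \<tau> b" using x by (auto simp: C_def)
      then show ?thesis using assms s by (auto simp: single_def intro: lin_base lin_zero)
    qed
    have "a \<sigma> \<in> lin (B \<sigma>)" if "\<sigma> \<in> \<G>" for \<sigma>
      unfolding c(2) by (rule lin_sum, rule lin_smult) (use c that comp in auto)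
    moreover have "a \<in> carrier A"
    proof -
      have "x \<sigma> = 0" if "x \<in> C" "\<sigma> \<notin> \<G>" for x \<sigma> using that C(2) by (auto simp: carrier_A)
      then show ?thesis unfolding c(2) by (auto simp: carrier_A intro!: sum.neutral)
    qed
    ultimately show "a \<in> {a \<in> carrier A. \<forall>\<sigma>\<in>\<G>. a \<sigma> \<in> lin (B \<sigma>)}" by blast
  qed
  then show ?thesis using C by blast
qed

definition A0 :: "(('k \<Rightarrow> 'k) \<Rightarrow> 'k) set" where
  "A0 = crossed_product_order S G f"

lemma A0_iff: "a \<in> A0 \<longleftrightarrow> a \<in> carrier A \<and> (\<forall>\<sigma>\<in>\<G>. a \<sigma> \<in> S)"
  by (simp add: A0_def A_def crossed_product_order_def)

lemma single_A0: "\<sigma> \<in> \<G> \<Longrightarrow> c \<in> S \<Longrightarrow> single \<sigma> c \<in> A0"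
  by (auto simp: A0_iff) (auto simp: single_def)

text \<open>A common denominator \<open>w \<in> V\<close> of the coefficients moves \<open>x\<close>
  into the crossed-product order, so \<open>x\<close> is a one-term combination with coefficient
  \<open>1 / w\<close>.\<close>

lemma module_span_fractions:
  assumes "A0 \<subseteq> \<Lambda>" "\<Lambda> \<subseteq> carrier A"
  shows "module_span fractions A \<Lambda> = carrier A"
proof (intro equalityI subsetI)
  interpret ring A by (rule ring_A)
  fix x assume "x \<in> module_span fractions A \<Lambda>"
  then show "x \<in> carrier A"
    unfolding module_span_def using assms(2) by (auto intro!: finsum_closed smult_carrier)
next
  fix x assume x: "x \<in> carrier A"
  have "\<exists>v. v \<in> V \<and> v \<noteq> 0 \<and> v * x \<sigma> \<in> S" for \<sigma> using multiple_in_S[of "x \<sigma>"] by blast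
  then obtain v where v: "\<And>\<sigma>. v \<sigma> \<in> V \<and> v \<sigma> \<noteq> 0 \<and> v \<sigma> * x \<sigma> \<in> S" by metis
  define w where "w = (\<Prod>\<sigma>\<in>\<G>. v \<sigma>)"
  have w: "w \<in> V" "w \<noteq> 0" using v by (auto simp: w_def intro!: prod_mem)
  have wx: "w * x \<sigma> \<in> S" if "\<sigma> \<in> \<G>" for \<sigma>
  proof -
    have "w = v \<sigma> * (\<Prod>\<tau>\<in>\<G>-{\<sigma>}. v \<tau>)" unfolding w_def by (rule prod.remove) (use that in auto)
    then have eq: "w * x \<sigma> = (v \<sigma> * x \<sigma>) * (\<Prod>\<tau>\<in>\<G>-{\<sigma>}. v \<tau>)" by (simp add: algebra_simps)
    moreover have "(\<Prod>\<tau>\<in>\<G>-{\<sigma>}. v \<tau>) \<in> S" using v V_subset_S by (intro S.prod_mem) auto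
    ultimately show ?thesis using v S.mult_mem by metis
  qed
  define y where "y = (\<lambda>\<sigma>. w * x \<sigma>)"
  have y: "y \<in> \<Lambda>" using assms(1) x wx by (auto simp: y_def A0_iff carrier_A)
  have "x = (\<Oplus>\<^bsub>A\<^esub>z\<in>{y}. (1 / w) \<odot>\<^bsub>A\<^esub> z)"
    using x y assms(2) w by (subst finsum_A) (auto intro!: scale_carrier simp: smult_A[abs_def] y_def)
  moreover have "1 / w \<in> fractions" using w by (intro fractionsI) auto
  ultimately show "x \<in> module_span fractions A \<Lambda>"
    unfolding module_span_def using y
    by (intro CollectI exI[of _ "{y}"] exI[of _ "\<lambda>_. 1 / w"]) auto
qed

lemma is_orderI:
  assumes sub: "A0 \<subseteq> \<Lambda>" "\<Lambda> \<subseteq> carrier A"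
    and mul: "\<And>a b. a \<in> \<Lambda> \<Longrightarrow> b \<in> \<Lambda> \<Longrightarrow> mul a b \<in> \<Lambda>"
    and add: "\<And>a b. a \<in> \<Lambda> \<Longrightarrow> b \<in> \<Lambda> \<Longrightarrow> (\<lambda>\<sigma>. a \<sigma> + b \<sigma>) \<in> \<Lambda>"
    and fin: "\<And>\<sigma>. \<sigma> \<in> \<G> \<Longrightarrow> finite (B \<sigma>)"
    and eq: "\<Lambda> = {a \<in> carrier A. \<forall>\<sigma>\<in>\<G>. a \<sigma> \<in> lin (B \<sigma>)}"
  shows "is_order V fractions A \<Lambda>"
  unfolding is_order_def
proof (intro conjI)
  interpret ring A by (rule ring_A)
  show "subring \<Lambda> A"
  proof (rule subringI[OF sub(2)])
    show "\<one>\<^bsub>A\<^esub> \<in> \<Lambda>" using single_A0[of id 1] sub(1) by (auto simp: one_A)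
    fix a assume a: "a \<in> \<Lambda>"
    then have "mul (single id (- 1)) a \<in> \<Lambda>"
      using single_A0[of id "- 1"] sub(1) S.uminus_mem[of 1] by (intro mul) auto
    then show "\<ominus>\<^bsub>A\<^esub> a \<in> \<Lambda>" using a sub(2) by (auto simp: a_inv_A mul_id_left subset_iff)
  qed (use mul add in \<open>auto simp: mult_A add_A\<close>)
  show "\<exists>B. finite B \<and> B \<subseteq> carrier A \<and> \<Lambda> = module_span V A B"
    unfolding eq by (rule graded_module_span[OF fin])
  show "module_span fractions A \<Lambda> = carrier A" by (rule module_span_fractions[OF sub])
qed

lemma A0_add: "a \<in> A0 \<Longrightarrow> b \<in> A0 \<Longrightarrow> (\<lambda>\<sigma>. a \<sigma> + b \<sigma>) \<in> A0"
  by (auto simp: A0_iff carrier_A intro: S.add_mem)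

lemma A0_mul: "a \<in> A0 \<Longrightarrow> b \<in> A0 \<Longrightarrow> mul a b \<in> A0"
  unfolding A0_iff using mul_carrier[of a b]
  by (auto simp: mul_def intro!: S.sum_mem S.mult_mem f_S comp_mem inv_mem)

lemma is_order_A0: "is_order V fractions A A0"
proof -
  obtain B where B: "finite B" "S = lin B" using S_finitely_generated by metis
  show ?thesis
  proof (rule is_orderI[where B = "\<lambda>_. B"])
    show "A0 = {a \<in> carrier A. \<forall>\<sigma>\<in>\<G>. a \<sigma> \<in> lin B}"
      unfolding set_eq_iff by (simp add: A0_iff B(2)[symmetric])
    show "A0 \<subseteq> carrier A" by (rule subsetI) (simp add: A0_iff)
  qed (use B(1) in \<open>simp_all add: A0_mul A0_add\<close>)
qed

section \<open>Rings above the crossed-product order are graded\<close>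

context
  fixes \<Lambda> assumes sub: "A0 \<subseteq> \<Lambda>" "\<Lambda> \<subseteq> carrier A"
    and mul: "\<And>a b. a \<in> \<Lambda> \<Longrightarrow> b \<in> \<Lambda> \<Longrightarrow> mul a b \<in> \<Lambda>"
    and add: "\<And>a b. a \<in> \<Lambda> \<Longrightarrow> b \<in> \<Lambda> \<Longrightarrow> (\<lambda>\<sigma>. a \<sigma> + b \<sigma>) \<in> \<Lambda>"
begin

text \<open>Sandwiching by scalars: the \<open>\<sigma>\<close>-coefficient of \<open>x a y\<close>
  is \<open>x * \<sigma> y * a \<sigma>\<close>. Thus \<open>S \<otimes> S\<close> acts through
  functions on the group, and an indicator function acts as the projection to one homogeneous
  component.\<close>

lemma overring_tensor_fun:
  assumes "g \<in> tensor_fun" "a \<in> \<Lambda>"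
  shows "(\<lambda>\<sigma>. g \<sigma> * a \<sigma>) \<in> \<Lambda>"
  using assms(1)
proof (induction rule: tensor_fun.induct)
  case zero
  have "(\<lambda>_. 0) \<in> A0" by (simp add: A0_iff carrier_A)
  then show ?case using sub(1) by auto
next
  case (step g x y)
  have "single id x \<in> \<Lambda>" "single id y \<in> \<Lambda>" using single_A0 step sub(1) by auto
  then have "mul (mul (single id x) a) (single id y) \<in> \<Lambda>" using assms(2) mul by simp
  then have "(\<lambda>\<sigma>. x * a \<sigma> * \<sigma> y) \<in> \<Lambda>"
    using assms(2) sub(2) by (simp add: mul_id_right mul_id_left subset_iff)
  then have "(\<lambda>\<sigma>. g \<sigma> * a \<sigma> + x * a \<sigma> * \<sigma> y) \<in> \<Lambda>" using add step.IH by blast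
  then show ?case by (simp add: algebra_simps)
next
  case (agree g g')
  have "(\<lambda>\<sigma>. g' \<sigma> * a \<sigma>) = (\<lambda>\<sigma>. g \<sigma> * a \<sigma>)"
  proof
    fix \<sigma> show "g' \<sigma> * a \<sigma> = g \<sigma> * a \<sigma>"
      using agree assms(2) sub(2) by (cases "\<sigma> \<in> \<G>") (auto simp: carrier_A)
  qed
  then show ?case using agree by (simp only:)
qed

lemma overring_component:
  assumes "a \<in> \<Lambda>" "\<sigma> \<in> \<G>"
  shows "single \<sigma> (a \<sigma>) \<in> \<Lambda>"
proof -
  have "(\<lambda>\<tau>. (if \<tau> = \<sigma> then 1 else 0) * a \<tau>) \<in> \<Lambda>"
    by (rule overring_tensor_fun[OF tensor_fun_indicator[OF assms(2)] assms(1)])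
  moreover have "(\<lambda>\<tau>. (if \<tau> = \<sigma> then 1 else 0) * a \<tau>) = single \<sigma> (a \<sigma>)"
    by (auto simp: single_def)
  ultimately show ?thesis by simp
qed

lemma overring_graded: "\<Lambda> = {a \<in> carrier A. \<forall>\<sigma>\<in>\<G>. single \<sigma> (a \<sigma>) \<in> \<Lambda>}"
proof (intro equalityI subsetI)
  fix a assume a: "a \<in> {a \<in> carrier A. \<forall>\<sigma>\<in>\<G>. single \<sigma> (a \<sigma>) \<in> \<Lambda>}"
  have zero: "(\<lambda>_. 0) \<in> \<Lambda>" using sub(1) by (auto simp: A0_iff carrier_A)
  show "a \<in> \<Lambda>" by (rule single_sum_mem[of a]) (use a zero add in auto)
qed (use sub overring_component in auto)

end

lemma order_closed:
  assumes "is_order V fractions A \<Lambda>"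
  shows "\<Lambda> \<subseteq> carrier A" "\<And>a b. a \<in> \<Lambda> \<Longrightarrow> b \<in> \<Lambda> \<Longrightarrow> mul a b \<in> \<Lambda>"
    "\<And>a b. a \<in> \<Lambda> \<Longrightarrow> b \<in> \<Lambda> \<Longrightarrow> (\<lambda>\<sigma>. a \<sigma> + b \<sigma>) \<in> \<Lambda>" "single id 1 \<in> \<Lambda>"
proof -
  have s: "subring \<Lambda> A" using assms by (simp add: is_order_def)
  show "\<Lambda> \<subseteq> carrier A" "single id 1 \<in> \<Lambda>" using subringE(1,3)[OF s] by (simp_all add: one_A)
  fix a b assume "a \<in> \<Lambda>" "b \<in> \<Lambda>"
  then show "mul a b \<in> \<Lambda>" "(\<lambda>\<sigma>. a \<sigma> + b \<sigma>) \<in> \<Lambda>"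
    using subringE(6,7)[OF s, of a b] by (simp_all add: mult_A add_A)
qed

text \<open>Left multiplication by \<open>single id c\<close> preserves the order and multiplies
  identity coefficients by \<open>c\<close>. These coefficients span a finitely generated module,
  nonzero because 1 lies in the order, so the determinant trick applies.\<close>

lemma order_scalar_integral:
  assumes "is_order V fractions A \<Lambda>" "single id c \<in> \<Lambda>"
  shows "c \<in> S"
proof -
  note \<Lambda> = order_closed[OF assms(1)]
  obtain B where B: "finite B" "B \<subseteq> carrier A" "\<Lambda> = module_span V A B"
    using assms(1) unfolding is_order_def by blast
  note span = B(3)[unfolded module_span_finite[OF B(1,2)]]
  define B0 where "B0 = (\<lambda>b. b id) ` B"
  have fin: "finite B0" using B(1) by (simp add: B0_def)
  obtain d where d: "d \<in> B \<rightarrow> V" "single id 1 = (\<lambda>\<sigma>. \<Sum>x\<in>B. d x * x \<sigma>)"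
    using \<Lambda>(4) unfolding span by auto
  have "1 = (\<Sum>x\<in>B. d x * x id)" using fun_cong[OF d(2), of id] by simp
  then have "\<exists>x\<in>B. x id \<noteq> 0" by (metis (no_types, lifting) mult_zero_right sum.neutral zero_neq_one)
  then obtain b0 where b0: "b0 \<in> B" "b0 id \<noteq> 0" by blast
  show ?thesis
  proof (rule integral_closureI[OF fin])
    show "b0 id \<in> B0" "b0 id \<noteq> 0" using b0 by (auto simp: B0_def)
    fix x assume "x \<in> B0"
    then obtain b where b: "b \<in> B" "x = b id" by (auto simp: B0_def)
    have "b \<in> \<Lambda>"
    proof -
      have "(\<lambda>\<sigma>. \<Sum>y\<in>B. (if y = b then 1 else 0) * y \<sigma>) \<in> \<Lambda>"
        unfolding span by (intro CollectI exI[of _ "\<lambda>y. if y = b then 1 else 0"]) auto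
      moreover have "(\<Sum>y\<in>B. (if y = b then 1 else 0) * y \<sigma>) = b \<sigma>" for \<sigma>
        by (rule sum_indicator[OF B(1) b(1)])
      ultimately show ?thesis by simp
    qed
    then have "mul (single id c) b \<in> \<Lambda>" using \<Lambda>(2) assms(2) by blast
    then have "(\<lambda>\<sigma>. c * b \<sigma>) \<in> \<Lambda>" using B(2) b by (simp add: mul_id_left subset_iff)
    then obtain e where e: "e \<in> B \<rightarrow> V" "(\<lambda>\<sigma>. c * b \<sigma>) = (\<lambda>\<sigma>. \<Sum>x\<in>B. e x * x \<sigma>)"
      unfolding span by auto
    have "c * x = (\<Sum>x\<in>B. e x * x id)" using fun_cong[OF e(2), of id] b by simp
    moreover have "x id \<in> lin B0" if "x \<in> B" for x
      by (rule lin_base[OF fin]) (use that in \<open>simp add: B0_def\<close>)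
    then have "(\<Sum>x\<in>B. e x * x id) \<in> lin B0"
      by (intro lin_sum lin_smult) (use e in auto)
    ultimately show "c * x \<in> lin B0" by simp
  qed
qed

end

section \<open>Maximality\<close>

context crossed_setting
begin

lemma image_comp_inv: "\<sigma> \<in> \<G> \<Longrightarrow> finv \<sigma> ` (\<sigma> ` M) = M" "\<sigma> \<in> \<G> \<Longrightarrow> \<sigma> ` (finv \<sigma> ` M) = M"
  by (simp_all add: image_comp)

section \<open>Valuations of the cocycle values\<close>

lemma f_inv_swap:
  assumes "\<sigma> \<in> \<G>"
  shows "\<sigma> (f (finv \<sigma>) \<sigma>) = f \<sigma> (finv \<sigma>)"
  using f_cocycle[OF assms inv_mem[OF assms] assms] assms by simp

lemma val_f_nonneg:
  assumes "max_ideal M" "\<sigma> \<in> \<G>" "\<tau> \<in> \<G>"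
  shows "0 \<le> val M (f \<sigma> \<tau>)"
  using val_S_nonneg[OF assms(1)] f_S f_nonzero assms by blast

lemma val_hom_f_nonneg:
  assumes "max_ideal M" "\<rho> \<in> \<G>" "\<sigma> \<in> \<G>" "\<tau> \<in> \<G>"
  shows "0 \<le> val M (\<rho> (f \<sigma> \<tau>))"
  using val_S_nonneg[OF assms(1), of "\<rho> (f \<sigma> \<tau>)"] f_S f_nonzero assms by simp

text \<open>In additive form all four terms are nonnegative: if one side vanishes, both terms of the
  other side vanish, and each term is bounded by the opposite side.\<close>

lemma val_cocycle:
  assumes "max_ideal M" "\<sigma> \<in> \<G>" "\<tau> \<in> \<G>" "\<gamma> \<in> \<G>"
  shows "val M (\<sigma> (f \<tau> \<gamma>)) + val M (f \<sigma> (\<tau> \<circ> \<gamma>)) = val M (f \<sigma> \<tau>) + val M (f (\<sigma> \<circ> \<tau>) \<gamma>)"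
  using arg_cong[OF f_cocycle[OF assms(2-4)], of "val M"] assms f_nonzero comp_mem
  by (simp add: val_mult[OF assms(1)])

lemma val_hom': "\<sigma> \<in> \<G> \<Longrightarrow> \<sigma> ` N = M \<Longrightarrow> val M (\<sigma> x) = val N x"
  using val_hom by blast

lemma funpow_mem: "\<delta> \<in> \<G> \<Longrightarrow> \<delta> ^^ i \<in> \<G>"
proof (induction i)
  case 0
  show ?case unfolding funpow.simps by (rule id_mem)
next
  case (Suc i)
  then show ?case unfolding funpow.simps by (intro comp_mem)
qed

lemma finite_order:
  assumes "\<delta> \<in> \<G>"
  obtains m where "0 < m" "\<delta> ^^ m = id"
proof -
  note mem = funpow_mem[OF assms]
  have "\<not> inj (\<lambda>i. \<delta> ^^ i)"
  proof
    assume "inj (\<lambda>i. \<delta> ^^ i)"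
    moreover have "finite (range (\<lambda>i. \<delta> ^^ i))"
      by (rule finite_subset[OF _ finite_G]) (use mem in auto)
    ultimately show False using finite_imageD infinite_UNIV_nat by blast
  qed
  then obtain i j where ij: "\<delta> ^^ i = \<delta> ^^ j" "i < j" by (metis injI linorder_neqE_nat)
  have "\<delta> ^^ j = \<delta> ^^ i \<circ> \<delta> ^^ (j - i)" using ij(2) by (simp add: funpow_add[symmetric])
  then have "finv (\<delta> ^^ i) \<circ> \<delta> ^^ i = finv (\<delta> ^^ i) \<circ> (\<delta> ^^ i \<circ> \<delta> ^^ (j - i))" using ij by simp
  then have "\<delta> ^^ (j - i) = id" using mem[of i] by simp
  then show ?thesis using ij(2) that[of "j - i"] by simp
qed

lemma maximal_if:
  assumes C1: "\<And>M \<tau>. max_ideal M \<Longrightarrow> \<tau> \<in> \<G> \<Longrightarrow> val M (f \<tau> (finv \<tau>)) \<le> 1"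
    and C2: "\<And>M \<sigma>. max_ideal M \<Longrightarrow> \<sigma> \<in> \<G> \<Longrightarrow>
      \<exists>g\<in>\<G>. \<exists>\<delta>\<in>\<G>. \<delta> ` M = M \<and> \<sigma> = \<delta> \<circ> g \<and> val M (f g (finv g)) = 0"
  shows "is_maximal_order V fractions A A0"
  unfolding is_maximal_order_def
proof (intro conjI allI impI)
  show "is_order V fractions A A0" by (rule is_order_A0)
  fix \<Lambda> assume "is_order V fractions A \<Lambda> \<and> A0 \<subseteq> \<Lambda>"
  then have ord: "is_order V fractions A \<Lambda>" and sub: "A0 \<subseteq> \<Lambda>" by auto
  note \<Lambda> = order_closed[OF ord]
  have "l \<in> A0" if l: "l \<in> \<Lambda>" for l
  proof (rule ccontr)
    assume "l \<notin> A0"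
    then obtain \<sigma> where s: "\<sigma> \<in> \<G>" "l \<sigma> \<notin> S" using l \<Lambda>(1) by (auto simp: A0_iff)
    then obtain M where M: "max_ideal M" "\<not> val_ge M 0 (l \<sigma>)" using mem_S_iff by blast
    then have l0: "l \<sigma> \<noteq> 0" "val M (l \<sigma>) < 0" by (auto simp: val_ge_def)
    obtain g \<delta> where gd: "g \<in> \<G>" "\<delta> \<in> \<G>" "\<delta> ` M = M" "\<sigma> = \<delta> \<circ> g" "val M (f g (finv g)) = 0"
      using C2[OF M(1) s(1)] by blast
    have gi: "finv g \<in> \<G>" and di: "finv \<delta> \<in> \<G>" using gd inv_mem by auto
    define a where "a = l \<sigma> * f \<sigma> (finv g)"
    have "single \<sigma> (l \<sigma>) \<in> \<Lambda>" by (rule overring_component[OF sub \<Lambda>(1-3) l s(1)])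
    moreover have "single (finv g) 1 \<in> \<Lambda>" using single_A0[OF gi S.one_mem] sub by blast
    ultimately have "mul (single \<sigma> (l \<sigma>)) (single (finv g) 1) \<in> \<Lambda>" by (rule \<Lambda>(2))
    moreover have "\<sigma> \<circ> finv g = \<delta>" using gd by simp
    ultimately have a: "single \<delta> a \<in> \<Lambda>" using s gi by (simp add: mul_single_single a_def)
    \<comment> \<open>At \<open>(\<sigma>, finv g, g)\<close> the left side vanishes by the choice
      of \<open>g\<close>. Hence \<open>f \<sigma> (finv g)\<close> is a unit at \<open>M\<close>,
      and the pole of \<open>l \<sigma>\<close> survives the passage from \<open>\<sigma>\<close> to
      \<open>\<delta>\<close>.\<close>
    have "val M (\<sigma> (f (finv g) g)) + val M (f \<sigma> (finv g \<circ> g)) = val M (f \<sigma> (finv g)) + val M (f (\<sigma> \<circ> finv g) g)"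
      by (rule val_cocycle[OF M(1) s(1) gi gd(1)])
    moreover have "val M (\<sigma> (f (finv g) g)) = 0"
      using f_inv_swap[OF gd(1)] val_hom'[OF gd(2,3)] gd(4,5) by simp
    moreover have "val M (f \<sigma> (finv g \<circ> g)) = 0" using gd(1) s(1) val_one[OF M(1)] by simp
    ultimately have "val M (f \<sigma> (finv g)) = 0"
      using val_f_nonneg[OF M(1)] s(1) gi gd(1) comp_mem by (metis add.right_neutral add_nonneg_eq_0_iff)
    then have a0: "a \<noteq> 0" "val M a < 0"
      using val_mult[OF M(1) l0(1), of "f \<sigma> (finv g)"] l0 f_nonzero[OF s(1) gi] by (auto simp: a_def)
    have le1: "val M (f \<delta> \<tau>) \<le> 1" if t: "\<tau> \<in> \<G>" for \<tau>
    proof -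
      have "val M (finv \<delta> (f \<delta> \<tau>)) + val M (f (finv \<delta>) (\<delta> \<circ> \<tau>)) = val M (f (finv \<delta>) \<delta>) + val M (f (finv \<delta> \<circ> \<delta>) \<tau>)"
        by (rule val_cocycle[OF M(1) di gd(2) t])
      moreover have "val M (finv \<delta> (f \<delta> \<tau>)) = val M (f \<delta> \<tau>)"
        by (rule val_hom'[OF di]) (metis gd(2,3) image_comp_inv(1))
      moreover have "val M (f (finv \<delta>) \<delta>) \<le> 1" using C1[OF M(1) di] gd(2) by simp
      moreover have "0 \<le> val M (f (finv \<delta>) (\<delta> \<circ> \<tau>))" using val_f_nonneg[OF M(1) di comp_mem[OF gd(2) t]] .
      ultimately show ?thesis using gd(2) t val_one[OF M(1)] by simp
    qed
    note dmem = funpow_mem[OF gd(2)]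
    have pow: "\<exists>b. b \<noteq> 0 \<and> val M b < 0 \<and> single (\<delta> ^^ Suc i) b \<in> \<Lambda>" for i
    proof (induction i)
      case 0
      then show ?case using a a0 by auto
    next
      case (Suc i)
      then obtain b where b: "b \<noteq> 0" "val M b < 0" "single (\<delta> ^^ Suc i) b \<in> \<Lambda>" by blast
      define c where "c = a * \<delta> b * f \<delta> (\<delta> ^^ Suc i)"
      have f0: "f \<delta> (\<delta> ^^ Suc i) \<noteq> 0" by (rule f_nonzero[OF gd(2) dmem])
      have "mul (single \<delta> a) (single (\<delta> ^^ Suc i) b) \<in> \<Lambda>" using a b by (intro \<Lambda>(2))
      then have "single (\<delta> ^^ Suc (Suc i)) c \<in> \<Lambda>"
        using mul_single_single[OF gd(2) dmem[of "Suc i"]] by (simp add: c_def)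
      moreover have "c \<noteq> 0" using a0 b f0 gd(2) by (simp add: c_def)
      moreover have vc: "val M c = val M a + val M b + val M (f \<delta> (\<delta> ^^ Suc i))"
        unfolding c_def using a0 b f0 gd(2) val_hom'[OF gd(2,3), of b]
        by (simp add: val_mult[OF M(1)] del: funpow.simps)
      \<comment> \<open>Two poles of order at least 1 face one cocycle value of valuation at most 1,
        so a pole of order at least 1 remains.\<close>
      moreover have "val M c < 0" using vc a0 b le1[OF dmem[of "Suc i"]] by linarith
      ultimately show ?case by blast
    qed
    obtain m where m: "0 < m" "\<delta> ^^ m = id" using finite_order[OF gd(2)] by blast
    then obtain i where "m = Suc i" by (cases m) auto
    then obtain b where b: "b \<noteq> 0" "val M b < 0" "single id b \<in> \<Lambda>" using pow[of i] m by auto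
    then have "b \<in> S" using order_scalar_integral[OF ord] by blast
    then show False using val_S_nonneg[OF M(1) _ b(1)] b(2) by simp
  qed
  then show "\<Lambda> = A0" using sub by blast
qed

text \<open>When \<open>S\<close> is local these are the exponents of the Jacobson radical of the
  crossed-product order: a non-invertible \<open>x\<^sub>\<tau>\<close> is itself radical, an
  invertible one only after multiplication by \<open>p\<close>. In general degree
  \<open>\<tau>\<close> is measured at the image under \<open>\<tau>\<close> of one fixed
  \<open>N\<close>.\<close>

definition radical_exp :: "'k set \<Rightarrow> ('k \<Rightarrow> 'k) \<Rightarrow> int" where
  "radical_exp N \<tau> = (if val (\<tau> ` N) (f \<tau> (finv \<tau>)) = 0 then 1 else 0)"

lemma radical_exp_range: "0 \<le> radical_exp N \<tau>" "radical_exp N \<tau> \<le> 1"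
  by (auto simp: radical_exp_def)

text \<open>The inequality behind the stability of \<open>radical_lattice N\<close> under
  \<open>x\<^sub>\<sigma>\<close>. With \<open>\<rho> = \<sigma> \<circ> \<tau>\<close>, it could
  fail only if \<open>f \<rho> (finv \<rho>)\<close> and \<open>f \<sigma> \<tau>\<close> were units
  at the image of \<open>N\<close> under \<open>\<rho>\<close> while
  \<open>f \<tau> (finv \<tau>)\<close> was not one at the image under \<open>\<tau>\<close>. The
  cocycle identity at \<open>(finv \<rho>, \<sigma>, \<tau>)\<close> excludes this.\<close>

lemma radical_exp_comp:
  assumes N: "max_ideal N" and s: "\<sigma> \<in> \<G>" and t: "\<tau> \<in> \<G>"
  shows "radical_exp N (\<sigma> \<circ> \<tau>) \<le> radical_exp N \<tau> + val ((\<sigma> \<circ> \<tau>) ` N) (f \<sigma> \<tau>)"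
proof (rule ccontr)
  assume neg: "\<not> ?thesis"
  define \<rho> where "\<rho> = \<sigma> \<circ> \<tau>"
  have r: "\<rho> \<in> \<G>" and ri: "finv \<rho> \<in> \<G>" and ti: "finv \<tau> \<in> \<G>" using s t comp_mem inv_mem by (auto simp: \<rho>_def)
  have P: "max_ideal (\<rho> ` N)" by (rule max_ideal_hom[OF r N])
  have rN: "finv \<rho> ` (\<rho> ` N) = N" using image_comp_inv r by auto
  have "0 \<le> val (\<rho> ` N) (f \<sigma> \<tau>)" by (rule val_f_nonneg[OF P s t])
  then have "radical_exp N \<rho> = 1" "radical_exp N \<tau> = 0" and st: "val (\<rho> ` N) (f \<sigma> \<tau>) = 0"
    using neg radical_exp_range[of N \<tau>] radical_exp_range[of N \<rho>] unfolding \<rho>_def[symmetric] by linarith+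
  then have inv_r: "val (\<rho> ` N) (f \<rho> (finv \<rho>)) = 0" and t0: "val (\<tau> ` N) (f \<tau> (finv \<tau>)) \<noteq> 0"
    by (auto simp: radical_exp_def split: if_splits)
  have rs: "finv \<rho> \<circ> \<sigma> = finv \<tau>" using s t by (simp add: \<rho>_def inv_comp comp_assoc)
  have "val N (finv \<rho> (f \<sigma> \<tau>)) + val N (f (finv \<rho>) (\<sigma> \<circ> \<tau>)) = val N (f (finv \<rho>) \<sigma>) + val N (f (finv \<rho> \<circ> \<sigma>) \<tau>)"
    by (rule val_cocycle[OF N ri s t])
  moreover have "val N (finv \<rho> (f \<sigma> \<tau>)) = 0" using val_hom'[OF ri rN] st by simp
  moreover have "val N (f (finv \<rho>) \<rho>) = 0"
    using val_hom[OF r, of N "f (finv \<rho>) \<rho>"] f_inv_swap[OF r] inv_r by simp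
  moreover have "0 \<le> val N (f (finv \<rho>) \<sigma>)" "0 \<le> val N (f (finv \<tau>) \<tau>)"
    using val_f_nonneg[OF N] ri s ti t by auto
  ultimately have "val N (f (finv \<tau>) \<tau>) = 0" unfolding rs \<rho>_def[symmetric] by linarith
  then have "val (\<tau> ` N) (f \<tau> (finv \<tau>)) = 0"
    using val_hom[OF t, of N "f (finv \<tau>) \<tau>"] f_inv_swap[OF t] by simp
  then show False using t0 by simp
qed

text \<open>A lattice on the part of the algebra with source \<open>N\<close>, modelled on the Jacobson radical.\<close>

definition radical_lattice :: "'k set \<Rightarrow> (('k \<Rightarrow> 'k) \<Rightarrow> 'k) set" where
  "radical_lattice N = {b \<in> carrier A. \<forall>\<tau>\<in>\<G>. val_ge (\<tau> ` N) (radical_exp N \<tau>) (b \<tau>)}"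

definition left_order :: "'k set \<Rightarrow> (('k \<Rightarrow> 'k) \<Rightarrow> 'k) set" where
  "left_order N = {a \<in> carrier A. \<forall>b\<in>radical_lattice N. mul a b \<in> radical_lattice N}"

context
  fixes N assumes N: "max_ideal N"
begin

lemma hom_max_ideal: "\<tau> \<in> \<G> \<Longrightarrow> max_ideal (\<tau> ` N)"
  by (rule max_ideal_hom[OF _ N])

lemma radical_lattice_add:
  "a \<in> radical_lattice N \<Longrightarrow> b \<in> radical_lattice N \<Longrightarrow> (\<lambda>\<sigma>. a \<sigma> + b \<sigma>) \<in> radical_lattice N"
  unfolding radical_lattice_def using hom_max_ideal by (auto simp: carrier_A intro!: val_ge_add)

text \<open>In degree \<open>\<rho> = \<sigma> \<circ> \<tau>\<close> the product consists of terms
  \<open>a \<sigma> * \<sigma> (b \<tau>) * f \<sigma> \<tau>\<close>, and \<open>\<sigma>\<close>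
  carries the valuation at the image of \<open>N\<close> under \<open>\<tau>\<close> to the one at
  its image under \<open>\<rho>\<close>. All terms are compared at the same ideal, so the bound can
  be checked term by term.\<close>

lemma mul_radical_lattice:
  assumes b: "b \<in> radical_lattice N"
    and a: "\<And>\<sigma> \<tau> k. \<sigma> \<in> \<G> \<Longrightarrow> \<tau> \<in> \<G> \<Longrightarrow> a \<sigma> \<noteq> 0 \<Longrightarrow>
      radical_exp N (\<sigma> \<circ> \<tau>) \<le> val ((\<sigma> \<circ> \<tau>) ` N) (a \<sigma>) + radical_exp N \<tau> + val ((\<sigma> \<circ> \<tau>) ` N) (f \<sigma> \<tau>)"
  shows "mul a b \<in> radical_lattice N"
  unfolding radical_lattice_def
proof (intro CollectI conjI ballI)
  fix \<rho> assume r: "\<rho> \<in> \<G>"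
  note P = hom_max_ideal[OF r]
  have "val_ge (\<rho> ` N) (radical_exp N \<rho>) (a \<sigma> * \<sigma> (b (finv \<sigma> \<circ> \<rho>)) * f \<sigma> (finv \<sigma> \<circ> \<rho>))" if s: "\<sigma> \<in> \<G>" for \<sigma>
  proof (cases "a \<sigma> = 0 \<or> b (finv \<sigma> \<circ> \<rho>) = 0")
    case False
    define \<tau> where "\<tau> = finv \<sigma> \<circ> \<rho>"
    have t: "\<tau> \<in> \<G>" and st: "\<sigma> \<circ> \<tau> = \<rho>" using s r inv_mem comp_mem by (auto simp: \<tau>_def)
    have "val (\<rho> ` N) (\<sigma> (b \<tau>)) = val (\<tau> ` N) (b \<tau>)"
      by (rule val_hom'[OF s]) (simp add: image_comp st)
    moreover have "radical_exp N \<tau> \<le> val (\<tau> ` N) (b \<tau>)"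
      using b t False by (auto simp: radical_lattice_def val_ge_def \<tau>_def)
    ultimately have "radical_exp N \<rho> \<le> val (\<rho> ` N) (a \<sigma> * \<sigma> (b \<tau>) * f \<sigma> \<tau>)"
      using a[OF s t] False f_nonzero[OF s t] s by (simp add: val_mult[OF P] st \<tau>_def[symmetric])
    then show ?thesis by (simp add: val_ge_def \<tau>_def)
  qed (use s r val_ge_zero[OF P] in auto)
  then show "val_ge (\<rho> ` N) (radical_exp N \<rho>) (mul a b \<rho>)"
    unfolding mul_def using r by (auto intro!: val_ge_sum[OF P])
qed simp

lemma left_order_closed:
  shows "left_order N \<subseteq> carrier A" "A0 \<subseteq> left_order N"
    "\<And>a b. a \<in> left_order N \<Longrightarrow> b \<in> left_order N \<Longrightarrow> mul a b \<in> left_order N"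
    "\<And>a b. a \<in> left_order N \<Longrightarrow> b \<in> left_order N \<Longrightarrow> (\<lambda>\<sigma>. a \<sigma> + b \<sigma>) \<in> left_order N"
proof -
  show "left_order N \<subseteq> carrier A" by (auto simp: left_order_def)
  show "A0 \<subseteq> left_order N"
  proof
    fix a assume a: "a \<in> A0"
    have "mul a b \<in> radical_lattice N" if b: "b \<in> radical_lattice N" for b
    proof (rule mul_radical_lattice[OF b])
      fix \<sigma> \<tau> assume st: "\<sigma> \<in> \<G>" "\<tau> \<in> \<G>" "a \<sigma> \<noteq> 0"
      have "0 \<le> val ((\<sigma> \<circ> \<tau>) ` N) (a \<sigma>)"
        using a st hom_max_ideal[OF comp_mem[OF st(1,2)]] by (intro val_S_nonneg) (auto simp: A0_iff)
      then show "radical_exp N (\<sigma> \<circ> \<tau>) \<le> val ((\<sigma> \<circ> \<tau>) ` N) (a \<sigma>) + radical_exp N \<tau> + val ((\<sigma> \<circ> \<tau>) ` N) (f \<sigma> \<tau>)"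
        using radical_exp_comp[OF N st(1,2)] by simp
    qed
    then show "a \<in> left_order N" using a by (auto simp: left_order_def A0_iff)
  qed
  fix a b assume ab: "a \<in> left_order N" "b \<in> left_order N"
  then show "mul a b \<in> left_order N" by (simp add: left_order_def mul_assoc)
  show "(\<lambda>\<sigma>. a \<sigma> + b \<sigma>) \<in> left_order N"
    using ab radical_lattice_add by (auto simp: left_order_def mul_add_left carrier_A)
qed

text \<open>The conductor of the left order contains \<open>p \<Prod> f(\<sigma>, \<tau>)\<close>: test on \<open>p x\<^sub>\<tau>\<close>, where \<open>\<tau> N = \<sigma>\<^sup>-\<^sup>1 P\<close>.\<close>

lemma left_order_bounded:
  "\<exists>q. q \<noteq> 0 \<and> (\<forall>\<sigma>\<in>\<G>. \<forall>c. single \<sigma> c \<in> left_order N \<longrightarrow> c * q \<in> S)"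
proof -
  define h where "h = (\<lambda>(\<sigma>, \<tau>). f \<sigma> \<tau>)"
  define q where "q = p * prod h (\<G> \<times> \<G>)"
  have "q \<noteq> 0" using f_nonzero by (auto simp: q_def h_def)
  moreover have "c * q \<in> S" if s: "\<sigma> \<in> \<G>" and c: "single \<sigma> c \<in> left_order N" for \<sigma> c
    unfolding mem_S_iff
  proof (intro allI impI)
    fix P assume P: "max_ideal P"
    have si: "finv \<sigma> \<in> \<G>" using s inv_mem by blast
    obtain \<tau> where t: "\<tau> \<in> \<G>" "\<tau> ` N = finv \<sigma> ` P"
      using max_ideal_transitive[OF N max_ideal_hom[OF si P]] by blast
    have "(\<sigma> \<circ> \<tau>) ` N = \<sigma> ` (\<tau> ` N)" by (rule image_comp[symmetric])
    then have stN: "(\<sigma> \<circ> \<tau>) ` N = P" using t(2) image_comp_inv(2)[OF s] by simp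
    have st: "\<sigma> \<circ> \<tau> \<in> \<G>" using comp_mem s t by blast
    have "single \<tau> p \<in> radical_lattice N"
      using t(1) hom_max_ideal[OF t(1)] radical_exp_range[of N \<tau>] by (auto simp: radical_lattice_def val_ge_def) (auto simp: single_def)
    then have "mul (single \<sigma> c) (single \<tau> p) \<in> radical_lattice N" using c by (auto simp: left_order_def)
    then have "single (\<sigma> \<circ> \<tau>) (c * p * f \<sigma> \<tau>) \<in> radical_lattice N" using s t by (simp add: mul_single_single)
    then have "val_ge P (radical_exp N (\<sigma> \<circ> \<tau>)) (c * p * f \<sigma> \<tau>)"
      using st stN unfolding radical_lattice_def by (auto dest!: bspec[of _ _ "\<sigma> \<circ> \<tau>"])
    then have ge: "val_ge P 0 (c * p * f \<sigma> \<tau>)" using radical_exp_range val_ge_mono[OF P] by blast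
    have "prod h (\<G> \<times> \<G>) = f \<sigma> \<tau> * prod h (\<G> \<times> \<G> - {(\<sigma>, \<tau>)})"
      using prod.remove[of "\<G> \<times> \<G>" "(\<sigma>, \<tau>)" h] s t by (simp add: h_def)
    then have eq: "c * q = (c * p * f \<sigma> \<tau>) * prod h (\<G> \<times> \<G> - {(\<sigma>, \<tau>)})" by (simp add: q_def algebra_simps)
    have "prod h (\<G> \<times> \<G> - {(\<sigma>, \<tau>)}) \<in> S" by (rule S.prod_mem) (auto simp: h_def intro: f_S)
    then have "val_ge P (0 + 0) ((c * p * f \<sigma> \<tau>) * prod h (\<G> \<times> \<G> - {(\<sigma>, \<tau>)}))"
      by (intro val_ge_mult[OF P ge] val_ge_S[OF P])
    then show "val_ge P 0 (c * q)" unfolding eq by simp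
  qed
  ultimately show ?thesis by blast
qed

text \<open>Homogeneous coefficients have the common denominator \<open>q\<close>, so each component
  is a submodule of the finitely generated module \<open>lin B'\<close>, the multiple of
  \<open>S\<close> by \<open>inverse q\<close>. \<open>noetherian\<close> applies to each component,
  and gradedness assembles them.\<close>

lemma is_order_left_order: "is_order V fractions A (left_order N)"
proof -
  note L = left_order_closed
  obtain B where B: "finite B" "S = lin B" using S_finitely_generated by metis
  obtain q where q: "q \<noteq> 0" "\<And>\<sigma> c. \<sigma> \<in> \<G> \<Longrightarrow> single \<sigma> c \<in> left_order N \<Longrightarrow> c * q \<in> S"
    using left_order_bounded by blast
  define B' where "B' = (\<lambda>b. inverse q * b) ` B"
  have fin: "finite B'" using B(1) by (simp add: B'_def)
  have "\<exists>C. finite C \<and> {c. single \<sigma> c \<in> left_order N} = lin C" if s: "\<sigma> \<in> \<G>" for \<sigma>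
  proof -
    let ?U = "{c. single \<sigma> c \<in> left_order N}"
    have "\<exists>C. finite C \<and> C \<subseteq> ?U \<and> ?U = lin C"
    proof (rule noetherian[OF fin])
      show "?U \<subseteq> lin B'"
      proof
        fix c assume "c \<in> ?U"
        then have "c * q \<in> lin B" using q(2) s B(2) by auto
        then have "inverse q * (c * q) \<in> lin B'"
          by (rule lin_mult_stable, intro lin_base[OF fin]) (auto simp: B'_def)
        then show "c \<in> lin B'" using q(1) by (simp add: field_simps)
      qed
      have "single \<sigma> 0 \<in> A0" using s by (intro single_A0) auto
      then show "0 \<in> ?U" using L(2) by auto
      show "x + y \<in> ?U" if "x \<in> ?U" "y \<in> ?U" for x y
      proof -
        have "(\<lambda>\<tau>. single \<sigma> x \<tau> + single \<sigma> y \<tau>) \<in> left_order N" using that L(4) by blast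
        moreover have "(\<lambda>\<tau>. single \<sigma> x \<tau> + single \<sigma> y \<tau>) = single \<sigma> (x + y)" by (auto simp: single_def)
        ultimately show ?thesis by simp
      qed
      show "a * x \<in> ?U" if "a \<in> V" "x \<in> ?U" for a x
      proof -
        have "single id a \<in> left_order N" using single_A0[of id a] that V_subset_S L(2) by auto
        then have "mul (single id a) (single \<sigma> x) \<in> left_order N" using that L(3) by blast
        then show ?thesis using s by (simp add: mul_single_single)
      qed
    qed
    then show ?thesis by blast
  qed
  then obtain C where C: "\<And>\<sigma>. \<sigma> \<in> \<G> \<Longrightarrow> finite (C \<sigma>) \<and> {c. single \<sigma> c \<in> left_order N} = lin (C \<sigma>)"
    by metis
  show ?thesis
  proof (rule is_orderI[OF L(2,1,3,4), where B = C])
    have "left_order N = {a \<in> carrier A. \<forall>\<sigma>\<in>\<G>. single \<sigma> (a \<sigma>) \<in> left_order N}"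
      by (rule overring_graded[OF L(2,1,3,4)])
    also have "\<dots> = {a \<in> carrier A. \<forall>\<sigma>\<in>\<G>. a \<sigma> \<in> lin (C \<sigma>)}" using C by blast
    finally show "left_order N = {a \<in> carrier A. \<forall>\<sigma>\<in>\<G>. a \<sigma> \<in> lin (C \<sigma>)}" .
  qed (use C in auto)
qed

text \<open>Were the inequality false for every admissible \<open>\<tau>\<close>, the slack of 1
  would absorb a simple pole at \<open>M\<close>. Then \<open>c x\<^sub>\<sigma>\<close> with such a
  pole would belong to the left order, which is the maximal order itself, although \<open>c\<close>
  is not integral.\<close>

lemma maximal_radical_exp:
  assumes max: "is_maximal_order V fractions A A0" and M: "max_ideal M" and s: "\<sigma> \<in> \<G>"
  obtains \<tau> where "\<tau> \<in> \<G>" "(\<sigma> \<circ> \<tau>) ` N = M" "radical_exp N \<tau> + val M (f \<sigma> \<tau>) \<le> radical_exp N (\<sigma> \<circ> \<tau>)"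
proof (rule ccontr)
  assume "\<not> thesis"
  then have neg: "radical_exp N (\<sigma> \<circ> \<tau>) + 1 \<le> radical_exp N \<tau> + val M (f \<sigma> \<tau>)"
    if "\<tau> \<in> \<G>" "(\<sigma> \<circ> \<tau>) ` N = M" for \<tau> using that \<open>\<not> thesis\<close> \<open>\<And>\<tau>. \<tau> \<in> \<G> \<Longrightarrow> (\<sigma> \<circ> \<tau>) ` N = M \<Longrightarrow> radical_exp N \<tau> + val M (f \<sigma> \<tau>) \<le> radical_exp N (\<sigma> \<circ> \<tau>) \<Longrightarrow> thesis\<close> by force
  obtain c where c: "c \<noteq> 0" "val M c = - 1" "\<And>P. max_ideal P \<Longrightarrow> P \<noteq> M \<Longrightarrow> 0 \<le> val P c"
    using exists_simple_pole[OF M] by blast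
  have "single \<sigma> c \<in> left_order N"
    unfolding left_order_def
  proof (intro CollectI conjI ballI)
    fix b assume b: "b \<in> radical_lattice N"
    show "mul (single \<sigma> c) b \<in> radical_lattice N"
    proof (rule mul_radical_lattice[OF b])
      fix \<sigma>' \<tau> assume st: "\<sigma>' \<in> \<G>" "\<tau> \<in> \<G>" "single \<sigma> c \<sigma>' \<noteq> 0"
      then have [simp]: "\<sigma>' = \<sigma>" by (auto simp: single_def split: if_splits)
      show "radical_exp N (\<sigma>' \<circ> \<tau>) \<le> val ((\<sigma>' \<circ> \<tau>) ` N) (single \<sigma> c \<sigma>') + radical_exp N \<tau> + val ((\<sigma>' \<circ> \<tau>) ` N) (f \<sigma>' \<tau>)"
      proof (cases "(\<sigma> \<circ> \<tau>) ` N = M")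
        case True
        then show ?thesis using neg[OF st(2)] c(2) by simp
      next
        case False
        then have "0 \<le> val ((\<sigma> \<circ> \<tau>) ` N) c" using c(3) hom_max_ideal comp_mem s st(2) by blast
        then show ?thesis using radical_exp_comp[OF N s st(2)] by simp
      qed
    qed
  qed (use s in simp)
  moreover have "left_order N = A0"
    using max is_order_left_order left_order_closed(2) unfolding is_maximal_order_def by blast
  ultimately have "c \<in> S" using s by (auto simp: A0_iff)
  then show False using val_S_nonneg[OF M _ c(1)] c(2) by simp
qed

end

text \<open>The relation \<open>v\<^sub>M(f(\<sigma>, \<sigma>\<^sup>-\<^sup>1\<rho>)) = 0\<close> is a preorder on \<open>\<G>\<close>; climb to an element \<open>\<sigma>'\<close> above \<open>\<sigma>\<close> that is
  maximal up to equivalence.\<close>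

lemma exists_maximal_above:
  assumes M: "max_ideal M" and s: "\<sigma> \<in> \<G>"
  obtains \<sigma>' where "\<sigma>' \<in> \<G>" "val M (f \<sigma> (finv \<sigma> \<circ> \<sigma>')) = 0"
    "\<And>\<tau>. \<tau> \<in> \<G> \<Longrightarrow> val M (f \<sigma>' \<tau>) = 0 \<Longrightarrow> val M (\<sigma>' (f \<tau> (finv \<tau>))) = 0"
proof -
  define up where "up \<sigma> = {\<rho> \<in> \<G>. val M (f \<sigma> (finv \<sigma> \<circ> \<rho>)) = 0}" for \<sigma>
  have refl: "\<sigma> \<in> up \<sigma>" if "\<sigma> \<in> \<G>" for \<sigma>
    using that val_one[OF M] by (simp add: up_def)
  have trans: "up \<rho> \<subseteq> up \<sigma>" if s: "\<sigma> \<in> \<G>" and r: "\<rho> \<in> up \<sigma>" for \<sigma> \<rho>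
  proof
    fix \<mu> assume m: "\<mu> \<in> up \<rho>"
    define \<tau> where "\<tau> = finv \<sigma> \<circ> \<rho>"
    define \<gamma> where "\<gamma> = finv \<rho> \<circ> \<mu>"
    have mem: "\<rho> \<in> \<G>" "\<mu> \<in> \<G>" using r m by (auto simp: up_def)
    then have tg: "\<tau> \<in> \<G>" "\<gamma> \<in> \<G>" using s inv_mem comp_mem by (auto simp: \<tau>_def \<gamma>_def)
    have "\<sigma> \<circ> \<tau> = \<rho>" using s by (simp add: \<tau>_def)
    moreover have "\<tau> \<circ> \<gamma> = finv \<sigma> \<circ> \<mu>" using mem by (simp add: \<tau>_def \<gamma>_def comp_assoc)
    ultimately have "val M (\<sigma> (f \<tau> \<gamma>)) + val M (f \<sigma> (finv \<sigma> \<circ> \<mu>)) = 0"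
      using val_cocycle[OF M s tg] r m by (simp add: up_def \<tau>_def \<gamma>_def)
    moreover have "0 \<le> val M (\<sigma> (f \<tau> \<gamma>))" by (rule val_hom_f_nonneg[OF M s tg])
    moreover have "0 \<le> val M (f \<sigma> (finv \<sigma> \<circ> \<mu>))"
      using val_f_nonneg[OF M s] inv_mem[OF s] mem comp_mem by blast
    ultimately show "\<mu> \<in> up \<sigma>" using mem by (simp add: up_def)
  qed
  have fin: "finite (up \<sigma>)" for \<sigma> by (simp add: up_def)
  \<comment> \<open>An element is maximal when its up-set has least cardinality: the up-set of
    anything above it is contained in its own, hence equal to it.\<close>
  obtain \<sigma>' where s': "\<sigma>' \<in> up \<sigma>" "\<And>\<rho>. \<rho> \<in> up \<sigma> \<Longrightarrow> card (up \<sigma>') \<le> card (up \<rho>)"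
    using ex_has_least_nat[of "\<lambda>\<rho>. \<rho> \<in> up \<sigma>" \<sigma> "\<lambda>\<rho>. card (up \<rho>)"] refl[OF s] by blast
  have s'G: "\<sigma>' \<in> \<G>" using s'(1) by (simp add: up_def)
  show ?thesis
  proof (rule that[OF s'G])
    show "val M (f \<sigma> (finv \<sigma> \<circ> \<sigma>')) = 0" using s'(1) by (simp add: up_def)
    fix \<tau> assume t: "\<tau> \<in> \<G>" "val M (f \<sigma>' \<tau>) = 0"
    define \<rho> where "\<rho> = \<sigma>' \<circ> \<tau>"
    have r: "\<rho> \<in> \<G>" and ti: "finv \<tau> \<in> \<G>" using comp_mem s'G t inv_mem by (auto simp: \<rho>_def)
    have up: "\<rho> \<in> up \<sigma>'" using r s'G t by (simp add: up_def) (simp add: \<rho>_def)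
    then have sub: "up \<rho> \<subseteq> up \<sigma>'" by (rule trans[OF s'G])
    have "\<rho> \<in> up \<sigma>" using up trans[OF s s'(1)] by blast
    then have "up \<rho> = up \<sigma>'" using s'(2) sub fin by (meson card_seteq)
    then have "\<sigma>' \<in> up \<rho>" using refl s'G by blast
    moreover have "finv \<rho> \<circ> \<sigma>' = finv \<tau>" using s'G t by (simp add: \<rho>_def inv_comp comp_assoc)
    ultimately have "val M (f \<rho> (finv \<tau>)) = 0" by (simp add: up_def)
    \<comment> \<open>Since \<open>\<rho>\<close> leads back to \<open>\<sigma>'\<close>, both terms
      on the right vanish.\<close>
    moreover have "val M (\<sigma>' (f \<tau> (finv \<tau>))) + val M (f \<sigma>' (\<tau> \<circ> finv \<tau>)) = val M (f \<sigma>' \<tau>) + val M (f (\<sigma>' \<circ> \<tau>) (finv \<tau>))"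
      by (rule val_cocycle[OF M s'G t(1) ti])
    ultimately show "val M (\<sigma>' (f \<tau> (finv \<tau>))) = 0"
      using t s'G val_one[OF M] by (simp add: \<rho>_def)
  qed
qed

text \<open>Test maximality at an element \<open>\<mu>\<close> that is maximal above
  \<open>\<sigma>\<close>. If \<open>f \<mu> \<tau>\<close> is a unit at \<open>M\<close>,
  maximality of \<open>\<mu>\<close> gives \<open>\<tau>\<close>, and with it
  \<open>\<rho> = \<mu> \<circ> \<tau>\<close>, exponent 1; if not, its valuation alone forces
  exponent 1 at \<open>\<rho>\<close>. So \<open>f \<rho> (finv \<rho>)\<close> is a unit at
  \<open>M\<close>. Two cocycle identities then carry the bound 1 from \<open>f \<mu> \<tau>\<close>
  to \<open>f \<mu> (finv \<mu>)\<close> and on to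
  \<open>f \<sigma> (finv \<sigma>)\<close>.\<close>

lemma maximal_imp_arrow:
  assumes max: "is_maximal_order V fractions A A0" and M: "max_ideal M" and N: "max_ideal N" and s: "\<sigma> \<in> \<G>"
  shows "val M (f \<sigma> (finv \<sigma>)) \<le> 1" "\<exists>\<rho>\<in>\<G>. \<rho> ` N = M \<and> val M (f \<rho> (finv \<rho>)) = 0"
proof -
  obtain \<mu> where m: "\<mu> \<in> \<G>" "val M (f \<sigma> (finv \<sigma> \<circ> \<mu>)) = 0"
    "\<And>\<tau>. \<tau> \<in> \<G> \<Longrightarrow> val M (f \<mu> \<tau>) = 0 \<Longrightarrow> val M (\<mu> (f \<tau> (finv \<tau>))) = 0"
    using exists_maximal_above[OF M s] by blast
  obtain \<tau> where t: "\<tau> \<in> \<G>" "(\<mu> \<circ> \<tau>) ` N = M" "radical_exp N \<tau> + val M (f \<mu> \<tau>) \<le> radical_exp N (\<mu> \<circ> \<tau>)"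
    using maximal_radical_exp[OF N max M m(1)] by blast
  define \<rho> where "\<rho> = \<mu> \<circ> \<tau>"
  have r: "\<rho> \<in> \<G>" and ri: "finv \<rho> \<in> \<G>" and mi: "finv \<mu> \<in> \<G>" and si: "finv \<sigma> \<in> \<G>"
    using m t s comp_mem inv_mem by (auto simp: \<rho>_def)
  have rN: "\<rho> ` N = M" using t by (simp add: \<rho>_def)
  have nn: "0 \<le> val M (f \<mu> \<tau>)" by (rule val_f_nonneg[OF M m(1) t(1)])
  have "radical_exp N \<rho> = 1"
  proof (cases "val M (f \<mu> \<tau>) = 0")
    case True
    have "val M (\<mu> (f \<tau> (finv \<tau>))) = val (\<tau> ` N) (f \<tau> (finv \<tau>))"
      by (rule val_hom'[OF m(1)]) (use t(2) in \<open>simp add: image_comp\<close>)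
    then have "radical_exp N \<tau> = 1" using m(3)[OF t(1) True] by (simp add: radical_exp_def)
    then show ?thesis using t(3) True radical_exp_range(2)[of N \<rho>] by (simp add: \<rho>_def)
  next
    case False
    then show ?thesis using t(3) nn radical_exp_range[of N \<tau>] radical_exp_range(2)[of N \<rho>] by (simp add: \<rho>_def)
  qed
  then have inv_r: "val M (f \<rho> (finv \<rho>)) = 0" using rN by (auto simp: radical_exp_def split: if_splits)
  then show "\<exists>\<rho>\<in>\<G>. \<rho> ` N = M \<and> val M (f \<rho> (finv \<rho>)) = 0" using r rN by blast
  have le: "val M (f \<mu> \<tau>) \<le> 1"
    using t(3) radical_exp_range(1)[of N \<tau>] radical_exp_range(2)[of N "\<mu> \<circ> \<tau>"] by linarith
  have "val M (\<mu> (f \<tau> (finv \<rho>))) + val M (f \<mu> (\<tau> \<circ> finv \<rho>)) = val M (f \<mu> \<tau>) + val M (f (\<mu> \<circ> \<tau>) (finv \<rho>))"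
    by (rule val_cocycle[OF M m(1) t(1) ri])
  moreover have "\<tau> \<circ> finv \<rho> = finv \<mu>" using m t by (simp add: \<rho>_def inv_comp comp_assoc[symmetric])
  moreover have "0 \<le> val M (\<mu> (f \<tau> (finv \<rho>)))" by (rule val_hom_f_nonneg[OF M m(1) t(1) ri])
  ultimately have m1: "val M (f \<mu> (finv \<mu>)) \<le> 1" using le inv_r by (simp add: \<rho>_def)
  define \<nu> where "\<nu> = finv \<sigma> \<circ> \<mu>"
  have n: "\<nu> \<in> \<G>" using si m comp_mem by (auto simp: \<nu>_def)
  have "val M (\<sigma> (f \<nu> (finv \<mu>))) + val M (f \<sigma> (\<nu> \<circ> finv \<mu>)) = val M (f \<sigma> \<nu>) + val M (f (\<sigma> \<circ> \<nu>) (finv \<mu>))"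
    by (rule val_cocycle[OF M s n mi])
  moreover have "\<nu> \<circ> finv \<mu> = finv \<sigma>" "\<sigma> \<circ> \<nu> = \<mu>" using m s by (simp_all add: \<nu>_def)
  moreover have "0 \<le> val M (\<sigma> (f \<nu> (finv \<mu>)))" by (rule val_hom_f_nonneg[OF M s n mi])
  ultimately show "val M (f \<sigma> (finv \<sigma>)) \<le> 1" using m1 m(2) by (simp add: \<nu>_def)
qed

theorem maximal_iff:
  "is_maximal_order V fractions A A0 \<longleftrightarrow>
    (\<forall>M. max_ideal M \<longrightarrow> (\<forall>\<tau>\<in>\<G>. val M (f \<tau> (finv \<tau>)) \<le> 1) \<and>
      (\<forall>\<sigma>\<in>\<G>. \<exists>g\<in>\<G>. \<exists>\<delta>\<in>\<G>. \<delta> ` M = M \<and> \<sigma> = \<delta> \<circ> g \<and> val M (f g (finv g)) = 0))"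
    (is "_ \<longleftrightarrow> ?rhs")
proof
  assume ?rhs
  then show "is_maximal_order V fractions A A0" by (intro maximal_if) blast+
next
  assume max: "is_maximal_order V fractions A A0"
  show ?rhs
  proof (intro allI impI conjI ballI)
    fix M assume M: "max_ideal M"
    show "val M (f \<tau> (finv \<tau>)) \<le> 1" if "\<tau> \<in> \<G>" for \<tau>
      by (rule maximal_imp_arrow(1)[OF max M M that])
    fix \<sigma> assume s: "\<sigma> \<in> \<G>"
    have si: "finv \<sigma> \<in> \<G>" using s inv_mem by blast
    \<comment> \<open>Taking the preimage of \<open>M\<close> under \<open>\<sigma>\<close> as the
      source places \<open>g\<close> in the coset of \<open>\<sigma>\<close>: both carry this ideal
      to \<open>M\<close>.\<close>
    obtain g where g: "g \<in> \<G>" "g ` (finv \<sigma> ` M) = M" "val M (f g (finv g)) = 0"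
      using maximal_imp_arrow(2)[OF max M max_ideal_hom[OF si M] s] by blast
    have gi: "finv g \<in> \<G>" using g inv_mem by blast
    have "finv g ` M = finv \<sigma> ` M" using g(1,2) image_comp_inv(1)[OF g(1), of "finv \<sigma> ` M"] by simp
    moreover have "(\<sigma> \<circ> finv g) ` M = \<sigma> ` (finv g ` M)" by (rule image_comp[symmetric])
    ultimately have "(\<sigma> \<circ> finv g) ` M = M" using image_comp_inv(2)[OF s] by simp
    moreover have "\<sigma> = (\<sigma> \<circ> finv g) \<circ> g" using g(1) by simp
    ultimately show "\<exists>g\<in>\<G>. \<exists>\<delta>\<in>\<G>. \<delta> ` M = M \<and> \<sigma> = \<delta> \<circ> g \<and> val M (f g (finv g)) = 0"
      using g comp_mem[OF s gi] by blast
  qed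
qed

end

section \<open>Uniformizers, automorphism groups and residue fields\<close>

text \<open>\<open>p\<close> generates the unique maximal ideal. Every nonzero non-unit has an
  irreducible divisor, which generates a maximal ideal and hence the same one, so it is a multiple
  of \<open>p\<close>. Splitting off \<open>p\<close> terminates because proper divisibility is
  well-founded.\<close>

lemma discrete_valuation_ring_uniformizer:
  fixes V :: "'k::field set"
  assumes "discrete_valuation_ring (ring_on V)"
  obtains p where "dvr_subring V p" "jacobson_radical (ring_on V) = {x * p | x. x \<in> V}"
proof -
  interpret R: principal_domain "ring_on V"
    using assms by (simp add: discrete_valuation_ring_def)
  interpret V: field_subring V by (rule field_subring_if_ring[OF R.ring_axioms])
  obtain M where M: "maximalideal M (ring_on V)" "\<And>M'. maximalideal M' (ring_on V) \<Longrightarrow> M' = M"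
    using assms unfolding discrete_valuation_ring_def by blast
  have "ideal M (ring_on V)" using M(1) by (simp add: maximalideal_def)
  then obtain p where p: "p \<in> V" "M = PIdl\<^bsub>ring_on V\<^esub> p" using R.exists_gen by auto
  have Mp: "M = {x * p | x. x \<in> V}" unfolding p(2) by (simp add: cgenideal_def)
  have "{N. maximalideal N (ring_on V)} = {M}" using M by blast
  then have "jacobson_radical (ring_on V) = V \<inter> M" by (simp add: jacobson_radical_def)
  moreover have "M \<subseteq> V" using M(1) unfolding V.maximalideal_ring_on_iff by (rule conjunct1)
  ultimately have "jacobson_radical (ring_on V) = M" by blast
  then have jac: "jacobson_radical (ring_on V) = {x * p | x. x \<in> V}" unfolding Mp .
  have one: "1 \<notin> M" using M(1) V.maximalideal_ring_on_iff by blast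
  \<comment> \<open>A zero generator would make the zero ideal maximal, that is, \<open>V\<close> a
    field.\<close>
  have p0: "p \<noteq> 0"
  proof
    assume "p = 0"
    then have "M = {\<zero>\<^bsub>ring_on V\<^esub>}" unfolding Mp by (auto intro: exI[of _ 0])
    then have "field (ring_on V)" using M(1) R.zeromaximalideal_eq_field by metis
    then show False using assms by (simp add: discrete_valuation_ring_def)
  qed
  have nonunit: "\<exists>y\<in>V. x = y * p" if x: "x \<in> V" "inverse x \<notin> V" for x
  proof (cases "x = 0")
    case False
    have "x \<notin> Units (ring_on V)"
    proof
      assume "x \<in> Units (ring_on V)"
      then obtain y where "y \<in> V" "y * x = 1" by (auto simp: Units_def)
      then have "inverse x = y" by (metis inverse_unique mult.commute)
      then show False using x \<open>y \<in> V\<close> by simp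
    qed
    moreover have "x \<in> carrier (ring_on V) - {\<zero>\<^bsub>ring_on V\<^esub>}" using x False by simp
    ultimately obtain q where q: "q \<in> carrier (ring_on V)" "ring_irreducible\<^bsub>ring_on V\<^esub> q" "q divides\<^bsub>ring_on V\<^esub> x"
      by (metis R.exists_irreducible_divisor)
    then have "PIdl\<^bsub>ring_on V\<^esub> q = M" using M(2) R.irreducible_imp_maximalideal by blast
    moreover have "q \<in> PIdl\<^bsub>ring_on V\<^esub> q" using q(1) R.cgenideal_self by blast
    ultimately obtain y where y: "y \<in> V" "q = y * p" unfolding Mp by auto
    obtain z where z: "z \<in> V" "x = q * z" using q(3) by (auto simp: factor_def)
    then have "x = (y * z) * p" using y by (simp add: algebra_simps)
    then show ?thesis using y z V.mult_mem by blast
  qed (auto intro!: bexI[of _ 0])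
  have fact: "\<exists>u n. u \<in> V \<and> inverse u \<in> V \<and> x = u * p ^ n" if x: "x \<in> V" "x \<noteq> 0" for x
    using R.mult_of.division_wellfounded x
  proof (induction x rule: wf_induct_rule)
    case (less x)
    show ?case
    proof (cases "inverse x \<in> V")
      case True
      then show ?thesis using less.prems by (intro exI[of _ x] exI[of _ 0]) auto
    next
      case False
      then obtain y where y: "y \<in> V" "x = y * p" using nonunit less.prems by blast
      have "x \<noteq> 0" "y \<noteq> 0" using less.prems y by auto
      have "\<not> (\<exists>c\<in>V. y = x * c)"
      proof
        assume "\<exists>c\<in>V. y = x * c"
        then obtain c where c: "c \<in> V" "y = x * c" by blast
        have "x * 1 = x * (c * p)" using y(2) unfolding c(2) by (simp only: mult.assoc mult_1_right)
        then have "1 = c * p" using \<open>x \<noteq> 0\<close> by (metis mult_cancel_left)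
        then show False using one c unfolding Mp by blast
      qed
      then have "properfactor (mult_of (ring_on V)) y x"
        using y p(1) p0 by (auto simp: properfactor_def factor_def)
      then have "\<exists>u n. u \<in> V \<and> inverse u \<in> V \<and> y = u * p ^ n"
        using less.IH[of y] less.prems y \<open>y \<noteq> 0\<close> by simp
      then obtain u n where u: "u \<in> V" "inverse u \<in> V" "y = u * p ^ n" by blast
      have "x = u * p ^ Suc n" unfolding y(2) u(3) by (simp add: mult_ac)
      then show ?thesis using u(1,2) by blast
    qed
  qed
  have "inverse p \<notin> V"
  proof
    assume "inverse p \<in> V"
    moreover have "1 = inverse p * p" using p0 by simp
    ultimately have "1 \<in> M" unfolding Mp by blast
    then show False using one by simp
  qed
  then have "dvr_subring V p"
    by unfold_locales (use p(1) p0 fact in auto)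
  then show ?thesis using that jac by blast
qed

section \<open>The Galois group as a finite set of automorphisms\<close>

definition galois_auts :: "'k::field set \<Rightarrow> ('k \<Rightarrow> 'k) set" where
  "galois_auts F = carrier (galois_group F)"

lemma galois_auts_iff:
  "\<sigma> \<in> galois_auts F \<longleftrightarrow> bij \<sigma> \<and> (\<forall>x y. \<sigma> (x + y) = \<sigma> x + \<sigma> y) \<and> (\<forall>x y. \<sigma> (x * y) = \<sigma> x * \<sigma> y) \<and>
     \<sigma> 1 = 1 \<and> (\<forall>x\<in>F. \<sigma> x = x)"
  by (auto simp: galois_auts_def galois_group_def ring_iso_def Ring.ring_hom_def)

lemma galois_auts_eval:
  assumes "\<sigma> \<in> galois_auts (F :: 'k::field set)" "set q \<subseteq> F"
  shows "\<sigma> (ring.eval ring_of_type_algebra q x) = ring.eval ring_of_type_algebra q (\<sigma> x)"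
proof -
  interpret L: field "ring_of_type_algebra :: 'k ring" by (rule field_from_type_algebra)
  note s = assms(1)[unfolded galois_auts_iff]
  have zero: "\<sigma> 0 = 0" using s by (metis add.right_neutral add_left_cancel)
  have pow: "\<sigma> (x [^]\<^bsub>ring_of_type_algebra\<^esub> n) = \<sigma> x [^]\<^bsub>ring_of_type_algebra\<^esub> n" for n :: nat
    by (induction n) (use s in auto)
  show ?thesis using assms(2)
  proof (induction q)
    case (Cons a q)
    then show ?case using s pow by (simp add: L.eval.simps)
  qed (simp add: L.eval.simps zero)
qed

lemma galois_auts_combine:
  assumes "\<sigma> \<in> galois_auts (F :: 'k::field set)" "set ks \<subseteq> F"
  shows "\<sigma> (ring.combine ring_of_type_algebra ks us) = ring.combine ring_of_type_algebra ks (map \<sigma> us)"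
proof -
  interpret L: field "ring_of_type_algebra :: 'k ring" by (rule field_from_type_algebra)
  note s = assms(1)[unfolded galois_auts_iff]
  have zero: "\<sigma> 0 = 0" using s by (metis add.right_neutral add_left_cancel)
  show ?thesis using assms(2)
    by (induction ks us rule: L.combine.induct) (use s zero in \<open>auto simp: L.combine.simps\<close>)
qed

text \<open>An automorphism is determined by the images of a basis, and those are roots of fixed polynomials.\<close>

lemma finite_galois_auts:
  assumes "finite_galois (F :: 'k::field set)"
  shows "finite (galois_auts F)"
proof -
  interpret L: field "ring_of_type_algebra :: 'k ring" by (rule field_from_type_algebra)
  have F: "subfield F (ring_of_type_algebra :: 'k ring)" "L.finite_dimension F UNIV"
    using assms by (auto simp: finite_galois_def)
  have U: "subring UNIV (ring_of_type_algebra :: 'k ring)" using L.carrier_is_subring by simp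
  obtain n where "L.dimension n F UNIV" using F(2) by (auto simp: L.finite_dimension_def)
  then obtain us where us: "L.Span F us = UNIV" using L.exists_base[OF F(1)] by blast
  have "\<exists>q. set q \<subseteq> F \<and> finite {y. L.eval q y = 0} \<and> L.eval q x = 0" for x
  proof -
    have "(L.algebraic over F) x"
      by (rule L.finite_dimension_imp_algebraic[OF F(1) U F(2)]) simp
    then obtain q where q: "q \<in> carrier (F[X]\<^bsub>ring_of_type_algebra\<^esub>)" "q \<noteq> []" "L.eval q x = 0"
      using L.algebraicE[OF subfieldE(1)[OF F(1)]] by auto
    then have "polynomial\<^bsub>ring_of_type_algebra\<^esub> F q" by (simp add: univ_poly_carrier[symmetric])
    then have "set q \<subseteq> F" "polynomial\<^bsub>ring_of_type_algebra\<^esub> UNIV q"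
      by (auto simp: polynomial_def)
    then have "finite {y. L.is_root q y}"
      using L.finite_number_of_roots by (simp add: univ_poly_carrier)
    then have "finite {y. L.eval q y = 0}" using q(2) by (simp add: L.is_root_def)
    then show ?thesis using \<open>set q \<subseteq> F\<close> q(3) by blast
  qed
  then obtain q where q: "\<And>x. set (q x) \<subseteq> F" "\<And>x. finite {y. L.eval (q x) y = 0}" "\<And>x. L.eval (q x) x = 0"
    by metis
  define h where "h = (\<lambda>\<sigma> :: 'k \<Rightarrow> 'k. restrict \<sigma> (set us))"
  have "h ` galois_auts F \<subseteq> (\<Pi>\<^sub>E u\<in>set us. {y. L.eval (q u) y = 0})"
  proof
    fix g assume "g \<in> h ` galois_auts F"
    then obtain \<sigma> where s: "\<sigma> \<in> galois_auts F" "g = restrict \<sigma> (set us)" by (auto simp: h_def)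
    have "L.eval (q u) (\<sigma> u) = 0" for u
    proof -
      have "L.eval (q u) (\<sigma> u) = \<sigma> (L.eval (q u) u)" by (rule galois_auts_eval[OF s(1) q(1), symmetric])
      also have "\<dots> = 0" using q(3) s(1)[unfolded galois_auts_iff] by (metis add.right_neutral add_left_cancel)
      finally show ?thesis .
    qed
    then show "g \<in> (\<Pi>\<^sub>E u\<in>set us. {y. L.eval (q u) y = 0})" using s(2) by auto
  qed
  moreover have "finite (\<Pi>\<^sub>E u\<in>set us. {y. L.eval (q u) y = 0})"
    by (rule finite_PiE) (use q(2) in auto)
  ultimately have "finite (h ` galois_auts F)" by (rule finite_subset)
  moreover have "inj_on h (galois_auts F)"
  proof (rule inj_onI)
    fix \<sigma> \<tau> assume st: "\<sigma> \<in> galois_auts F" "\<tau> \<in> galois_auts F" "h \<sigma> = h \<tau>"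
    have "\<sigma> u = \<tau> u" if "u \<in> set us" for u
      using fun_cong[OF st(3), of u] that by (simp add: h_def)
    then have eq: "map \<sigma> us = map \<tau> us" by simp
    show "\<sigma> = \<tau>"
    proof
      fix x
      have "x \<in> L.Span F us" using us by simp
      then obtain ks where ks: "set ks \<subseteq> F" "x = L.combine ks us"
        using L.Span_eq_combine_set[OF F(1), of us] by auto
      then show "\<sigma> x = \<tau> x" using galois_auts_combine st(1,2) eq by metis
    qed
  qed
  ultimately show ?thesis by (rule finite_imageD)
qed

lemma galois_setting_galois_auts:
  assumes "dvr_subring V p" "is_quotient_field V F" "finite_galois F"
  shows "galois_setting V p (galois_auts F)"
proof -
  interpret dvr_subring V p by (rule assms(1))
  show ?thesis
  proof
    show "finite (galois_auts F)" by (rule finite_galois_auts[OF assms(3)])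
    show "id \<in> galois_auts F" by (auto simp: galois_auts_iff)
    fix \<sigma> assume s: "\<sigma> \<in> galois_auts F"
    note s' = s[unfolded galois_auts_iff]
    then have b: "bij \<sigma>" by blast
    then have inv: "\<sigma> (finv \<sigma> x) = x" "finv \<sigma> (\<sigma> x) = x" for x
      by (simp_all add: bij_is_surj surj_f_inv_f bij_is_inj)
    show "bij \<sigma>" by (rule b)
    show "\<sigma> \<circ> \<tau> \<in> galois_auts F" if "\<tau> \<in> galois_auts F" for \<tau>
      using s that by (auto simp: galois_auts_iff bij_comp)
    show "\<sigma> (x + y) = \<sigma> x + \<sigma> y" "\<sigma> (x * y) = \<sigma> x * \<sigma> y" for x y using s' by auto
    have "finv \<sigma> (x + y) = finv \<sigma> x + finv \<sigma> y" "finv \<sigma> (x * y) = finv \<sigma> x * finv \<sigma> y" for x y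
      using s' inv by metis+
    moreover have "finv \<sigma> 1 = 1" "\<forall>x\<in>F. finv \<sigma> x = x" using s' inv by metis+
    ultimately show "finv \<sigma> \<in> galois_auts F"
      using bij_imp_bij_inv[OF b] by (auto simp: galois_auts_iff)
  next
    have "{x. \<forall>\<sigma>\<in>galois_auts F. \<sigma> x = x} = F"
      using assms(3) by (simp add: finite_galois_def galois_auts_def)
    also have "F = fractions" using assms(2) by (simp add: is_quotient_field_def fractions_def)
    finally show "{x. \<forall>\<sigma>\<in>galois_auts F. \<sigma> x = x} = fractions" .
  qed
qed

section \<open>Separable residue extensions\<close>

context galois_setting
begin

lemma V_unit_if_notin_max_ideal:
  assumes "max_ideal M" "p \<in> M" "v \<in> V" "v \<notin> M"
  shows "inverse v \<in> V"
proof -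
  have "v \<noteq> 0" using assms(4) max_ideal_zero[OF assms(1)] by auto
  then obtain u n where u: "u \<in> V" "inverse u \<in> V" "v = u * p ^ n"
    using factorization[OF assms(3)] by blast
  have "n = 0"
  proof (rule ccontr)
    assume "n \<noteq> 0"
    then obtain m where "n = Suc m" by (cases n) auto
    then have "v = (u * p ^ m) * p" using u by (simp add: algebra_simps)
    moreover have "u * p ^ m \<in> S" using u p_mem by (intro V_subset_S mult_mem power_mem)
    ultimately show False using max_ideal_mult[OF assms(1) _ assms(2)] assms(4) by metis
  qed
  then show ?thesis using u by simp
qed

text \<open>The minimal polynomial \<open>m\<close> of a residue class satisfies \<open>u m + v m' = 1\<close>, so \<open>m'\<close> does not vanish at
  that class; lift its coefficients from the residue field to \<open>V\<close>.\<close>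

lemma separable_extension_lift:
  assumes M: "max_ideal M" and pM: "p \<in> M" and x: "x \<in> S"
    and sep: "ring.separable_extension (ring_on S Quot M) ((\<lambda>v. M +>\<^bsub>ring_on S\<^esub> v) ` V)"
  shows "\<exists>P. (\<forall>i. poly.coeff P i \<in> V) \<and> poly P x \<in> M \<and> poly (pderiv P) x \<notin> M"
proof -
  define R where "R = ring_on S"
  define Q where "Q = R Quot M"
  define \<phi> where "\<phi> = (\<lambda>v. M +>\<^bsub>R\<^esub> v)"
  define k where "k = \<phi> ` V"
  have max: "maximalideal M R" using M by (simp add: max_ideal_def R_def)
  interpret R: domain R unfolding R_def by (rule S.domain_ring_on)
  interpret I: maximalideal M R by (rule max)
  interpret Q: field Q
    unfolding Q_def by (rule I.quotient_is_field[OF R.cring_axioms])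
  have R: "carrier R = S" "\<And>a b. a \<otimes>\<^bsub>R\<^esub> b = a * b" "\<And>a b. a \<oplus>\<^bsub>R\<^esub> b = a + b" "\<one>\<^bsub>R\<^esub> = 1" "\<zero>\<^bsub>R\<^esub> = 0"
    by (simp_all add: R_def)
  have hom: "\<phi> \<in> Ring.ring_hom R Q" using I.rcos_ring_hom by (simp add: \<phi>_def Q_def)
  have phi_carrier: "\<phi> s \<in> carrier Q" if "s \<in> S" for s using ring_hom_closed[OF hom] that R by simp
  have phi_mult: "\<phi> (s * t) = \<phi> s \<otimes>\<^bsub>Q\<^esub> \<phi> t" if "s \<in> S" "t \<in> S" for s t
    using ring_hom_mult[OF hom, of s t] that R by simp
  have phi_add: "\<phi> (s + t) = \<phi> s \<oplus>\<^bsub>Q\<^esub> \<phi> t" if "s \<in> S" "t \<in> S" for s t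
    using ring_hom_add[OF hom, of s t] that R by simp
  have phi_one: "\<phi> 1 = \<one>\<^bsub>Q\<^esub>" using ring_hom_one[OF hom] R by simp
  have zeroQ: "\<zero>\<^bsub>Q\<^esub> = M" by (simp add: Q_def FactRing_def)
  have phi_zero_iff: "\<phi> s = \<zero>\<^bsub>Q\<^esub> \<longleftrightarrow> s \<in> M" if "s \<in> S" for s
    unfolding zeroQ \<phi>_def using I.a_rcos_const[of s] I.a_rcos_self[of s] that R by auto
  have phi_zero: "\<phi> 0 = \<zero>\<^bsub>Q\<^esub>" using phi_zero_iff[of 0] max_ideal_zero[OF M] by simp
  have phi_uminus: "\<ominus>\<^bsub>Q\<^esub> \<phi> s = \<phi> (- s)" if "s \<in> S" for s
    using phi_add[of "- s" s] that S.uminus_mem phi_zero phi_carrier by (intro Q.minus_equality) auto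
  have phi_pow: "\<phi> s [^]\<^bsub>Q\<^esub> n = \<phi> (s ^ n)" if "s \<in> S" for s and n :: nat
  proof (induction n)
    case (Suc n)
    then show ?case using phi_mult[of "s ^ n" s] that S.power_mem by (simp add: mult.commute)
  qed (simp add: phi_one)
  have phi_add_pow: "add_pow Q n (\<phi> s) = \<phi> (of_nat n * s)" if "s \<in> S" for s and n :: nat
  proof (induction n)
    case 0
    then show ?case by (simp add: phi_zero)
  next
    case (Suc n)
    then show ?case using phi_add[of "of_nat n * s" s] that S.mult_mem[OF S.of_nat_mem that] phi_carrier
      by (simp add: distrib_right add.commute)
  qed
  have sub: "subring k Q"
  proof (rule Q.subringI)
    show "k \<subseteq> carrier Q" using phi_carrier V_subset_S by (auto simp: k_def)
    show "\<one>\<^bsub>Q\<^esub> \<in> k" using phi_one[symmetric] by (auto simp: k_def)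
    fix a assume "a \<in> k"
    then obtain v where v: "v \<in> V" "a = \<phi> v" by (auto simp: k_def)
    then show "\<ominus>\<^bsub>Q\<^esub> a \<in> k" using phi_uminus V_subset_S uminus_mem by (auto simp: k_def)
    fix b assume "b \<in> k"
    then obtain w where w: "w \<in> V" "b = \<phi> w" by (auto simp: k_def)
    have "a \<otimes>\<^bsub>Q\<^esub> b = \<phi> (v * w)" "a \<oplus>\<^bsub>Q\<^esub> b = \<phi> (v + w)"
      using phi_mult phi_add v w V_subset_S by simp_all
    then show "a \<otimes>\<^bsub>Q\<^esub> b \<in> k" "a \<oplus>\<^bsub>Q\<^esub> b \<in> k" using v w mult_mem add_mem by (auto simp: k_def)
  qed
  have subf: "subfield k Q"
  proof (rule Q.subfieldI'[OF sub])
    fix a assume a: "a \<in> k - {\<zero>\<^bsub>Q\<^esub>}"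
    then obtain v where v: "v \<in> V" "a = \<phi> v" "v \<notin> M" using phi_zero_iff V_subset_S by (auto simp: k_def)
    then have inv: "inverse v \<in> V" using V_unit_if_notin_max_ideal[OF M pM] by blast
    have "v \<noteq> 0" using v max_ideal_zero[OF M] by auto
    then have "a \<otimes>\<^bsub>Q\<^esub> \<phi> (inverse v) = \<one>\<^bsub>Q\<^esub>"
      using phi_mult[of v "inverse v"] v inv V_subset_S phi_one by simp
    then have "inv\<^bsub>Q\<^esub> a = \<phi> (inverse v)"
      using Q.comm_inv_char[of a "\<phi> (inverse v)"] phi_carrier v inv V_subset_S by simp
    then show "inv\<^bsub>Q\<^esub> a \<in> k" using inv by (simp add: k_def)
  qed
  define y where "y = \<phi> x"
  have y: "y \<in> carrier Q" using phi_carrier x by (simp add: y_def)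
  have "Q.separable_extension k" using sep by (simp add: Q_def R_def k_def \<phi>_def)
  then have alg: "(Q.algebraic over k) y" and sp: "Q.separable_poly k (Q.Irr k y)"
    using y by (simp_all add: Q.separable_extension_def over_def)
  define m where "m = Q.Irr k y"
  have m: "m \<in> carrier (k[X]\<^bsub>Q\<^esub>)" "Q.eval m y = \<zero>\<^bsub>Q\<^esub>"
    using Q.IrrE(1,4)[OF subf y alg] by (simp_all add: m_def)
  then have "polynomial\<^bsub>Q\<^esub> k m" by (simp add: univ_poly_carrier)
  then have "set m \<subseteq> k" by (auto simp: polynomial_def)
  then have "\<exists>q. set q \<subseteq> V \<and> m = map \<phi> q"
  proof (induction m)
    case (Cons a m)
    then obtain q v where "set q \<subseteq> V" "m = map \<phi> q" "v \<in> V" "a = \<phi> v" by (auto simp: k_def)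
    then show ?case by (intro exI[of _ "v # q"]) auto
  qed simp
  then obtain q where q: "set q \<subseteq> V" "m = map \<phi> q" by blast
  \<comment> \<open>The list \<open>q\<close> starts with the leading coefficient, whereas
    \<open>Poly\<close> expects the constant term first.\<close>
  define P where "P = Poly (rev q)"
  have eval_map: "Q.eval (map \<phi> l) y = \<phi> (poly (Poly (rev l)) x)" if "set l \<subseteq> S" for l
    using that
  proof (induction l)
    case (Cons a l)
    have "poly (Poly (rev l)) x \<in> S"
      by (rule S.poly_mem[OF S.coeff_Poly_mem x]) (use Cons.prems in auto)
    moreover have "a * x ^ length l \<in> S" using Cons.prems x by (auto intro: S.mult_mem S.power_mem)
    ultimately have "\<phi> (a * x ^ length l + poly (Poly (rev l)) x) = Q.eval (map \<phi> (a # l)) y"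
      using Cons x phi_add phi_mult[of a "x ^ length l"] phi_pow[OF x] S.power_mem
      by (simp add: y_def Q.eval.simps)
    then show ?case by (simp add: Poly_snoc poly_monom add.commute)
  qed (simp add: Q.eval.simps phi_zero)
  have coeff_map: "Q.coeff (map \<phi> l) i = \<phi> (poly.coeff (Poly (rev l)) i)" for l i
  proof (induction l)
    case (Cons a l)
    show ?case
    proof (cases "i = length l")
      case True
      then show ?thesis by (simp add: Q.coeff.simps Poly_snoc coeff_Poly_eq nth_default_def)
    next
      case False
      then show ?thesis using Cons by (simp add: Q.coeff.simps Poly_snoc)
    qed
  qed (simp add: Q.coeff.simps phi_zero)
  \<comment> \<open>The derivative of the lift in list form. Its leading entries may vanish modulo
    \<open>M\<close>, for instance when the residue characteristic divides the degree, so
    \<open>normalize\<close> enters only after reduction.\<close>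
  define dq where "dq = map (\<lambda>i. of_nat (Suc i) * poly.coeff P (Suc i)) (rev [0..<length q - 1])"
  have PV: "poly.coeff P i \<in> V" for i unfolding P_def by (rule coeff_Poly_mem) (use q(1) in simp)
  have PS: "poly.coeff P i \<in> S" for i using PV V_subset_S by blast
  have dqV: "set dq \<subseteq> V"
    using PV of_nat_mem[of "Suc _"] by (auto simp: dq_def intro!: mult_mem add_mem of_nat_mem)
  have "map (\<lambda>i. add_pow Q (Suc i) (Q.coeff m (Suc i))) (rev [0..<length m - 1]) = map \<phi> dq"
    unfolding q(2) coeff_map P_def[symmetric] using phi_add_pow[OF PS] by (simp add: dq_def del: of_nat_Suc)
  then have dm: "Q.formal_derivative m = Q.normalize (map \<phi> dq)"
    by (simp add: Q.formal_derivative_def)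
  have dmk: "set (map \<phi> dq) \<subseteq> k" using dqV by (auto simp: k_def)
  have dm_carrier: "Q.formal_derivative m \<in> carrier (k[X]\<^bsub>Q\<^esub>)"
    unfolding dm using Q.normalize_gives_polynomial[OF dmk] by (simp add: univ_poly_carrier)
  have dP: "Poly (rev dq) = pderiv P"
  proof (rule poly_eqI)
    fix i
    have "poly.coeff P (Suc i) = 0" if "\<not> i < length q - 1"
      using that by (auto simp: P_def coeff_Poly_eq nth_default_def)
    then show "poly.coeff (Poly (rev dq)) i = poly.coeff (pderiv P) i"
      by (auto simp: dq_def rev_map coeff_Poly_eq nth_default_def coeff_pderiv)
  qed
  have "set (map \<phi> dq) \<subseteq> carrier Q" using dmk subringE(1)[OF sub] by blast
  then have "Q.eval (Q.formal_derivative m) y = Q.eval (map \<phi> dq) y"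
    unfolding dm by (rule Q.eval_normalize) (rule y)
  also have "\<dots> = \<phi> (poly (pderiv P) x)"
    using eval_map[of dq] dqV V_subset_S dP by auto
  finally have ev_d: "Q.eval (Q.formal_derivative m) y = \<phi> (poly (pderiv P) x)" .
  have ev: "\<phi> (poly P x) = \<zero>\<^bsub>Q\<^esub>" using m(2) eval_map[of q] q V_subset_S by (auto simp: P_def)
  have PxS: "poly P x \<in> S" and dPxS: "poly (pderiv P) x \<in> S"
    using PS x by (auto intro!: S.poly_mem S.mult_mem S.add_mem S.of_nat_mem simp: coeff_pderiv)
  obtain u v where uv: "u \<in> carrier (k[X]\<^bsub>Q\<^esub>)" "v \<in> carrier (k[X]\<^bsub>Q\<^esub>)"
    "(u \<otimes>\<^bsub>k[X]\<^bsub>Q\<^esub>\<^esub> m) \<oplus>\<^bsub>k[X]\<^bsub>Q\<^esub>\<^esub> (v \<otimes>\<^bsub>k[X]\<^bsub>Q\<^esub>\<^esub> Q.formal_derivative m) = \<one>\<^bsub>k[X]\<^bsub>Q\<^esub>\<^esub>"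
    using sp unfolding Q.separable_poly_def m_def by blast
  interpret K: domain "k[X]\<^bsub>Q\<^esub>" by (rule Q.univ_poly_is_domain[OF sub])
  note eh = Q.eval_is_hom[OF sub y]
  have "poly (pderiv P) x \<notin> M"
  proof
    assume "poly (pderiv P) x \<in> M"
    then have d0: "Q.eval (Q.formal_derivative m) y = \<zero>\<^bsub>Q\<^esub>" using ev_d phi_zero_iff[OF dPxS] by simp
    have c: "Q.eval u y \<in> carrier Q" "Q.eval v y \<in> carrier Q"
      using ring_hom_closed[OF eh] uv by auto
    have "\<one>\<^bsub>Q\<^esub> = Q.eval ((u \<otimes>\<^bsub>k[X]\<^bsub>Q\<^esub>\<^esub> m) \<oplus>\<^bsub>k[X]\<^bsub>Q\<^esub>\<^esub> (v \<otimes>\<^bsub>k[X]\<^bsub>Q\<^esub>\<^esub> Q.formal_derivative m)) y"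
      unfolding uv(3) using ring_hom_one[OF eh] by simp
    also have "\<dots> = (Q.eval u y \<otimes>\<^bsub>Q\<^esub> Q.eval m y) \<oplus>\<^bsub>Q\<^esub> (Q.eval v y \<otimes>\<^bsub>Q\<^esub> Q.eval (Q.formal_derivative m) y)"
      using ring_hom_add[OF eh, of "u \<otimes>\<^bsub>k[X]\<^bsub>Q\<^esub>\<^esub> m" "v \<otimes>\<^bsub>k[X]\<^bsub>Q\<^esub>\<^esub> Q.formal_derivative m"]
        ring_hom_mult[OF eh, of u m] ring_hom_mult[OF eh, of v "Q.formal_derivative m"] uv(1,2) m(1) dm_carrier
      by simp
    also have "\<dots> = \<zero>\<^bsub>Q\<^esub>" unfolding m(2) d0 using c by simp
    finally show False using Q.one_not_zero by simp
  qed
  moreover have "poly P x \<in> M" using ev phi_zero_iff[OF PxS] by simp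
  ultimately show ?thesis using PV by blast
qed

end

text \<open>As \<open>p\<close> generates the radical of \<open>V\<close>, containment of the
  radical in \<open>M\<close> or in its square is decided by \<open>p\<close> alone: two products
  summing to \<open>p\<close> would put every multiple \<open>x * p\<close> into the square.\<close>

lemma unramified_setting_if_unramified:
  assumes "galois_setting V p \<G>" and jac: "jacobson_radical (ring_on V) = {x * p | x. x \<in> V}"
    and unram: "unramified V (integral_closure V)"
  shows "unramified_setting V p \<G>"
proof -
  interpret galois_setting V p \<G> by (rule assms(1))
  have ideal: "ideal M (ring_on S)" if "max_ideal M" for M
    using that by (simp add: max_ideal_def maximalideal_def)
  have ram: "jacobson_radical (ring_on V) \<subseteq> M" "\<not> jacobson_radical (ring_on V) \<subseteq> M \<cdot>\<^bsub>ring_on S\<^esub> M"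
    "ring.separable_extension (ring_on S Quot M) ((\<lambda>v. M +>\<^bsub>ring_on S\<^esub> v) ` V)" if M: "max_ideal M" for M
  proof -
    have "has_ramification_index V S M 1" and sep: "ring.separable_extension (ring_on S Quot M) ((\<lambda>v. M +>\<^bsub>ring_on S\<^esub> v) ` V)"
      using unram M by (auto simp: unramified_def max_ideal_def)
    then show "jacobson_radical (ring_on V) \<subseteq> M" "\<not> jacobson_radical (ring_on V) \<subseteq> M \<cdot>\<^bsub>ring_on S\<^esub> M"
      using S.ideal_power_1[OF ideal[OF M]] S.ideal_power_2[OF ideal[OF M]]
      by (simp_all add: has_ramification_index_def numeral_2_eq_2)
    show "ring.separable_extension (ring_on S Quot M) ((\<lambda>v. M +>\<^bsub>ring_on S\<^esub> v) ` V)" by (rule sep)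
  qed
  have pM: "p \<in> M" if "max_ideal M" for M
  proof -
    have "p \<in> jacobson_radical (ring_on V)" unfolding jac by (auto intro!: exI[of _ 1])
    then show ?thesis using ram(1)[OF that] by blast
  qed
  show ?thesis
  proof
    fix M assume M: "max_ideal M"
    show "p \<in> M" by (rule pM[OF M])
    show "\<exists>P. (\<forall>i. poly.coeff P i \<in> V) \<and> poly P x \<in> M \<and> poly (pderiv P) x \<notin> M" if "x \<in> S" for x
      by (rule separable_extension_lift[OF M pM[OF M] that ram(3)[OF M]])
    fix a b c d assume abcd: "a \<in> M" "b \<in> M" "c \<in> M" "d \<in> M"
    show "p \<noteq> a * b + c * d"
    proof
      assume eq: "p = a * b + c * d"
      have "x * p \<in> M \<cdot>\<^bsub>ring_on S\<^esub> M" if "x \<in> V" for x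
      proof -
        have xS: "x \<in> S" using that V_subset_S by blast
        have "(x * a) \<otimes>\<^bsub>ring_on S\<^esub> b \<oplus>\<^bsub>ring_on S\<^esub> (x * c) \<otimes>\<^bsub>ring_on S\<^esub> d \<in> M \<cdot>\<^bsub>ring_on S\<^esub> M"
          using abcd max_ideal_mult[OF M xS] by (intro ideal_prod.sum ideal_prod.prod)
        then show ?thesis unfolding eq by (simp add: algebra_simps)
      qed
      then have "jacobson_radical (ring_on V) \<subseteq> M \<cdot>\<^bsub>ring_on S\<^esub> M" unfolding jac by auto
      then show False using ram(2)[OF M] by blast
    qed
  qed
qed

lemma (in unramified_setting) mem_square_iff:
  assumes M: "max_ideal M" and x: "x \<in> S" "x \<noteq> 0"
  shows "x \<in> ideal_power (ring_on S) M 2 \<longleftrightarrow> 2 \<le> val M x"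
proof -
  have ideal: "ideal M (ring_on S)" using M by (simp add: max_ideal_def maximalideal_def)
  have "val_ge M 2 z" if "z \<in> M \<cdot>\<^bsub>ring_on S\<^esub> M" for z
    using that
  proof (induction rule: ideal_prod.induct)
    case (prod i j)
    then have "val_ge M 1 i" "val_ge M 1 j"
      using max_ideal_iff_val_ge[OF M] max_ideal_subset[OF M] by auto
    then show ?case using val_ge_mult[OF M, of 1 i 1 j] by simp
  next
    case (sum s t)
    then show ?case using val_ge_add[OF M] by simp
  qed
  moreover have "x \<in> M \<cdot>\<^bsub>ring_on S\<^esub> M" if ge: "val_ge M 2 x"
  proof -
    obtain a b c d where abcd: "a \<in> M" "b \<in> M" "c \<in> M" "d \<in> M" "x = a * b + c * d"
      using val_ge_2_product[OF M x(1) ge] by blast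
    have "a \<otimes>\<^bsub>ring_on S\<^esub> b \<oplus>\<^bsub>ring_on S\<^esub> c \<otimes>\<^bsub>ring_on S\<^esub> d \<in> M \<cdot>\<^bsub>ring_on S\<^esub> M"
      using abcd by (intro ideal_prod.sum ideal_prod.prod)
    then show ?thesis unfolding abcd(5) by simp
  qed
  ultimately show ?thesis
    unfolding S.ideal_power_2[OF ideal] using x(2) by (auto simp: val_ge_def)
qed

section \<open>Right cosets of the decomposition group\<close>

context crossed_setting
begin

lemma inv_G: "\<sigma> \<in> \<G> \<Longrightarrow> inv\<^bsub>G\<^esub> \<sigma> = finv \<sigma>"
proof -
  assume s: "\<sigma> \<in> \<G>"
  show ?thesis
    unfolding m_inv_def
  proof (rule the_equality)
    show "finv \<sigma> \<in> carrier G \<and> \<sigma> \<otimes>\<^bsub>G\<^esub> finv \<sigma> = \<one>\<^bsub>G\<^esub> \<and> finv \<sigma> \<otimes>\<^bsub>G\<^esub> \<sigma> = \<one>\<^bsub>G\<^esub>"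
      using s inv_mem by simp
    fix \<tau> assume "\<tau> \<in> carrier G \<and> \<sigma> \<otimes>\<^bsub>G\<^esub> \<tau> = \<one>\<^bsub>G\<^esub> \<and> \<tau> \<otimes>\<^bsub>G\<^esub> \<sigma> = \<one>\<^bsub>G\<^esub>"
    then have "finv \<sigma> \<circ> (\<sigma> \<circ> \<tau>) = finv \<sigma>" by simp
    then show "\<tau> = finv \<sigma>" using s comp_inv_left(2) by metis
  qed
qed

text \<open>\<open>\<sigma> \<circ> finv g\<close> stabilises \<open>M\<close> exactly when
  \<open>\<sigma>\<close> and \<open>g\<close> have the same preimage of \<open>M\<close>. Right
  cosets are thus labelled by conjugates of \<open>M\<close>.\<close>

lemma r_coset_decomposition_group:
  assumes g: "g \<in> \<G>"
  shows "decomposition_group G M #>\<^bsub>G\<^esub> g = {\<sigma> \<in> \<G>. finv \<sigma> ` M = finv g ` M}"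
proof (intro equalityI subsetI)
  fix \<sigma> assume "\<sigma> \<in> decomposition_group G M #>\<^bsub>G\<^esub> g"
  then obtain \<delta> where d: "\<delta> \<in> \<G>" "\<delta> ` M = M" "\<sigma> = \<delta> \<circ> g"
    by (auto simp: r_coset_def decomposition_group_def)
  then have "finv \<delta> ` M = M" using image_comp_inv(1)[OF d(1), of M] by simp
  moreover have "finv \<sigma> ` M = finv g ` (finv \<delta> ` M)" using d g by (simp add: inv_comp image_comp)
  ultimately show "\<sigma> \<in> {\<sigma> \<in> \<G>. finv \<sigma> ` M = finv g ` M}" using d g comp_mem by simp
next
  fix \<sigma> assume "\<sigma> \<in> {\<sigma> \<in> \<G>. finv \<sigma> ` M = finv g ` M}"
  then have s: "\<sigma> \<in> \<G>" "finv \<sigma> ` M = finv g ` M" by auto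
  have "(\<sigma> \<circ> finv g) ` M = \<sigma> ` (finv g ` M)" by (rule image_comp[symmetric])
  also have "\<dots> = M" using s image_comp_inv(2)[OF s(1), of M] by simp
  finally have "\<sigma> \<circ> finv g \<in> decomposition_group G M"
    using s g inv_mem comp_mem by (simp add: decomposition_group_def)
  moreover have "\<sigma> = (\<sigma> \<circ> finv g) \<otimes>\<^bsub>G\<^esub> g" using g by simp
  ultimately show "\<sigma> \<in> decomposition_group G M #>\<^bsub>G\<^esub> g" unfolding r_coset_def by blast
qed

text \<open>One element with \<open>Q\<close> in every coset suffices. The choice \<open>r\<close>
  depends only on the conjugate of \<open>M\<close> that labels the coset, so distinct members of
  \<open>T\<close> have disjoint cosets.\<close>

lemma right_coset_representatives_iff:
  "(\<exists>T. right_coset_representatives G (decomposition_group G M) T \<and> (\<forall>g\<in>T. Q g)) \<longleftrightarrow>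
    (\<forall>\<sigma>\<in>\<G>. \<exists>g\<in>\<G>. finv g ` M = finv \<sigma> ` M \<and> Q g)"
proof
  assume "\<exists>T. right_coset_representatives G (decomposition_group G M) T \<and> (\<forall>g\<in>T. Q g)"
  then obtain T where T: "T \<subseteq> \<G>" "(\<Union>g\<in>T. decomposition_group G M #>\<^bsub>G\<^esub> g) = \<G>" "\<And>g. g \<in> T \<Longrightarrow> Q g"
    by (auto simp: right_coset_representatives_def)
  show "\<forall>\<sigma>\<in>\<G>. \<exists>g\<in>\<G>. finv g ` M = finv \<sigma> ` M \<and> Q g"
  proof
    fix \<sigma> assume "\<sigma> \<in> \<G>"
    then obtain g where g: "g \<in> T" "\<sigma> \<in> decomposition_group G M #>\<^bsub>G\<^esub> g" using T(2) by blast
    moreover then have "g \<in> \<G>" using T(1) by blast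
    ultimately show "\<exists>g\<in>\<G>. finv g ` M = finv \<sigma> ` M \<and> Q g"
      using T(3) by (auto simp: r_coset_decomposition_group intro!: bexI[of _ g])
  qed
next
  assume all: "\<forall>\<sigma>\<in>\<G>. \<exists>g\<in>\<G>. finv g ` M = finv \<sigma> ` M \<and> Q g"
  have "\<forall>N\<in>(\<lambda>\<sigma>. finv \<sigma> ` M) ` \<G>. \<exists>g. g \<in> \<G> \<and> finv g ` M = N \<and> Q g" using all by auto
  then obtain r where r: "\<And>N. N \<in> (\<lambda>\<sigma>. finv \<sigma> ` M) ` \<G> \<Longrightarrow> r N \<in> \<G> \<and> finv (r N) ` M = N \<and> Q (r N)"
    by metis
  define T where "T = r ` (\<lambda>\<sigma>. finv \<sigma> ` M) ` \<G>"
  have T: "T \<subseteq> \<G>" and Q: "\<forall>g\<in>T. Q g" using r by (auto simp: T_def)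
  have coset: "decomposition_group G M #>\<^bsub>G\<^esub> g = {\<sigma> \<in> \<G>. finv \<sigma> ` M = finv g ` M}" if "g \<in> T" for g
    using r_coset_decomposition_group T that by blast
  have "(\<Union>g\<in>T. decomposition_group G M #>\<^bsub>G\<^esub> g) = \<G>"
  proof (intro equalityI subsetI)
    fix \<sigma> assume s: "\<sigma> \<in> \<G>"
    then have "r (finv \<sigma> ` M) \<in> T" by (auto simp: T_def)
    moreover have "finv (r (finv \<sigma> ` M)) ` M = finv \<sigma> ` M" using r s by blast
    ultimately have "\<sigma> \<in> decomposition_group G M #>\<^bsub>G\<^esub> r (finv \<sigma> ` M)" using coset s by simp
    then show "\<sigma> \<in> (\<Union>g\<in>T. decomposition_group G M #>\<^bsub>G\<^esub> g)"
      using \<open>r (finv \<sigma> ` M) \<in> T\<close> by blast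
  qed (use coset in auto)
  moreover have "(decomposition_group G M #>\<^bsub>G\<^esub> g) \<inter> (decomposition_group G M #>\<^bsub>G\<^esub> h) = {}"
    if gh: "g \<in> T" "h \<in> T" "g \<noteq> h" for g h
  proof -
    have "r (finv g ` M) = g" "r (finv h ` M) = h" using gh r by (auto simp: T_def)
    then have "finv g ` M \<noteq> finv h ` M" using gh(3) by auto
    then show ?thesis using coset gh by auto
  qed
  ultimately have "right_coset_representatives G (decomposition_group G M) T"
    using T by (simp add: right_coset_representatives_def)
  then show "\<exists>T. right_coset_representatives G (decomposition_group G M) T \<and> (\<forall>g\<in>T. Q g)"
    using Q by blast
qed

lemma decomposition_iff:
  assumes "\<sigma> \<in> \<G>" "g \<in> \<G>"
  shows "(\<exists>\<delta>\<in>\<G>. \<delta> ` M = M \<and> \<sigma> = \<delta> \<circ> g) \<longleftrightarrow> finv g ` M = finv \<sigma> ` M"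
proof -
  have "(\<exists>\<delta>\<in>\<G>. \<delta> ` M = M \<and> \<sigma> = \<delta> \<circ> g) \<longleftrightarrow> \<sigma> \<in> decomposition_group G M #>\<^bsub>G\<^esub> g"
    by (auto simp: r_coset_def decomposition_group_def)
  then show ?thesis using r_coset_decomposition_group[OF assms(2)] assms(1) by auto
qed

lemma not_square_iff:
  assumes "max_ideal M" "\<tau> \<in> \<G>"
  shows "f \<tau> (inv\<^bsub>G\<^esub> \<tau>) \<notin> ideal_power (ring_on S) M 2 \<longleftrightarrow> val M (f \<tau> (finv \<tau>)) \<le> 1"
  using mem_square_iff[OF assms(1)] f_S f_nonzero inv_mem assms(2) by (auto simp: inv_G)

lemma not_max_ideal_iff:
  assumes "max_ideal M" "\<tau> \<in> \<G>"
  shows "f \<tau> (inv\<^bsub>G\<^esub> \<tau>) \<notin> M \<longleftrightarrow> val M (f \<tau> (finv \<tau>)) = 0"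
proof -
  have "0 \<le> val M (f \<tau> (finv \<tau>))" using val_f_nonneg[OF assms] inv_mem assms(2) by blast
  moreover have "f \<tau> (finv \<tau>) \<in> M \<longleftrightarrow> 0 < val M (f \<tau> (finv \<tau>))"
    using max_ideal_iff_val[OF assms(1)] f_S f_nonzero inv_mem assms(2) by blast
  ultimately show ?thesis using assms(2) by (auto simp: inv_G)
qed

lemma coset_condition_iff:
  assumes M: "max_ideal M"
  shows "(\<exists>T. right_coset_representatives G (decomposition_group G M) T \<and> (\<forall>g\<in>T. f g (inv\<^bsub>G\<^esub> g) \<notin> M)) \<longleftrightarrow>
    (\<forall>\<sigma>\<in>\<G>. \<exists>g\<in>\<G>. \<exists>\<delta>\<in>\<G>. \<delta> ` M = M \<and> \<sigma> = \<delta> \<circ> g \<and> val M (f g (finv g)) = 0)"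
proof -
  have "(\<exists>\<delta>\<in>\<G>. \<delta> ` M = M \<and> \<sigma> = \<delta> \<circ> g \<and> val M (f g (finv g)) = 0) \<longleftrightarrow>
      finv g ` M = finv \<sigma> ` M \<and> f g (inv\<^bsub>G\<^esub> g) \<notin> M" if "\<sigma> \<in> \<G>" "g \<in> \<G>" for \<sigma> g
    using decomposition_iff[OF that, of M] not_max_ideal_iff[OF M that(2)] by blast
  then show ?thesis unfolding right_coset_representatives_iff by simp
qed

theorem maximal_order_iff:
  "is_maximal_order V fractions A A0 \<longleftrightarrow>
    (\<forall>M. maximalideal M (ring_on S) \<longrightarrow>
      (\<forall>\<tau>\<in>carrier G. f \<tau> (inv\<^bsub>G\<^esub> \<tau>) \<notin> ideal_power (ring_on S) M 2) \<and>
      (\<exists>T. right_coset_representatives G (decomposition_group G M) T \<and> (\<forall>g\<in>T. f g (inv\<^bsub>G\<^esub> g) \<notin> M)))"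
  unfolding maximal_iff max_ideal_def[symmetric] using coset_condition_iff not_square_iff by simp

text \<open>With a single maximal ideal the decomposition group is everything and the identity
  represents its only coset. There \<open>f id id = 1\<close> is a unit, which leaves only the
  condition on squares.\<close>

theorem maximal_order_iff_local:
  assumes "discrete_valuation_ring (ring_on S)"
  shows "is_maximal_order V fractions A A0 \<longleftrightarrow>
    (\<forall>\<tau>\<in>carrier G. f \<tau> (inv\<^bsub>G\<^esub> \<tau>) \<notin> ideal_power (ring_on S) (jacobson_radical (ring_on S)) 2)"
proof -
  obtain M where M: "max_ideal M" "\<And>N. max_ideal N \<Longrightarrow> N = M"
    using assms unfolding discrete_valuation_ring_def max_ideal_def by blast
  have "{N. maximalideal N (ring_on S)} = {M}" using M unfolding max_ideal_def by blast
  then have "jacobson_radical (ring_on S) = S \<inter> M" by (simp add: jacobson_radical_def)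
  then have "jacobson_radical (ring_on S) = M" using max_ideal_subset[OF M(1)] by blast
  moreover have "\<sigma> ` M = M" if "\<sigma> \<in> \<G>" for \<sigma> using M max_ideal_hom that by blast
  then have "\<exists>g\<in>\<G>. \<exists>\<delta>\<in>\<G>. \<delta> ` M = M \<and> \<sigma> = \<delta> \<circ> g \<and> val M (f g (finv g)) = 0" if "\<sigma> \<in> \<G>" for \<sigma>
    using that val_one[OF M(1)] by (intro bexI[of _ id] bexI[of _ \<sigma>]) (auto simp: inv_id)
  ultimately show ?thesis
    unfolding maximal_iff using M not_square_iff[OF M(1)] by (metis partial_object.select_convs(1))
qed

end

theorem corollary2:
  fixes F V S :: "'k::field set"
    and G :: "('k \<Rightarrow> 'k) monoid"
    and f :: "('k \<Rightarrow> 'k) \<Rightarrow> ('k \<Rightarrow> 'k) \<Rightarrow> 'k"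
  assumes "discrete_valuation_ring (ring_on V)"
    and "is_quotient_field V F"
    and "finite_galois F"
    and "G = galois_group F"
    and "S = integral_closure V"
    and "unramified V S"
    and "normalized_cocycle G f"
    and "\<forall>\<sigma>\<in>carrier G. \<forall>\<tau>\<in>carrier G. f \<sigma> \<tau> \<in> S - {0}"
  shows "(is_maximal_order V F (crossed_product G f) (crossed_product_order S G f) \<longleftrightarrow>
           (\<forall>M. maximalideal M (ring_on S) \<longrightarrow>
              (\<forall>\<tau>\<in>carrier G. f \<tau> (inv\<^bsub>G\<^esub> \<tau>) \<notin> ideal_power (ring_on S) M 2) \<and>
              (\<exists>T. right_coset_representatives G (decomposition_group G M) T \<and>
                 (\<forall>g\<in>T. f g (inv\<^bsub>G\<^esub> g) \<notin> M)))) \<and>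
         (discrete_valuation_ring (ring_on S) \<longrightarrow>
           (is_maximal_order V F (crossed_product G f) (crossed_product_order S G f) \<longleftrightarrow>
             (\<forall>\<tau>\<in>carrier G.
                f \<tau> (inv\<^bsub>G\<^esub> \<tau>) \<notin> ideal_power (ring_on S) (jacobson_radical (ring_on S)) 2)))"
proof -
  obtain p where p: "dvr_subring V p" "jacobson_radical (ring_on V) = {x * p | x. x \<in> V}"
    using discrete_valuation_ring_uniformizer[OF assms(1)] by blast
  define \<G> where "\<G> = galois_auts F"
  have G: "G = \<lparr>carrier = \<G>, monoid.mult = (\<circ>), one = id\<rparr>"
    using assms(4) by (simp add: \<G>_def galois_auts_def galois_group_def)
  have "galois_setting V p \<G>"
    unfolding \<G>_def by (rule galois_setting_galois_auts[OF p(1) assms(2,3)])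
  then interpret U: unramified_setting V p \<G>
    using p(2) assms(5,6) by (intro unramified_setting_if_unramified) simp_all
  interpret C: crossed_setting V p \<G> f
    by unfold_locales (use assms(5,7,8) in \<open>auto simp: G normalized_cocycle_def\<close>)
  have F: "F = U.fractions" using assms(2) by (simp add: is_quotient_field_def U.fractions_def)
  show ?thesis
    unfolding assms(5) F G C.A_def[symmetric] C.A0_def[symmetric]
    using C.maximal_order_iff C.maximal_order_iff_local by blast
qed

end
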